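(* Let $\mu>0$ and $\lambda>1$. Suppose $\operatorname{supp}\rho_0,\ \operatorname{supp}u_0\subseteq\{x\in\mathbb R^3: |x|\le M\}$, and suppose that, for some fixed constant $M_0$ with $0\le M_0<M$ (and for all sufficiently small $\varepsilon>0$), $$q_0(l)>0\quad\text{and}\quad q_1(l)\ge 0\qquad\text{for all } l\in(M_0,M),$$ where $$q_0(l)=\int_{|x|>l}\frac{(|x|-l)^2}{|x|}\bigl(\rho(0,x)-\bar\rho\bigr)\,dx,\qquad q_1(l)=\int_{|x|>l}\frac{|x|^2-l^2}{|x|^3}\,x\cdot(\rho u)(0,x)\,dx .$$ Then there exists an $\varepsilon_0>0$ such that, for $0<\varepsilon\le\varepsilon_0$, the lifespan $T_\varepsilon$ of the smooth solution $(\rho,u)$ of $$\partial_t\rho+\operatorname{div}(\rho u)=0,\qquad \partial_t(\rho u)+\operatorname{div}(\rho u\otimes u+p\,I_3)=-\frac{\mu}{(1+t)^\lambda}\rho u,$$ $$\rho(0,x)=\bar\rho+\varepsilon\rho_0(x),\qquad u(0,x)=\varepsilon u_0(x)$$ is finite.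
   Context: Here $x\in\mathbb R^3$, $\rho$ is the density, $u=(u_1,u_2,u_3)$ the velocity, $I_3$ the $3\times 3$ identity matrix, and $p=p(\rho)=A\rho^\gamma$ the pressure with constants $A>0$, $\gamma>1$. $\bar\rho>0$ is a constant; $\rho_0\in C_0^\infty(\mathbb R^3)$, $u_0\in C_0^\infty(\mathbb R^3;\mathbb R^3)$ are fixed, $(\rho_0,u_0)\not\equiv0$, $\rho(0,\cdot)>0$. No assumption on $\operatorname{curl}u_0$ is made. The lifespan $T_\varepsilon\in(0,\infty]$ is the supremum of the times $T$ such that the Cauchy problem has a smooth solution on $[0,T]\times\mathbb R^3$. *)

theory Defs
  imports "HOL-Analysis.Analysis"
begin

(* Differentiability is taken within S, so that on a closed slab {0..T} x R^3 with T > 0 (convex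
   with nonempty interior, hence with unique derivatives) C^infinity includes one-sided
   smoothness at t = 0 and t = T. *)

primrec Ck_on :: "nat \<Rightarrow> 'a set \<Rightarrow> ('a::real_normed_vector \<Rightarrow> 'b::real_normed_vector) \<Rightarrow> bool" where
  "Ck_on 0 S f \<longleftrightarrow> continuous_on S f"
| "Ck_on (Suc k) S f \<longleftrightarrow>
     (\<exists>f'. (\<forall>x\<in>S. (f has_derivative f' x) (at x within S)) \<and> (\<forall>v. Ck_on k S (\<lambda>x. f' x v)))"

definition smooth_on :: "'a set \<Rightarrow> ('a::real_normed_vector \<Rightarrow> 'b::real_normed_vector) \<Rightarrow> bool" where
  "smooth_on S f \<longleftrightarrow> (\<forall>k. Ck_on k S f)"

definition supp :: "('a::topological_space \<Rightarrow> 'b::zero) \<Rightarrow> 'a set" where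
  "supp f = closure {x. f x \<noteq> 0}"

definition smooth_compact_support :: "('a::real_normed_vector \<Rightarrow> 'b::real_normed_vector) \<Rightarrow> bool" where
  "smooth_compact_support f \<longleftrightarrow> smooth_on UNIV f \<and> compact (supp f)"

definition partial :: "'n::finite \<Rightarrow> (real^'n \<Rightarrow> real) \<Rightarrow> real^'n \<Rightarrow> real" where
  "partial i f x = deriv (\<lambda>h. f (x + h *\<^sub>R axis i 1)) 0"

definition divergence :: "(real^'n \<Rightarrow> real^'n) \<Rightarrow> real^'n::finite \<Rightarrow> real" where
  "divergence v x = (\<Sum>i\<in>UNIV. partial i (\<lambda>y. v y $ i) x)"

definition matrix_divergence :: "(real^'n \<Rightarrow> real^'n^'n) \<Rightarrow> real^'n::finite \<Rightarrow> real^'n" where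
  "matrix_divergence m x = (\<chi> j. divergence (\<lambda>y. m y $ j) x)"

definition tensor :: "real^'n \<Rightarrow> real^'n \<Rightarrow> real^'n^'n" (infixl "\<otimes>\<^sub>v" 72) where
  "v \<otimes>\<^sub>v w = (\<chi> i j. v $ i * w $ j)"

definition time_deriv ::
    "real \<Rightarrow> (real \<Rightarrow> 'a \<Rightarrow> 'b::real_normed_vector) \<Rightarrow> real \<Rightarrow> 'a \<Rightarrow> 'b" where
  "time_deriv T f t x = vector_derivative (\<lambda>s. f s x) (at t within {0..T})"

definition pressure :: "real \<Rightarrow> real \<Rightarrow> real \<Rightarrow> real" where
  "pressure A \<gamma> r = A * r powr \<gamma>"

definition init_density :: "real \<Rightarrow> (real^3 \<Rightarrow> real) \<Rightarrow> real \<Rightarrow> real^3 \<Rightarrow> real" where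
  "init_density \<rho>bar \<rho>0 \<epsilon> x = \<rho>bar + \<epsilon> * \<rho>0 x"

definition init_velocity :: "(real^3 \<Rightarrow> real^3) \<Rightarrow> real \<Rightarrow> real^3 \<Rightarrow> real^3" where
  "init_velocity u0 \<epsilon> x = \<epsilon> *\<^sub>R u0 x"

(* The density is required to be positive, so that A * \<rho> powr \<gamma> is the genuine (and smooth)
   pressure also for non-integer \<gamma>. *)

definition smooth_euler_solution ::
    "real \<Rightarrow> real \<Rightarrow> real \<Rightarrow> real \<Rightarrow> (real^3 \<Rightarrow> real) \<Rightarrow> (real^3 \<Rightarrow> real^3) \<Rightarrow> real \<Rightarrow>
     (real \<Rightarrow> real^3 \<Rightarrow> real) \<Rightarrow> (real \<Rightarrow> real^3 \<Rightarrow> real^3) \<Rightarrow> bool" where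
  "smooth_euler_solution A \<gamma> \<mu> lam r0 v0 T \<rho> u \<longleftrightarrow>
     smooth_on ({0..T} \<times> UNIV) (\<lambda>(t, x). \<rho> t x) \<and>
     smooth_on ({0..T} \<times> UNIV) (\<lambda>(t, x). u t x) \<and>
     (\<forall>t\<in>{0..T}. \<forall>x. 0 < \<rho> t x) \<and>
     (\<forall>t\<in>{0..T}. \<forall>x.
        time_deriv T \<rho> t x + divergence (\<lambda>y. \<rho> t y *\<^sub>R u t y) x = 0) \<and>
     (\<forall>t\<in>{0..T}. \<forall>x.
        time_deriv T (\<lambda>s y. \<rho> s y *\<^sub>R u s y) t x
        + matrix_divergence (\<lambda>y. \<rho> t y *\<^sub>R (u t y \<otimes>\<^sub>v u t y) + pressure A \<gamma> (\<rho> t y) *\<^sub>R mat 1) x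
        = - (\<mu> / (1 + t) powr lam) *\<^sub>R (\<rho> t x *\<^sub>R u t x)) \<and>
     (\<forall>x. \<rho> 0 x = r0 x) \<and>
     (\<forall>x. u 0 x = v0 x)"

definition lifespan ::
    "real \<Rightarrow> real \<Rightarrow> real \<Rightarrow> real \<Rightarrow> (real^3 \<Rightarrow> real) \<Rightarrow> (real^3 \<Rightarrow> real^3) \<Rightarrow> ennreal" where
  "lifespan A \<gamma> \<mu> lam r0 v0 =
     Sup {ennreal T | T. 0 < T \<and> (\<exists>\<rho> u. smooth_euler_solution A \<gamma> \<mu> lam r0 v0 T \<rho> u)}"

definition q0 :: "real \<Rightarrow> (real^3 \<Rightarrow> real) \<Rightarrow> real \<Rightarrow> real" where
  "q0 \<rho>bar r0 l =
     (LINT x:{x. norm x > l}|lborel. (norm x - l)\<^sup>2 / norm x * (r0 x - \<rho>bar))"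

definition q1 :: "(real^3 \<Rightarrow> real) \<Rightarrow> (real^3 \<Rightarrow> real^3) \<Rightarrow> real \<Rightarrow> real" where
  "q1 r0 v0 l =
     (LINT x:{x. norm x > l}|lborel. ((norm x)\<^sup>2 - l\<^sup>2) / (norm x)^3 * (x \<bullet> (r0 x *\<^sub>R v0 x)))"

end

theory Submission
  imports Defs
begin

text \<open>
  The proof follows Sideris' averaging method. Write n = \<rho> - \<rho>bar, m = \<rho> u,
  c^2 = p'(\<rho>bar), and weigh the surplus of mass outside the ball of radius l by
  P(t, l), the integral of (|x| - l)^2 / |x| * n over |x| > l. The weight has Laplacian 2 / |x|,
  which is also its second derivative in l. Formally the balance laws therefore give the damped
  one-dimensional wave inequality
  P_tt + drag P_t - c^2 P_ll \<ge> (integral of 2 (p - pbar - c^2 n) / |x| over |x| > l) \<ge> 0: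
  the convective term has a sign because the weight is convex, and the last integrand is nonnegative
  because the pressure is a convex function of the density. The quantities q0 and q1 are P and P_t
  at time 0.
  
  Damping. The drag is read as a Poisson clock of rate drag(t) which resets P_t to zero. This turns the
  damped equation into a Duhamel formula, lemma duhamel_inequality, in which damp(T) P(T, L),
  with damp = exp of the integrated drag, dominates the free wave generated by the initial data, plus
  the time integral of damp times the sum of the source and of drag times the average of P over the
  two characteristics through (T, L). All kernels are positive, so P stays nonnegative on l \<ge> y + c t (lemma P_nonneg), and since lam > 1 the factor
  damp is bounded, so that the damping costs only a constant. P is never differentiated twice in l:
  the formula comes from testing mass and momentum against the outgoing and the incoming
  travelling weight and subtracting.
  
  Concentration. By finite speed of propagation, with the exact sound speed c of the background
  (lemma finite_speed), the perturbation at time t lives in |x| \<le> M + c t. Fix y between M0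
  and M. Then p(t) = P(t, y + c t) only sees a shell of width M - y, whose volume is O((1 + t)^2) and
  on which the weight is O(1 / (1 + t)). Jensen's inequality for the convex pressure
  (lemma jensen_excess) bounds the source from below by a power of p, and
  p(t) \<ge> C0 + C (integral over 0 \<le> s \<le> t of min 1 (\<kappa> (t - s)) p(s)^q / (1 + s)),
  where q = min \<gamma> 2 > 1 and C0 > 0 is a multiple of q0(y). The logarithmic divergence of the
  integral of 1 / (1 + s) lets p grow beyond any level, and then the superlinear power makes it infinite
  within a bounded time (lemma superlinear_volterra_blowup). This time depends only on the parameters
  and the data, so it bounds the lifespan.
\<close>

section \<open>C1 functions on a space-time slab\<close>

lemma integral_cbox_supported:
  fixes g :: "'a::euclidean_space \<Rightarrow> real"
  assumes "\<And>x. x \<notin> cbox a b \<Longrightarrow> g x = 0"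
  shows "integral (cbox a b) g = integral UNIV g"
proof -
  have "integral UNIV (\<lambda>x. if x \<in> cbox a b then g x else 0) = integral (cbox a b) g"
    by (rule integral_restrict_UNIV)
  also have "(\<lambda>x. if x \<in> cbox a b then g x else 0) = g" using assms by auto
  finally show ?thesis by simp
qed

text \<open>
  The integral of g(x + h e) does not depend on h, and differentiating it under the integral sign at
  h = 0 gives the claim. This replaces the divergence theorem: all boundary terms below vanish because
  the fields have compact support.
\<close>
lemma integral_directional_derivative_eq_0:
  fixes g :: "'a::euclidean_space \<Rightarrow> real"
  assumes G: "\<And>x. GDERIV g x :> G x" and contG: "continuous_on UNIV G"
    and supp: "\<And>x. norm x > R \<Longrightarrow> g x = 0" and box: "cball 0 (R + 1) \<subseteq> cbox a b"
    and e: "norm e \<le> 1"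
  shows "integral (cbox a b) (\<lambda>x. G x \<bullet> e) = 0"
proof -
  define F where "F h = integral (cbox a b) (\<lambda>x. g (x + h *\<^sub>R e))" for h
  have contg: "continuous_on UNIV g"
    using G unfolding gderiv_def
    by (meson UNIV_I continuous_at_imp_continuous_on has_derivative_continuous)
  have F0: "F h = F 0" if h: "h \<in> {-1..1}" for h
  proof -
    have hn: "norm (h *\<^sub>R e) \<le> 1"
      using h e by (simp add: abs_le_iff mult_le_one)
    have "cbox (a + h *\<^sub>R e) (b + h *\<^sub>R e) = (\<lambda>x. h *\<^sub>R e + x) ` cbox a b"
      using cbox_translation[of "h *\<^sub>R e" a b] by (simp add: add.commute)
    moreover have "x \<in> (\<lambda>x. h *\<^sub>R e + x) ` cbox a b" if "norm x \<le> R" for x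
    proof
      show "x = h *\<^sub>R e + (x - h *\<^sub>R e)" by simp
      have "norm (x - h *\<^sub>R e) \<le> R + 1" using that hn norm_triangle_ineq4[of x "h *\<^sub>R e"] by linarith
      then show "x - h *\<^sub>R e \<in> cbox a b" using box by auto
    qed
    ultimately have z: "g x = 0" if "x \<notin> cbox (a + h *\<^sub>R e) (b + h *\<^sub>R e)" for x
      using that supp[of x] by (metis linorder_not_le)
    have z0: "g x = 0" if "x \<notin> cbox a b" for x
    proof -
      have "x \<notin> cball 0 (R + 1)" using that box by blast
      then show ?thesis using supp[of x] by auto
    qed
    have "(g has_integral integral UNIV g) (cbox (a + h *\<^sub>R e) (b + h *\<^sub>R e))"
      using integrable_integral[OF integrable_continuous[OF continuous_on_subset[OF contg subset_UNIV]]]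
        integral_cbox_supported[of "a + h *\<^sub>R e" "b + h *\<^sub>R e" g] z by metis
    then have "F h = integral UNIV g"
      unfolding F_def has_integral_shift_cbox_iff[symmetric]
      by (intro integral_unique) (simp add: o_def add.commute)
    also have "\<dots> = F 0" using integral_cbox_supported[of a b g] z0 by (simp add: F_def)
    finally show ?thesis .
  qed
  have "((\<lambda>h. integral (cbox a b) (\<lambda>x. g (x + h *\<^sub>R e))) has_field_derivative
      integral (cbox a b) (\<lambda>x. G (x + 0 *\<^sub>R e) \<bullet> e)) (at 0 within {-1..1})"
  proof (rule leibniz_rule_field_derivative)
    fix h :: real and x
    have "((\<lambda>h. g (x + h *\<^sub>R e)) has_derivative (\<lambda>d. (d *\<^sub>R e) \<bullet> G (x + h *\<^sub>R e))) (at h)"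
      by (rule has_derivative_compose[where g = g and f = "\<lambda>h. x + h *\<^sub>R e"])
         (auto intro!: derivative_eq_intros G[unfolded gderiv_def])
    then show "((\<lambda>h. g (x + h *\<^sub>R e)) has_field_derivative G (x + h *\<^sub>R e) \<bullet> e) (at h within {-1..1})"
      unfolding has_field_derivative_def
      by (rule has_derivative_at_withinI[THEN has_derivative_eq_rhs]) (auto simp: inner_commute mult.commute)
  next
    show "(\<lambda>x. g (x + h *\<^sub>R e)) integrable_on cbox a b" for h
      by (intro integrable_continuous continuous_on_compose2[OF contg] continuous_intros) auto
    show "continuous_on ({-1..1} \<times> cbox a b) (\<lambda>(h, x). G (x + h *\<^sub>R e) \<bullet> e)"
      unfolding case_prod_beta
      by (intro continuous_intros continuous_on_compose2[OF contG]) auto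
  qed auto
  then have "(F has_field_derivative integral (cbox a b) (\<lambda>x. G x \<bullet> e)) (at 0 within {-1..1})"
    by (simp add: F_def[abs_def])
  moreover have "(F has_field_derivative 0) (at 0 within {-1..1})"
  proof (rule has_field_derivative_transform_within)
    show "((\<lambda>_. F 0) has_field_derivative 0) (at 0 within {-1..1})" by (rule DERIV_const)
    show "F 0 = F h" if "h \<in> {-1..1}" for h using F0[OF that] by (rule sym)
  qed (auto intro: zero_less_one)
  moreover have "at 0 within {-1..1} = at (0::real)" by (rule at_within_interior) simp
  ultimately show ?thesis using DERIV_unique by metis
qed

text \<open>
  Only first derivatives of the solution enter the argument. The derivatives are carried as explicit
  arguments, so that composing the closure rules below computes them; the time derivative is
  one-sided at t = 0 and t = T.
\<close>
definition C1_slab ::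
    "real \<Rightarrow> (real \<Rightarrow> 'a::euclidean_space \<Rightarrow> real) \<Rightarrow> (real \<Rightarrow> 'a \<Rightarrow> real) \<Rightarrow> (real \<Rightarrow> 'a \<Rightarrow> 'a) \<Rightarrow> bool"
  where "C1_slab T f f\<^sub>t f\<^sub>x \<longleftrightarrow>
    continuous_on ({0..T} \<times> UNIV) (\<lambda>z. f (fst z) (snd z)) \<and>
    continuous_on ({0..T} \<times> UNIV) (\<lambda>z. f\<^sub>t (fst z) (snd z)) \<and>
    continuous_on ({0..T} \<times> UNIV) (\<lambda>z. f\<^sub>x (fst z) (snd z)) \<and>
    (\<forall>t\<in>{0..T}. \<forall>x. ((\<lambda>s. f s x) has_real_derivative f\<^sub>t t x) (at t within {0..T}) \<and>
      GDERIV (f t) x :> f\<^sub>x t x)"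

lemma C1_slabD:
  assumes "C1_slab T f ft fx"
  shows "continuous_on ({0..T} \<times> UNIV) (\<lambda>z. f (fst z) (snd z))"
    "continuous_on ({0..T} \<times> UNIV) (\<lambda>z. ft (fst z) (snd z))"
    "continuous_on ({0..T} \<times> UNIV) (\<lambda>z. fx (fst z) (snd z))"
    "t \<in> {0..T} \<Longrightarrow> ((\<lambda>s. f s x) has_real_derivative ft t x) (at t within {0..T})"
    "t \<in> {0..T} \<Longrightarrow> GDERIV (f t) x :> fx t x"
  using assms by (auto simp: C1_slab_def)

lemma C1_slab_cong:
  assumes "C1_slab T f ft fx"
    and "\<And>t x. t \<in> {0..T} \<Longrightarrow> f' t x = f t x" "\<And>t x. t \<in> {0..T} \<Longrightarrow> ft' t x = ft t x"
    and "\<And>t x. t \<in> {0..T} \<Longrightarrow> fx' t x = fx t x"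
  shows "C1_slab T f' ft' fx'"
  unfolding C1_slab_def
proof (intro conjI ballI allI)
  fix t x assume t: "t \<in> {0..T}"
  show "((\<lambda>s. f' s x) has_real_derivative ft' t x) (at t within {0..T})"
    unfolding assms(3)[OF t]
  proof (rule has_field_derivative_transform_within[OF C1_slabD(4)[OF assms(1) t, of x] zero_less_one t])
    show "f s x = f' s x" if "s \<in> {0..T}" for s using assms(2)[OF that] by (rule sym)
  qed
  have "f' t = f t" using assms(2)[OF t] by auto
  then show "GDERIV (f' t) x :> fx' t x"
    using C1_slabD(5)[OF assms(1) t, of x] unfolding assms(4)[OF t] by simp
next
  show "continuous_on ({0..T} \<times> UNIV) (\<lambda>z. f' (fst z) (snd z))"
    using C1_slabD(1)[OF assms(1)] by (rule continuous_on_eq) (auto simp: assms)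
  show "continuous_on ({0..T} \<times> UNIV) (\<lambda>z. ft' (fst z) (snd z))"
    using C1_slabD(2)[OF assms(1)] by (rule continuous_on_eq) (auto simp: assms)
  show "continuous_on ({0..T} \<times> UNIV) (\<lambda>z. fx' (fst z) (snd z))"
    using C1_slabD(3)[OF assms(1)] by (rule continuous_on_eq) (auto simp: assms)
qed

lemma C1_slab_const: "C1_slab T (\<lambda>_ _. c) (\<lambda>_ _. 0) (\<lambda>_ _. 0)"
  by (auto simp: C1_slab_def GDERIV_const)

lemma C1_slab_add:
  assumes "C1_slab T f ft fx" "C1_slab T g gt gx"
  shows "C1_slab T (\<lambda>t x. f t x + g t x) (\<lambda>t x. ft t x + gt t x) (\<lambda>t x. fx t x + gx t x)"
  using assms unfolding C1_slab_def
  by (auto intro!: continuous_intros derivative_intros GDERIV_add)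

lemma C1_slab_mult:
  assumes "C1_slab T f ft fx" "C1_slab T g gt gx"
  shows "C1_slab T (\<lambda>t x. f t x * g t x) (\<lambda>t x. ft t x * g t x + f t x * gt t x)
    (\<lambda>t x. f t x *\<^sub>R gx t x + g t x *\<^sub>R fx t x)"
  using assms unfolding C1_slab_def
  by (auto intro!: continuous_intros derivative_eq_intros GDERIV_mult)

lemma C1_slab_cmult:
  assumes "C1_slab T f ft fx"
  shows "C1_slab T (\<lambda>t x. c * f t x) (\<lambda>t x. c * ft t x) (\<lambda>t x. c *\<^sub>R fx t x)"
  using C1_slab_mult[OF C1_slab_const[of T c] assms] by simp

lemma C1_slab_sum:
  assumes "finite I" "\<And>i. i \<in> I \<Longrightarrow> C1_slab T (f i) (ft i) (fx i)"
  shows "C1_slab T (\<lambda>t x. \<Sum>i\<in>I. f i t x) (\<lambda>t x. \<Sum>i\<in>I. ft i t x) (\<lambda>t x. \<Sum>i\<in>I. fx i t x)"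
  using assms by (induction I rule: finite_induct) (auto intro: C1_slab_const C1_slab_add)

lemma C1_slab_compose:
  assumes f: "C1_slab T f ft fx"
    and S: "\<And>t x. t \<in> {0..T} \<Longrightarrow> f t x \<in> S"
    and g: "\<And>y. y \<in> S \<Longrightarrow> (g has_real_derivative g' y) (at y)" "continuous_on S g'"
  shows "C1_slab T (\<lambda>t x. g (f t x)) (\<lambda>t x. g' (f t x) * ft t x) (\<lambda>t x. g' (f t x) *\<^sub>R fx t x)"
  unfolding C1_slab_def
proof (intro conjI ballI allI)
  have "continuous_on S g" using g(1) by (meson DERIV_continuous continuous_at_imp_continuous_on)
  then show "continuous_on ({0..T} \<times> UNIV) (\<lambda>z. g (f (fst z) (snd z)))"
    by (rule continuous_on_compose2[OF _ C1_slabD(1)[OF f]]) (auto simp: S)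
  have *: "continuous_on ({0..T} \<times> UNIV) (\<lambda>z. g' (f (fst z) (snd z)))"
    by (rule continuous_on_compose2[OF g(2) C1_slabD(1)[OF f]]) (auto simp: S)
  show "continuous_on ({0..T} \<times> UNIV) (\<lambda>z. g' (f (fst z) (snd z)) * ft (fst z) (snd z))"
    "continuous_on ({0..T} \<times> UNIV) (\<lambda>z. g' (f (fst z) (snd z)) *\<^sub>R fx (fst z) (snd z))"
    by (intro continuous_intros * C1_slabD[OF f])+
next
  fix t x assume t: "t \<in> {0..T}"
  show "((\<lambda>s. g (f s x)) has_real_derivative g' (f t x) * ft t x) (at t within {0..T})"
    using DERIV_chain2[OF g(1)[OF S[OF t]] C1_slabD(4)[OF f t]] .
  show "GDERIV (\<lambda>x. g (f t x)) x :> g' (f t x) *\<^sub>R fx t x"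
    by (rule GDERIV_DERIV_compose[OF C1_slabD(5)[OF f t] g(1)[OF S[OF t]]])
qed

lemma C1_slab_slice:
  fixes f :: "real \<Rightarrow> 'a::euclidean_space \<Rightarrow> 'b::real_normed_vector"
  assumes "continuous_on ({0..T} \<times> UNIV) (\<lambda>z. f (fst z) (snd z))" "t \<in> {0..T}"
  shows "continuous_on UNIV (f t)"
proof -
  have "continuous_on UNIV (Pair t :: 'a \<Rightarrow> _)" by (intro continuous_intros)
  from continuous_on_compose2[OF assms(1) this] assms(2) show ?thesis
    by (simp add: image_subset_iff)
qed

lemma C1_slab_integrable:
  fixes f :: "real \<Rightarrow> 'a::euclidean_space \<Rightarrow> real"
  assumes "continuous_on ({0..T} \<times> UNIV) (\<lambda>z. f (fst z) (snd z))" "t \<in> {0..T}"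
  shows "(\<lambda>x. f t x) integrable_on cbox a b"
  using integrable_continuous[OF continuous_on_subset[OF C1_slab_slice[OF assms] subset_UNIV]] .

lemma C1_slab_integral_deriv:
  assumes f: "C1_slab T f ft fx" and t: "t \<in> {0..T}"
  shows "((\<lambda>s. integral (cbox a b) (f s)) has_real_derivative integral (cbox a b) (ft t))
           (at t within {0..T})"
  using t
  by (intro leibniz_rule_field_derivative C1_slabD(4)[OF f] C1_slab_integrable[OF C1_slabD(1)[OF f]])
     (auto simp: case_prod_beta intro: continuous_on_subset[OF C1_slabD(2)[OF f]])

lemma C1_slab_subset:
  assumes "C1_slab T f ft fx" "T' \<le> T" shows "C1_slab T' f ft fx"
proof -
  have sub: "{0..T'} \<subseteq> {0..T}" "{0..T'} \<times> UNIV \<subseteq> {0..T} \<times> UNIV" using assms(2) by auto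
  show ?thesis
    using assms(1) sub(1) unfolding C1_slab_def
    by (auto intro: continuous_on_subset[OF _ sub(2)] has_field_derivative_subset[OF _ sub(1)])
qed

lemma Gronwall_zero:
  fixes E :: "real \<Rightarrow> real"
  assumes t: "0 \<le> t" and cont: "continuous_on {0..t} E"
    and E': "\<And>s. \<lbrakk>0 < s; s < t\<rbrakk> \<Longrightarrow> (E has_real_derivative E' s) (at s)"
    and le: "\<And>s. \<lbrakk>0 < s; s < t\<rbrakk> \<Longrightarrow> E' s \<le> K * E s" and 0: "E 0 = 0"
  shows "E t \<le> 0"
proof -
  have "exp (- K * t) * E t \<le> exp (- K * 0) * E 0"
  proof (rule DERIV_nonpos_imp_decreasing_open[OF t])
    fix s assume s: "0 < s" "s < t"
    have "((\<lambda>s. exp (- K * s) * E s) has_real_derivative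
        exp (- K * s) * E' s + (exp (- K * s) * - K) * E s) (at s)"
      by (auto intro!: derivative_eq_intros E'[OF s])
    moreover have "exp (- K * s) * E' s + (exp (- K * s) * - K) * E s = exp (- K * s) * (E' s - K * E s)"
      by (simp add: algebra_simps)
    then have "exp (- K * s) * E' s + (exp (- K * s) * - K) * E s \<le> 0"
      using le[OF s] by (simp add: mult_nonneg_nonpos)
    ultimately show "\<exists>y. ((\<lambda>s. exp (- K * s) * E s) has_real_derivative y) (at s) \<and> y \<le> 0" by blast
  qed (intro continuous_intros cont)
  then have "exp (- K * t) * E t \<le> 0" using 0 by simp
  then show ?thesis by (simp add: mult_le_0_iff)
qed

lemma cball_subset_cbox:
  fixes y :: "'a::euclidean_space"
  obtains a b where "cball y R \<subseteq> cbox a b"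
  using bounded_subset_cbox_symmetric[OF bounded_cball[of y R]] by blast

section \<open>Blow-up for a superlinear Volterra inequality\<close>

text \<open>
  Keeping only the part a \<le> s \<le> b of the integral, where p \<ge> h and where the delay
  weight is at least its value at b.
\<close>
lemma volterra_step:
  fixes p :: "real \<Rightarrow> real"
  assumes "0 \<le> C0" "0 \<le> C" "0 \<le> \<kappa>" "0 \<le> q" "0 < h"
    and p: "continuous_on {0..t} p" "\<And>s. s \<in> {0..t} \<Longrightarrow> 0 < p s"
    and ineq: "p t \<ge> C0 + integral {0..t} (\<lambda>s. C * min 1 (\<kappa> * (t - s)) * p s powr q / (1 + s))"
    and ab: "0 \<le> a" "a \<le> b" "b \<le> t" and ph: "\<And>s. s \<in> {a..b} \<Longrightarrow> h \<le> p s"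
  shows "p t \<ge> C * min 1 (\<kappa> * (t - b)) * h powr q * (ln (1 + b) - ln (1 + a))"
proof -
  let ?f = "\<lambda>s. C * min 1 (\<kappa> * (t - s)) * p s powr q / (1 + s)"
  let ?w = "C * min 1 (\<kappa> * (t - b)) * h powr q"
  have cont: "continuous_on {0..t} ?f"
    using p(2) by (intro continuous_intros p(1)) (force dest: p(2))+
  have nonneg: "0 \<le> ?f s" if "s \<in> {0..t}" for s
    using that assms by auto
  have "((\<lambda>s. ?w * (1 / (1 + s))) has_integral ?w * (ln (1 + b) - ln (1 + a))) {a..b}"
    using ab by (intro has_integral_mult_right fundamental_theorem_of_calculus)
      (auto intro!: derivative_eq_intros simp flip: has_real_derivative_iff_has_vector_derivative)
  moreover have sub: "{a..b} \<subseteq> {0..t}" using ab by auto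
  have int: "?f integrable_on {a..b}" "?f integrable_on {0..t}"
    using continuous_on_subset[OF cont sub] cont by (auto intro: integrable_continuous_real)
  ultimately have "?w * (ln (1 + b) - ln (1 + a)) \<le> integral {a..b} ?f"
  proof (intro has_integral_le[OF _ integrable_integral[OF int(1)]])
    fix s assume s: "s \<in> {a..b}"
    have "\<kappa> * (t - b) \<le> \<kappa> * (t - s)" using s assms by (intro mult_left_mono) auto
    then have "min 1 (\<kappa> * (t - b)) \<le> min 1 (\<kappa> * (t - s))" by linarith
    moreover have "h powr q \<le> p s powr q" using ph[OF s] assms by (intro powr_mono2) auto
    moreover have "0 \<le> min 1 (\<kappa> * (t - b))" "0 \<le> min 1 (\<kappa> * (t - s))"
      using s assms by auto
    ultimately have "?w \<le> C * min 1 (\<kappa> * (t - s)) * p s powr q"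
      using assms by (intro mult_mono mult_left_mono mult_nonneg_nonneg) auto
    then show "?w * (1 / (1 + s)) \<le> ?f s" using s ab by (simp add: divide_right_mono)
  qed
  also have "\<dots> \<le> integral {0..t} ?f"
    using integral_subset_le[OF sub int] nonneg by auto
  finally show ?thesis using ineq assms(1) by linarith
qed

text \<open>
  If p \<ge> h on [a - 1, T], then p reaches 2 h at the latest at time (1 + \<theta>) a - 1, where
  \<theta> may be taken as a negative power of h once h is large. While p doubles k times, the times
  a thus get multiplied by a convergent infinite product, so p would have to be infinite at a finite time.
  The initial level h0, large enough for this to start, is reached because the integral of 1 / (1 + s)
  diverges.
\<close>
lemma superlinear_volterra_blowup:
  fixes C0 C \<kappa> q :: real
  assumes C0: "C0 > 0" and C: "C > 0" and \<kappa>: "\<kappa> > 0" and q: "q > 1"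
  obtains Tmax where "\<And>T p. \<lbrakk>0 \<le> T; continuous_on {0..T} p;
      \<And>t. t \<in> {0..T} \<Longrightarrow>
        p t \<ge> C0 + integral {0..t} (\<lambda>s. C * min 1 (\<kappa> * (t - s)) * p s powr q / (1 + s))\<rbrakk>
      \<Longrightarrow> T \<le> Tmax"
proof -
  \<comment> \<open>With this level the factor gained in a step, C h0^(q - 1) min 1 (\<kappa> / 2), is 8, which leaves room for the factor 2 and for the loss of 1/3 in the logarithm.\<close>
  define h0 where "h0 = (8 / (C * min 1 (\<kappa> / 2))) powr (1 / (q - 1))"
  have h0: "h0 > 0" using C \<kappa> by (simp add: h0_def)
  have h0q: "C * h0 powr (q - 1) * min 1 (\<kappa> / 2) = 8"
    using C \<kappa> q by (simp add: h0_def powr_powr)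
  define t0 where "t0 = exp (h0 / (C * C0 powr q)) + 1 / \<kappa>"
  have t0: "t0 > 1 / \<kappa>" "t0 > 0" using \<kappa> by (auto simp: t0_def add_pos_pos)
  \<comment> \<open>In the k-th step h^(q - 1) = h0^(q - 1) / \<theta>^(2 k). One factor \<theta>^k is spent on the length of the time interval and one on the delay weight.\<close>
  define \<theta> where "\<theta> = 2 powr (- (q - 1) / 2)"
  have \<theta>: "0 < \<theta>" "\<theta> < 1" using q by (auto simp: \<theta>_def powr_less_one)
  define a where "a k = (1 + t0) * (\<Prod>i<k. (1 + \<theta> ^ i))" for k
  have a1: "1 \<le> a k" for k
  proof -
    have "1 \<le> (\<Prod>i<k. (1 + \<theta> ^ i))" using \<theta> by (intro prod_ge_1) auto
    then have "(1 + t0) * 1 \<le> a k" unfolding a_def using t0 by (intro mult_left_mono) auto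
    then show ?thesis using t0 by simp
  qed
  have aS: "a (Suc k) = a k * (1 + \<theta> ^ k)" for k by (simp add: a_def)
  define Tmax where "Tmax = (1 + t0) * exp (1 / (1 - \<theta>))"
  have aT: "a k \<le> Tmax" for k
  proof -
    have "(\<Prod>i<k. (1 + \<theta> ^ i)) \<le> (\<Prod>i<k. exp (\<theta> ^ i))"
      using \<theta> exp_ge_add_one_self by (intro prod_mono) (auto simp: add_nonneg_nonneg)
    also have "\<dots> = exp (\<Sum>i<k. \<theta> ^ i)" by (simp add: exp_sum)
    also have "(\<Sum>i<k. \<theta> ^ i) \<le> (\<Sum>i. \<theta> ^ i)"
      using \<theta> by (intro sum_le_suminf summable_geometric) auto
    also have "\<dots> = 1 / (1 - \<theta>)" using \<theta> by (intro suminf_geometric) auto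
    finally show ?thesis using t0 by (simp add: a_def Tmax_def)
  qed
  have "T \<le> Tmax" if T: "0 \<le> T" and p: "continuous_on {0..T} p"
    and ineq: "\<And>t. t \<in> {0..T} \<Longrightarrow>
        p t \<ge> C0 + integral {0..t} (\<lambda>s. C * min 1 (\<kappa> * (t - s)) * p s powr q / (1 + s))"
    for T and p :: "real \<Rightarrow> real"
  proof (rule ccontr)
    assume "\<not> T \<le> Tmax"
    then have T': "Tmax < T" by simp
    have pC0: "C0 \<le> p t" if "t \<in> {0..T}" for t
    proof -
      have "0 \<le> integral {0..t} (\<lambda>s. C * min 1 (\<kappa> * (t - s)) * p s powr q / (1 + s))"
        using that C \<kappa> 
        by (cases "(\<lambda>s. C * min 1 (\<kappa> * (t - s)) * p s powr q / (1 + s)) integrable_on {0..t}")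
          (auto intro!: integral_nonneg simp: not_integrable_integral)
      then show ?thesis using ineq[OF that] by linarith
    qed
    have step: "p t \<ge> C * min 1 (\<kappa> * (t - v)) * h powr q * (ln (1 + v) - ln (1 + u))"
      if "t \<in> {0..T}" "0 \<le> u" "u \<le> v" "v \<le> t" "0 < h" "\<And>s. s \<in> {u..v} \<Longrightarrow> h \<le> p s" for t u v h
      using that C0 C \<kappa> q pC0
      by (intro volterra_step[of C0 C \<kappa> q h t p u v] ineq continuous_on_subset[OF p])
         (auto intro: less_le_trans[OF C0])
    have base: "h0 \<le> p t" if t: "t \<in> {t0..T}" for t
    proof -
      have "h0 = C * C0 powr q * (h0 / (C * C0 powr q))" using C C0 by simp
      also have "h0 / (C * C0 powr q) \<le> ln (1 + (t - 1 / \<kappa>))"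
        using t \<kappa> exp_gt_zero[of "h0 / (C * C0 powr q)"]
        by (subst ln_ge_iff) (auto simp: t0_def simp del: exp_gt_zero)
      also have "C * C0 powr q * ln (1 + (t - 1 / \<kappa>)) \<le> p t"
      proof -
        have "0 \<le> t - 1 / \<kappa>" "\<kappa> * (t - (t - 1 / \<kappa>)) = 1" using t t0 \<kappa> by auto
        moreover have "t - 1 / \<kappa> \<le> T"
          using t \<kappa> divide_pos_pos[of 1 \<kappa>] unfolding atLeastAtMost_iff by linarith
        then have "C0 \<le> p s" if "s \<in> {0..t - 1 / \<kappa>}" for s using that by (intro pC0) auto
        ultimately show ?thesis using step[of t 0 "t - 1/\<kappa>" C0] t t0 C0 \<kappa> by simp
      qed
      finally show ?thesis using C C0 by (auto simp: mult_left_mono)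
    qed
    have "h0 * 2 ^ k \<le> p t" if "a k \<le> 1 + t" "t \<le> T" for k t
      using that
    proof (induction k arbitrary: t)
      case 0
      then show ?case using base by (simp add: a_def)
    next
      case (Suc k)
      define h where "h = h0 * 2 ^ k"
      have h: "h > 0" using h0 by (simp add: h_def)
      define z where "z = \<theta> ^ k"
      have z: "0 < z" "z \<le> 1" using \<theta> by (auto simp: z_def power_le_one)
      have tS: "a k * (1 + z) \<le> 1 + t" using Suc.prems by (simp add: aS z_def)
      \<comment> \<open>The first half of the interval, so that the delay weight is evaluated at distance at least a k * z / 2.\<close>
      define u v where "u = a k - 1" and "v = a k * (1 + z / 2) - 1"
      have az: "a k * z \<ge> z" "a k * z > 0" using a1[of k] z by auto
      have tv: "t - v \<ge> a k * z / 2" using tS by (simp add: v_def algebra_simps)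
      have uv: "0 \<le> u" "u \<le> v" "v \<le> t"
        using a1[of k] az tv by (auto simp: u_def v_def algebra_simps)
      have "z / 3 \<le> ln (1 + z / 2)"
      proof -
        have "z / 3 \<le> 1 - 1 / (1 + z / 2)" using z by (simp add: field_simps)
        also have "\<dots> \<le> ln (1 + z / 2)"
          using ln_le_minus_one[of "1 / (1 + z / 2)"] z by (simp add: ln_div)
        finally show ?thesis .
      qed
      moreover have "ln (1 + v) - ln (1 + u) = ln (1 + z / 2)"
        using a1[of k] z by (simp add: u_def v_def ln_mult)
      ultimately have lnuv: "z / 3 \<le> ln (1 + v) - ln (1 + u)" by simp
      have hz: "h powr (q - 1) = h0 powr (q - 1) / z\<^sup>2"
      proof -
        have "z = 2 powr (k * (- (q - 1) / 2))"
          unfolding z_def \<theta>_def by (simp add: powr_power mult_ac)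
        then have "z\<^sup>2 = 2 powr (k * (- (q - 1) / 2) + k * (- (q - 1) / 2))"
          by (simp only: power2_eq_square powr_add)
        also have "k * (- (q - 1) / 2) + k * (- (q - 1) / 2) = - (k * (q - 1))" by argo
        also have "2 powr (- (k * (q - 1))) = 1 / (2 ^ k) powr (q - 1)"
          by (simp add: powr_minus_divide powr_powr flip: powr_realpow)
        finally have "(2 ^ k) powr (q - 1) * z\<^sup>2 = 1" by simp
        then show ?thesis using z h0 by (simp add: h_def powr_mult field_simps)
      qed
      have hq: "h powr q = h * h powr (q - 1)" using h by (simp add: powr_mult_base)
      have min: "z * min 1 (\<kappa> / 2) \<le> min 1 (\<kappa> * (t - v))"
      proof -
        have "\<kappa> * (z / 2) \<le> \<kappa> * (t - v)" using tv az \<kappa> by (intro mult_left_mono) auto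
        moreover have "z * min 1 (\<kappa> / 2) \<le> 1 * 1" using z \<kappa> by (intro mult_mono) auto
        moreover have "z * min 1 (\<kappa> / 2) \<le> z * (\<kappa> / 2)" using z by (intro mult_left_mono) auto
        ultimately show ?thesis by (simp add: algebra_simps)
      qed
      have "h0 * 2 ^ Suc k = 2 * h" by (simp add: h_def)
      also have "\<dots> \<le> 8 / 3 * h" using h by simp
      also have "\<dots> = C * (z * min 1 (\<kappa> / 2)) * h powr q * (z / 3)"
        using z h0q unfolding hq hz by (simp add: field_simps power2_eq_square)
      also have "\<dots> \<le> C * min 1 (\<kappa> * (t - v)) * h powr q * (ln (1 + v) - ln (1 + u))"
        using min lnuv C \<kappa> z uv by (intro mult_mono) auto
      also have "\<dots> \<le> p t"
        using uv h Suc.prems Suc.IH by (intro step) (auto simp: u_def h_def)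
      finally show ?case .
    qed
    then have "h0 * 2 ^ k \<le> p T" for k using aT[of k] T' by force
    moreover obtain k where "p T / h0 < 2 ^ k" using real_arch_pow[of 2] by auto
    ultimately show False using h0 by (metis divide_less_eq linorder_not_le mult.commute)
  qed
  then show ?thesis using that by blast
qed

section \<open>Outward moving radial weights\<close>

lemma DERIV_pos_part_power:
  fixes z :: real
  assumes n: "n \<noteq> 0"
  shows "((\<lambda>z. (max 0 z) ^ Suc n) has_real_derivative real (Suc n) * (max 0 z) ^ n) (at z)"
proof -
  consider "z < 0" | "z = 0" | "z > 0" by linarith
  then show ?thesis
  proof cases
    case 1
    have "((\<lambda>_. 0) has_real_derivative 0) (at z)" by simp
    then have "((\<lambda>z. (max 0 z) ^ Suc n) has_real_derivative 0) (at z)"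
      by (rule has_field_derivative_transform_within_open[of _ _ _ "{..<0}"]) (use 1 in auto)
    moreover have "real (Suc n) * (max 0 z) ^ n = 0" using 1 n by simp
    ultimately show ?thesis by (simp only:)
  next
    case 2
    have "((\<lambda>h. (max 0 h) ^ Suc n / h) \<longlongrightarrow> 0) (at (0::real))"
    proof (rule Lim_null_comparison)
      have "norm ((max 0 h) ^ Suc n / h) \<le> (max 0 h) ^ n" for h :: real
        by (cases "0 < h") auto
      then show "\<forall>\<^sub>F h in at (0::real). norm ((max 0 h) ^ Suc n / h) \<le> (max 0 h) ^ n" by simp
      have "isCont (\<lambda>h::real. (max 0 h) ^ n) 0" by (intro continuous_intros)
      then show "((\<lambda>h. (max 0 h) ^ n) \<longlongrightarrow> 0) (at (0::real))"
        using n by (simp only: isCont_def max.idem power_0_left if_False)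
    qed
    then show ?thesis using 2 n by (simp add: DERIV_def power_0_left)
  next
    case 3
    have "((\<lambda>z. z ^ Suc n) has_real_derivative real (Suc n) * z ^ n) (at z)"
      using DERIV_pow[of "Suc n" z] by simp
    then have "((\<lambda>z. (max 0 z) ^ Suc n) has_real_derivative real (Suc n) * z ^ n) (at z)"
      by (rule has_field_derivative_transform_within_open[of _ _ _ "{0<..}"]) (use 3 in auto)
    then show ?thesis using 3 by simp
  qed
qed

lemma GDERIV_transform_within_open:
  assumes "GDERIV f x :> D" "open S" "x \<in> S" "\<And>y. y \<in> S \<Longrightarrow> f y = g y"
  shows "GDERIV g x :> D"
  using has_derivative_transform_within_open[of f _ x UNIV S g] assms unfolding gderiv_def by simp

text \<open>
  For l > 0 this is the positive part of 1 - l / |x|. The maximum in the denominator makes it a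
  continuous function up to x = 0, where the bare formula would divide by zero. All weights
  below are polynomials in it, divided by powers of the same maximum.
\<close>
definition reach :: "real \<Rightarrow> 'a::euclidean_space \<Rightarrow> real"
  where "reach l x = 1 - l / max l (norm x)"

text \<open>
  The weight (|x| - l)^2 / |x| on |x| > l that defines q0 and P.
\<close>
definition shell_weight :: "real \<Rightarrow> 'a::euclidean_space \<Rightarrow> real"
  where "shell_weight l x = norm x * (reach l x)\<^sup>2"

text \<open>
  The gradient of the weight at x is this factor times x; on |x| > l it is
  (|x|^2 - l^2) / |x|^3, the kernel of q1.
\<close>
definition shell_flux :: "real \<Rightarrow> 'a::euclidean_space \<Rightarrow> real"
  where "shell_flux l x = (2 * reach l x - (reach l x)\<^sup>2) / max l (norm x)"

text \<open>
  The vector field push l x * x is the gradient of (|x| - l)^3 / |x| on |x| > l, which is the primitive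
  of - 3 * shell_weight in l. As a function of l + c t or l - c t it solves the wave equation, and it serves as
  the test function for the momentum balance.
\<close>
definition push :: "real \<Rightarrow> 'a::euclidean_space \<Rightarrow> real"
  where "push l x = 3 * (reach l x)\<^sup>2 - (reach l x) ^ 3"

text \<open>
  The gradient of push at x is this factor times x.
\<close>
definition push_slope :: "real \<Rightarrow> 'a::euclidean_space \<Rightarrow> real"
  where "push_slope l x = (6 * reach l x - 3 * (reach l x)\<^sup>2) * (1 - reach l x) / (max l (norm x))\<^sup>2"

context
  fixes l :: real
  assumes l: "0 < l"
begin

lemma reach_bounds: "0 \<le> reach l x" "reach l x < 1"
  using l by (auto simp: reach_def divide_simps)

lemma reach_eq_0: "norm x \<le> l \<Longrightarrow> reach l x = 0"
  using l by (simp add: reach_def)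

lemma reach_pos_part: "x \<noteq> 0 \<Longrightarrow> reach l x = max 0 (1 - l / norm x)"
  using l by (auto simp: reach_def max_def divide_simps)

lemma reach_power_cap: "n \<noteq> 0 \<Longrightarrow> reach l x ^ n * norm x = reach l x ^ n * max l (norm x)"
  using reach_eq_0[of x] by (cases "norm x \<le> l") auto

lemma DERIV_reach_power:
  assumes n: "n \<noteq> 0"
  shows "((\<lambda>l. reach l x ^ Suc n) has_real_derivative (real (Suc n) * reach l x ^ n) * (- 1 / max l (norm x))) (at l)"
proof (cases "x = 0")
  case True
  have "((\<lambda>_. 0) has_real_derivative 0) (at l)" by simp
  then have "((\<lambda>l. reach l x ^ Suc n) has_real_derivative 0) (at l)"
    by (rule has_field_derivative_transform_within_open[of _ _ _ "{0<..}"])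
       (use l n True in \<open>auto simp: reach_def\<close>)
  moreover have "reach l x ^ n = 0" using True l n by (simp add: reach_def)
  ultimately show ?thesis by (simp only: mult_zero_left mult_zero_right)
next
  case False
  have "((\<lambda>l. (max 0 (1 - l / norm x)) ^ Suc n) has_real_derivative
      (real (Suc n) * (max 0 (1 - l / norm x)) ^ n) * (- (1 / norm x))) (at l)"
    by (rule DERIV_chain2[OF DERIV_pos_part_power[OF n]]) (use False in \<open>auto intro!: derivative_eq_intros\<close>)
  then have "((\<lambda>l. reach l x ^ Suc n) has_real_derivative
      (real (Suc n) * (max 0 (1 - l / norm x)) ^ n) * (- (1 / norm x))) (at l)"
    by (rule has_field_derivative_transform_within_open[of _ _ _ "{0<..}"])
       (use l False in \<open>auto simp: reach_def max_def divide_simps\<close>)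
  moreover have "(real (Suc n) * (max 0 (1 - l / norm x)) ^ n) * (- (1 / norm x))
      = (real (Suc n) * reach l x ^ n) * (- 1 / max l (norm x))"
  proof (cases "norm x \<le> l")
    case True
    then have "reach l x = 0" by (rule reach_eq_0)
    then show ?thesis using n False by (simp flip: reach_pos_part)
  qed (use False in \<open>simp add: reach_pos_part max_def\<close>)
  ultimately show ?thesis by simp
qed

lemma GDERIV_reach_power:
  assumes n: "n \<noteq> 0"
  shows "GDERIV (\<lambda>x. reach l x ^ Suc n) x :>
    (real (Suc n) * reach l x ^ n * (1 - reach l x) / (max l (norm x))\<^sup>2) *\<^sub>R x"
proof (cases "norm x < l")
  case True
  have "GDERIV (\<lambda>x. reach l x ^ Suc n) x :> 0"
    by (rule GDERIV_transform_within_open[OF GDERIV_const, where S = "ball 0 l"])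
       (use True n in \<open>auto simp: reach_eq_0\<close>)
  moreover have "reach l x ^ n = 0" using True n by (simp add: reach_eq_0)
  ultimately show ?thesis by (simp only: mult_zero_left mult_zero_right div_0 scaleR_zero_left)
next
  case False
  then have x: "x \<noteq> 0" using l by auto
  have "((\<lambda>r. (max 0 (1 - l / r)) ^ Suc n) has_real_derivative
      (real (Suc n) * (max 0 (1 - l / norm x)) ^ n) * (l / (norm x)\<^sup>2)) (at (norm x))"
    by (rule DERIV_chain2[OF DERIV_pos_part_power[OF n]])
       (use x in \<open>auto intro!: derivative_eq_intros simp: power2_eq_square\<close>)
  then have "GDERIV (\<lambda>x. (max 0 (1 - l / norm x)) ^ Suc n) x :>
      ((real (Suc n) * (max 0 (1 - l / norm x)) ^ n) * (l / (norm x)\<^sup>2)) *\<^sub>R sgn x"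
    by (rule GDERIV_DERIV_compose[OF GDERIV_norm[OF x]])
  then have "GDERIV (\<lambda>x. reach l x ^ Suc n) x :>
      ((real (Suc n) * (max 0 (1 - l / norm x)) ^ n) * (l / (norm x)\<^sup>2)) *\<^sub>R sgn x"
    by (rule GDERIV_transform_within_open[of _ _ _ "- {0}"]) (use x in \<open>auto simp: reach_pos_part\<close>)
  moreover have "1 - reach l x = l / norm x" "max l (norm x) = norm x"
    using False by (auto simp: reach_def max_def)
  moreover have "((real (Suc n) * w ^ n) * (l / (norm x)\<^sup>2)) *\<^sub>R sgn x
      = (real (Suc n) * w ^ n * (l / norm x) / (norm x)\<^sup>2) *\<^sub>R x" for w
    by (simp add: sgn_div_norm divide_inverse mult_ac)
  ultimately show ?thesis by (simp only: reach_pos_part[OF x, symmetric])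
qed

lemma DERIV_shell_weight:
  "((\<lambda>l. shell_weight l x) has_real_derivative - 2 * reach l x) (at l)"
proof -
  have "norm x * (2 * reach l x * (- 1 / max l (norm x))) = - 2 * reach l x"
    using reach_power_cap[of 1 x] l by (simp add: field_simps)
  then show ?thesis
    using DERIV_cmult[OF DERIV_reach_power[of 1 x], of "norm x"]
    by (simp add: shell_weight_def numeral_2_eq_2)
qed

lemma GDERIV_shell_weight: "GDERIV (shell_weight l) x :> shell_flux l x *\<^sub>R x"
proof (cases "norm x < l")
  case True
  have "GDERIV (shell_weight l) x :> 0"
    by (rule GDERIV_transform_within_open[OF GDERIV_const, where S = "ball 0 l"])
       (use True in \<open>auto simp: reach_eq_0 shell_weight_def\<close>)
  then show ?thesis using True reach_eq_0[of x] by (simp add: shell_flux_def)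
next
  case False
  then have x: "x \<noteq> 0" and m: "max l (norm x) = norm x" using l by auto
  have "GDERIV (\<lambda>x. norm x * (reach l x)\<^sup>2) x :>
     norm x *\<^sub>R ((2 * reach l x * (1 - reach l x) / (max l (norm x))\<^sup>2) *\<^sub>R x)
       + (reach l x)\<^sup>2 *\<^sub>R sgn x"
    using GDERIV_mult[OF GDERIV_norm[OF x] GDERIV_reach_power[of 1]] by (simp add: numeral_2_eq_2)
  also have "norm x *\<^sub>R ((2 * reach l x * (1 - reach l x) / (max l (norm x))\<^sup>2) *\<^sub>R x)
       + (reach l x)\<^sup>2 *\<^sub>R sgn x = shell_flux l x *\<^sub>R x"
    using x by (simp add: m shell_flux_def sgn_div_norm flip: scaleR_add_left)
      (simp add: field_simps power2_eq_square)
  finally show ?thesis by (simp add: shell_weight_def[abs_def])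
qed

lemma DERIV_push: "((\<lambda>l. push l x) has_real_derivative - 3 * shell_flux l x) (at l)"
proof -
  have "((\<lambda>l. 3 * reach l x ^ Suc 1 - reach l x ^ Suc 2) has_real_derivative
    3 * ((real (Suc 1) * reach l x ^ 1) * (- 1 / max l (norm x)))
      - (real (Suc 2) * reach l x ^ 2) * (- 1 / max l (norm x))) (at l)"
    by (intro DERIV_diff DERIV_cmult DERIV_reach_power) auto
  moreover have "(\<lambda>l. 3 * reach l x ^ Suc 1 - reach l x ^ Suc 2) = (\<lambda>l. push l x)"
    by (auto simp: push_def numeral_2_eq_2 numeral_3_eq_3)
  moreover have "3 * ((real (Suc 1) * reach l x ^ 1) * (- 1 / max l (norm x)))
      - (real (Suc 2) * reach l x ^ 2) * (- 1 / max l (norm x)) = - 3 * shell_flux l x"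
    by (simp add: shell_flux_def diff_divide_distrib right_diff_distrib)
  ultimately show ?thesis by (simp only:)
qed

lemma GDERIV_push: "GDERIV (push l) x :> push_slope l x *\<^sub>R x"
proof -
  have "GDERIV (\<lambda>x. 3 * reach l x ^ Suc 1 - reach l x ^ Suc 2) x :>
    (3 *\<^sub>R ((real (Suc 1) * reach l x ^ 1 * (1 - reach l x) / (max l (norm x))\<^sup>2) *\<^sub>R x)
       + (reach l x ^ Suc 1) *\<^sub>R 0)
      - (real (Suc 2) * reach l x ^ 2 * (1 - reach l x) / (max l (norm x))\<^sup>2) *\<^sub>R x"
    by (intro GDERIV_diff GDERIV_mult GDERIV_const GDERIV_reach_power) auto
  moreover have "(\<lambda>x. 3 * reach l x ^ Suc 1 - reach l x ^ Suc 2) = push l"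
    by (auto simp: push_def numeral_2_eq_2 numeral_3_eq_3)
  moreover have "(3 *\<^sub>R ((real (Suc 1) * reach l x ^ 1 * (1 - reach l x) / (max l (norm x))\<^sup>2) *\<^sub>R x)
       + (reach l x ^ Suc 1) *\<^sub>R 0)
      - (real (Suc 2) * reach l x ^ 2 * (1 - reach l x) / (max l (norm x))\<^sup>2) *\<^sub>R x = push_slope l x *\<^sub>R x"
    by (simp add: push_slope_def left_diff_distrib mult.assoc diff_divide_distrib flip: scaleR_diff_left)
  ultimately show ?thesis by metis
qed

end

lemma continuous_on_weights:
  assumes l: "continuous_on S l" and f: "continuous_on S f" and pos: "\<And>z. z \<in> S \<Longrightarrow> 0 < l z"
  shows "continuous_on S (\<lambda>z. reach (l z) (f z))"
    "continuous_on S (\<lambda>z. shell_weight (l z) (f z))" "continuous_on S (\<lambda>z. shell_flux (l z) (f z))"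
    "continuous_on S (\<lambda>z. push (l z) (f z))" "continuous_on S (\<lambda>z. push_slope (l z) (f z))"
proof -
  have m: "\<forall>z\<in>S. max (l z) (norm (f z)) \<noteq> 0" "\<forall>z\<in>S. (max (l z) (norm (f z)))\<^sup>2 \<noteq> 0"
    using pos by (auto simp: max_def) force+
  show r: "continuous_on S (\<lambda>z. reach (l z) (f z))"
    unfolding reach_def by (intro continuous_intros l f m)
  show "continuous_on S (\<lambda>z. shell_weight (l z) (f z))" "continuous_on S (\<lambda>z. shell_flux (l z) (f z))"
    "continuous_on S (\<lambda>z. push (l z) (f z))" "continuous_on S (\<lambda>z. push_slope (l z) (f z))"
    unfolding shell_weight_def shell_flux_def push_def push_slope_def
    by (intro continuous_intros r l f m)+
qed

lemma C1_slab_coord: "C1_slab T (\<lambda>_ x. x \<bullet> b) (\<lambda>_ _. 0) (\<lambda>_ _. b)"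
  unfolding C1_slab_def by (auto intro!: continuous_intros derivative_eq_intros simp: gderiv_def)

context
  fixes l0 \<sigma> T :: real
  assumes pos: "\<And>s. s \<in> {0..T} \<Longrightarrow> 0 < l0 + \<sigma> * s"
begin

lemma continuous_on_moving_weights:
  "continuous_on ({0..T} \<times> UNIV) (\<lambda>z. reach (l0 + \<sigma> * fst z) (snd z))"
  "continuous_on ({0..T} \<times> UNIV) (\<lambda>z. shell_weight (l0 + \<sigma> * fst z) (snd z))"
  "continuous_on ({0..T} \<times> UNIV) (\<lambda>z. shell_flux (l0 + \<sigma> * fst z) (snd z))"
  "continuous_on ({0..T} \<times> UNIV) (\<lambda>z. push (l0 + \<sigma> * fst z) (snd z))"
  "continuous_on ({0..T} \<times> UNIV) (\<lambda>z. push_slope (l0 + \<sigma> * fst z) (snd z))"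
  by (rule continuous_on_weights; (intro continuous_intros | use pos in force))+

lemma C1_slab_shell_weight:
  "C1_slab T (\<lambda>s x. shell_weight (l0 + \<sigma> * s) x) (\<lambda>s x. \<sigma> * (- 2 * reach (l0 + \<sigma> * s) x))
     (\<lambda>s x. shell_flux (l0 + \<sigma> * s) x *\<^sub>R x)"
  unfolding C1_slab_def
proof (intro conjI ballI allI)
  fix t and x :: 'a assume t: "t \<in> {0..T}"
  have "((\<lambda>s. shell_weight (l0 + \<sigma> * s) x) has_real_derivative (- 2 * reach (l0 + \<sigma> * t) x) * \<sigma>) (at t within {0..T})"
    by (rule DERIV_chain2[where g = "\<lambda>s. l0 + \<sigma> * s", OF DERIV_shell_weight[OF pos[OF t]]]) (auto intro!: derivative_eq_intros)
  then show "((\<lambda>s. shell_weight (l0 + \<sigma> * s) x) has_real_derivative \<sigma> * (- 2 * reach (l0 + \<sigma> * t) x)) (at t within {0..T})"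
    by (simp add: mult.commute)
  show "GDERIV (shell_weight (l0 + \<sigma> * t)) x :> shell_flux (l0 + \<sigma> * t) x *\<^sub>R x"
    using GDERIV_shell_weight[OF pos[OF t]] .
qed (intro continuous_intros continuous_on_moving_weights)+

lemma C1_slab_push:
  "C1_slab T (\<lambda>s x. push (l0 + \<sigma> * s) x) (\<lambda>s x. \<sigma> * (- 3 * shell_flux (l0 + \<sigma> * s) x))
     (\<lambda>s x. push_slope (l0 + \<sigma> * s) x *\<^sub>R x)"
  unfolding C1_slab_def
proof (intro conjI ballI allI)
  fix t and x :: 'a assume t: "t \<in> {0..T}"
  have "((\<lambda>s. push (l0 + \<sigma> * s) x) has_real_derivative (- 3 * shell_flux (l0 + \<sigma> * t) x) * \<sigma>) (at t within {0..T})"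
    by (rule DERIV_chain2[where g = "\<lambda>s. l0 + \<sigma> * s", OF DERIV_push[OF pos[OF t]]]) (auto intro!: derivative_eq_intros)
  then show "((\<lambda>s. push (l0 + \<sigma> * s) x) has_real_derivative \<sigma> * (- 3 * shell_flux (l0 + \<sigma> * t) x)) (at t within {0..T})"
    by (simp add: mult.commute)
  show "GDERIV (push (l0 + \<sigma> * t)) x :> push_slope (l0 + \<sigma> * t) x *\<^sub>R x"
    using GDERIV_push[OF pos[OF t]] .
qed (intro continuous_intros continuous_on_moving_weights)+

end

lemma reach_antimono:
  assumes "0 < l" "l \<le> l'"
  shows "reach l' x \<le> reach l x"
  using assms by (auto simp: reach_def max_def divide_simps)

text \<open>
  The Jacobian of the field push l x * x has the eigenvalue 2 (1 - (l / |x|)^3) in radial and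
  3 w^2 - w^3 in tangential direction, w = reach l x. Both increase with w, hence decrease with l.
\<close>
lemma push_quadratic_form:
  assumes "0 < l"
  shows "push l x * (norm v)\<^sup>2 + push_slope l x * (x \<bullet> v)\<^sup>2
    = (3 * (reach l x)\<^sup>2 - reach l x ^ 3) * ((norm v)\<^sup>2 - (x \<bullet> v)\<^sup>2 / (norm x)\<^sup>2)
      + (6 * reach l x - 6 * (reach l x)\<^sup>2 + 2 * reach l x ^ 3) * ((x \<bullet> v)\<^sup>2 / (norm x)\<^sup>2)"
proof (cases "norm x \<le> l")
  case True
  then show ?thesis using reach_eq_0[OF assms True] by (simp add: push_def push_slope_def)
next
  case False
  then have "push_slope l x * (x \<bullet> v)\<^sup>2
      = ((6 * reach l x - 3 * (reach l x)\<^sup>2) * (1 - reach l x)) * ((x \<bullet> v)\<^sup>2 / (norm x)\<^sup>2)"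
    by (simp add: push_slope_def max_def)
  then show ?thesis by (simp add: push_def power2_eq_square power3_eq_cube algebra_simps)
qed

lemma radial_coefficient_mono:
  fixes w w' :: real
  assumes "0 \<le> w" "w \<le> w'" "w' \<le> 1"
  shows "6 * w - 6 * w\<^sup>2 + 2 * w ^ 3 \<le> 6 * w' - 6 * w'\<^sup>2 + 2 * w' ^ 3"
proof -
  have "6 * v - 6 * v\<^sup>2 + 2 * v ^ 3 = 2 - 2 * (1 - v) ^ 3" for v :: real
    by (simp add: power2_eq_square power3_eq_cube algebra_simps)
  moreover have "(1 - w') ^ 3 \<le> (1 - w) ^ 3" using assms by (intro power_mono) auto
  ultimately show ?thesis by simp
qed

lemma tangential_coefficient_mono:
  fixes w w' :: real
  assumes "0 \<le> w" "w \<le> w'" "w' \<le> 1"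
  shows "3 * w\<^sup>2 - w ^ 3 \<le> 3 * w'\<^sup>2 - w' ^ 3"
proof -
  have "w' ^ 3 - w ^ 3 = (w' - w) * (w'\<^sup>2 + w' * w + w\<^sup>2)"
    by (simp add: power2_eq_square power3_eq_cube algebra_simps)
  moreover have "3 * w'\<^sup>2 - 3 * w\<^sup>2 = (w' - w) * (3 * (w' + w))"
    by (simp add: power2_eq_square algebra_simps)
  moreover have "w'\<^sup>2 + w' * w + w\<^sup>2 \<le> 3 * (w' + w)"
  proof -
    have "w'\<^sup>2 \<le> w'" "w\<^sup>2 \<le> w" "w' * w \<le> w"
      using assms by (auto simp: power2_eq_square intro: mult_left_le mult_left_le_one_le)
    then have "w'\<^sup>2 + w' * w + w\<^sup>2 \<le> w' + w + w" by (intro add_mono)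
    also have "\<dots> \<le> 3 * (w' + w)" using assms by simp
    finally show ?thesis .
  qed
  then have "(w' - w) * (w'\<^sup>2 + w' * w + w\<^sup>2) \<le> (w' - w) * (3 * (w' + w))"
    using assms by (intro mult_left_mono) auto
  ultimately show ?thesis by linarith
qed

text \<open>
  The outgoing weight has the smaller l, so the convective term of the outgoing minus the incoming
  test field is nonnegative.
\<close>
lemma push_form_antimono:
  assumes "0 < l" "l \<le> l'"
  shows "push l' x * (norm v)\<^sup>2 + push_slope l' x * (x \<bullet> v)\<^sup>2
    \<le> push l x * (norm v)\<^sup>2 + push_slope l x * (x \<bullet> v)\<^sup>2"
proof -
  have r: "0 \<le> reach l' x" "reach l' x \<le> reach l x" "reach l x \<le> 1"
    using reach_antimono[OF assms, of x] reach_bounds[of l x] reach_bounds[of l' x] assms by auto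
  have "(x \<bullet> v)\<^sup>2 \<le> (norm x)\<^sup>2 * (norm v)\<^sup>2"
    using Cauchy_Schwarz_ineq[of x v] by (simp add: power2_norm_eq_inner)
  then have "(x \<bullet> v)\<^sup>2 / (norm x)\<^sup>2 \<le> (norm v)\<^sup>2"
    by (cases "x = 0") (auto simp: field_simps)
  then show ?thesis
    unfolding push_quadratic_form[OF assms(1)] push_quadratic_form[OF less_le_trans[OF assms]]
    by (intro add_mono mult_right_mono radial_coefficient_mono[OF r] tangential_coefficient_mono[OF r]) simp_all
qed

text \<open>
  The difference of the two weights at levels lo and lo + \<tau> is (1 / |x|) * min w \<tau>, where
  w = |x| - lo lies between 0 and d, whereas the weight itself is w^2 / |x|. The factor
  min 1 (\<tau> / d) is what becomes the delay weight of the Volterra inequality.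
\<close>
lemma reach_gap:
  fixes x :: "'a::euclidean_space"
  assumes lo: "0 < lo" and \<tau>: "0 \<le> \<tau>" and d: "0 < d" and x: "norm x \<le> lo + d"
  shows "min 1 (\<tau> / d) / d * shell_weight lo x \<le> reach lo x - reach (lo + \<tau>) x"
proof (cases "norm x \<le> lo")
  case True
  then show ?thesis using lo \<tau> by (simp add: shell_weight_def reach_eq_0)
next
  case False
  define w where "w = norm x - lo"
  have w: "0 < w" "w \<le> d" using False x by (auto simp: w_def)
  have r: "norm x > 0" using False lo by linarith
  have ro: "reach lo x = w / norm x" using False r by (simp add: reach_def w_def diff_divide_distrib)
  have ri: "reach (lo + \<tau>) x = max 0 (w - \<tau>) / norm x"
  proof (cases "norm x \<le> lo + \<tau>")
    case True
    then show ?thesis using lo \<tau> by (simp add: reach_eq_0 w_def)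
  next
    case False
    then show ?thesis using r by (simp add: reach_def w_def diff_divide_distrib add_divide_distrib)
  qed
  have "shell_weight lo x = w\<^sup>2 / norm x"
    using r by (simp add: shell_weight_def ro power_divide power2_eq_square)
  moreover have "min 1 (\<tau> / d) / d * w\<^sup>2 \<le> w - max 0 (w - \<tau>)"
  proof -
    have w2: "w\<^sup>2 / d \<le> w" using w d by (simp add: divide_simps power2_eq_square)
    have w3: "w\<^sup>2 / d \<le> d" using w2 w by simp
    have "min 1 (\<tau> / d) * (w\<^sup>2 / d) \<le> 1 * w" using w2 w d \<tau> by (intro mult_mono) auto
    moreover have "min 1 (\<tau> / d) * (w\<^sup>2 / d) \<le> (\<tau> / d) * d" using w3 w d \<tau> by (intro mult_mono) auto
    ultimately show ?thesis using d by (simp add: max_def)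
  qed
  then have "min 1 (\<tau> / d) / d * w\<^sup>2 / norm x \<le> (w - max 0 (w - \<tau>)) / norm x"
    using r by (intro divide_right_mono) auto
  ultimately show ?thesis unfolding ro ri by (simp add: diff_divide_distrib)
qed

lemma shell_volume:
  fixes a b :: real
  assumes "0 \<le> a" "a \<le> b"
  shows "(indicat_real (cball (0 :: real^3) b - ball 0 a) has_integral 4 / 3 * pi * (b ^ 3 - a ^ 3)) UNIV"
proof -
  have "measure lebesgue (cball (0 :: real^3) b - ball 0 a)
      = measure lebesgue (cball (0 :: real^3) b) - measure lebesgue (ball (0 :: real^3) a)"
    using assms by (intro measurable_measure_Diff) auto
  also have "\<dots> = 4 / 3 * pi * (b ^ 3 - a ^ 3)"
    using assms by (simp add: content_cball content_ball unit_ball_vol_3 right_diff_distrib)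
  finally have "measure lebesgue (cball (0 :: real^3) b - ball 0 a) = 4 / 3 * pi * (b ^ 3 - a ^ 3)" .
  moreover have "cball (0 :: real^3) b - ball 0 a \<in> lmeasurable" by (intro fmeasurable.Diff) auto
  ultimately show ?thesis using lmeasurable_iff_indicator_has_integral by metis
qed

section \<open>Convexity of the pressure\<close>

lemma tangent_arith:
  fixes A :: real
  assumes "A * (a + g * b * (x - r)) \<le> A * X"
  shows "A * (a - p0 - g * q * (r - y)) + A * g * (b - q) * (x - r) \<le> A * X - A * p0 - A * g * q * (x - y)"
proof -
  have "A * (a - p0 - g * q * (r - y)) + A * g * (b - q) * (x - r)
    = A * (a + g * b * (x - r)) - A * p0 - A * g * q * (x - y)"
    by (simp add: algebra_simps)
  then show ?thesis using assms by linarith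
qed

lemma powr_above_tangent:
  fixes a b p :: real
  assumes "1 \<le> p" "0 < a" "0 < b"
  shows "a powr p + p * a powr (p - 1) * (b - a) \<le> b powr p"
proof -
  have "b powr p - a powr p \<ge> p * a powr (p - 1) * (b - a)"
  proof (rule convex_on_imp_above_tangent[where A = "{0<..}"])
    show "convex_on {0<..} (\<lambda>x. x powr p)"
      by (rule powr_convex[OF assms(1)])
    show "((\<lambda>x. x powr p) has_real_derivative p * a powr (p - 1)) (at a within {0<..})"
      using assms by (auto intro: has_field_derivative_at_within[OF has_real_derivative_powr])
  qed (use assms in \<open>auto simp: interior_open\<close>)
  then show ?thesis by linarith
qed

definition excess_fun :: "real \<Rightarrow> real \<Rightarrow> real \<Rightarrow> real \<Rightarrow> real"
  where "excess_fun A \<gamma> \<rho>bar z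
    = A * ((\<rho>bar + z) powr \<gamma> - \<rho>bar powr \<gamma> - \<gamma> * \<rho>bar powr (\<gamma> - 1) * z)"

lemma excess_fun_quadratic:
  assumes A: "A > 0" and \<gamma>: "\<gamma> > 1" and \<rho>bar: "\<rho>bar > 0" and Z: "Z > 0"
    and k: "\<And>\<xi>. \<rho>bar < \<xi> \<Longrightarrow> \<xi> < \<rho>bar + Z \<Longrightarrow> k \<le> \<xi> powr (\<gamma> - 2)"
  shows "A * \<gamma> * (\<gamma> - 1) * k / 2 * Z\<^sup>2 \<le> excess_fun A \<gamma> \<rho>bar Z"
proof -
  let ?k = "A * \<gamma> * (\<gamma> - 1) * k / 2"
  have "excess_fun A \<gamma> \<rho>bar 0 - ?k * 0\<^sup>2 \<le> excess_fun A \<gamma> \<rho>bar Z - ?k * Z\<^sup>2"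
  proof (rule DERIV_nonneg_imp_increasing_open[of 0 Z])
    have d: "((\<lambda>z. excess_fun A \<gamma> \<rho>bar z - ?k * z\<^sup>2) has_real_derivative
        A * (\<gamma> * (\<rho>bar + z) powr (\<gamma> - 1) - \<gamma> * \<rho>bar powr (\<gamma> - 1)) - ?k * (2 * z)) (at z)" if "0 \<le> z" for z
    proof -
      have "0 < \<rho>bar + z" using that \<rho>bar by simp
      then show ?thesis unfolding excess_fun_def by (auto intro!: derivative_eq_intros)
    qed
    show "continuous_on {0..Z} (\<lambda>z. excess_fun A \<gamma> \<rho>bar z - ?k * z\<^sup>2)"
      by (rule DERIV_continuous_on[OF has_field_derivative_at_within[OF d]]) simp
    fix z assume z: "0 < z" "z < Z"
    have "\<exists>\<xi>>\<rho>bar. \<xi> < \<rho>bar + z \<and> (\<rho>bar + z) powr (\<gamma> - 1) - \<rho>bar powr (\<gamma> - 1)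
        = (\<rho>bar + z - \<rho>bar) * ((\<gamma> - 1) * \<xi> powr (\<gamma> - 1 - 1))"
      using z \<rho>bar by (intro MVT2 has_real_derivative_powr) auto
    then obtain \<xi> where \<xi>: "\<rho>bar < \<xi>" "\<xi> < \<rho>bar + z"
      and eq: "(\<rho>bar + z) powr (\<gamma> - 1) - \<rho>bar powr (\<gamma> - 1) = z * ((\<gamma> - 1) * \<xi> powr (\<gamma> - 2))" by auto
    have "k \<le> \<xi> powr (\<gamma> - 2)" using \<xi> z by (intro k) auto
    then have "A * \<gamma> * (\<gamma> - 1) * z * k \<le> A * \<gamma> * (\<gamma> - 1) * z * \<xi> powr (\<gamma> - 2)"
      using A \<gamma> z by (intro mult_left_mono) auto
    also have "\<dots> = A * \<gamma> * ((\<rho>bar + z) powr (\<gamma> - 1) - \<rho>bar powr (\<gamma> - 1))" unfolding eq by (simp add: mult_ac)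
    finally have "0 \<le> A * (\<gamma> * (\<rho>bar + z) powr (\<gamma> - 1) - \<gamma> * \<rho>bar powr (\<gamma> - 1)) - ?k * (2 * z)"
      by (simp add: right_diff_distrib mult_ac)
    then show "\<exists>d. ((\<lambda>z. excess_fun A \<gamma> \<rho>bar z - ?k * z\<^sup>2) has_real_derivative d) (at z) \<and> 0 \<le> d"
      using d[of z] z by (intro exI conjI) auto
  qed (use Z in auto)
  then show ?thesis by (simp add: excess_fun_def)
qed

text \<open>
  For \<gamma> \<ge> 2 the second derivative of the pressure is bounded below to the right of \<rho>bar, and
  e = 0. For \<gamma> < 2 it decays like a power \<gamma> - 2, and e = 2 - \<gamma>; what matters is that the
  bound grows like the power 2 - e > 1 at infinity.
\<close>
lemma excess_fun_growth:
  assumes A: "A > 0" and \<gamma>: "\<gamma> > 1" and \<rho>bar: "\<rho>bar > 0"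
  obtains C e :: real where "C > 0" "0 \<le> e" "e < 1"
    "\<And>Z. Z > 0 \<Longrightarrow> C * Z\<^sup>2 * (1 + Z) powr (- e) \<le> excess_fun A \<gamma> \<rho>bar Z"
proof (cases "\<gamma> \<ge> 2")
  case True
  show ?thesis
  proof
    show "0 < A * \<gamma> * (\<gamma> - 1) * \<rho>bar powr (\<gamma> - 2) / 2" using assms by simp
    fix Z :: real assume Z: "Z > 0"
    have "\<rho>bar powr (\<gamma> - 2) \<le> \<xi> powr (\<gamma> - 2)" if "\<rho>bar < \<xi>" for \<xi>
      using that True \<rho>bar by (intro powr_mono2) auto
    then have "A * \<gamma> * (\<gamma> - 1) * \<rho>bar powr (\<gamma> - 2) / 2 * Z\<^sup>2 \<le> excess_fun A \<gamma> \<rho>bar Z"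
      by (intro excess_fun_quadratic[OF assms Z]) auto
    then show "A * \<gamma> * (\<gamma> - 1) * \<rho>bar powr (\<gamma> - 2) / 2 * Z\<^sup>2 * (1 + Z) powr (- 0) \<le> excess_fun A \<gamma> \<rho>bar Z"
      using Z by simp
  qed auto
next
  case False
  show ?thesis
  proof
    show "0 < A * \<gamma> * (\<gamma> - 1) * (1 + \<rho>bar) powr (\<gamma> - 2) / 2" using assms by simp
    show "0 \<le> 2 - \<gamma>" "2 - \<gamma> < 1" using False \<gamma> by auto
    fix Z :: real assume Z: "Z > 0"
    have "(1 + \<rho>bar) powr (\<gamma> - 2) * (1 + Z) powr (\<gamma> - 2) \<le> \<xi> powr (\<gamma> - 2)" if "\<rho>bar < \<xi>" "\<xi> < \<rho>bar + Z" for \<xi>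
    proof -
      have "(1 + \<rho>bar) powr (\<gamma> - 2) * (1 + Z) powr (\<gamma> - 2) = ((1 + \<rho>bar) * (1 + Z)) powr (\<gamma> - 2)"
        using Z \<rho>bar by (simp add: powr_mult)
      also have "\<dots> \<le> \<xi> powr (\<gamma> - 2)"
      proof (rule powr_mono2')
        have "\<xi> \<le> \<rho>bar + Z" using that by simp
        also have "\<dots> \<le> (1 + \<rho>bar) * (1 + Z)" using Z \<rho>bar by (simp add: algebra_simps)
        finally show "\<xi> \<le> (1 + \<rho>bar) * (1 + Z)" .
      qed (use False that \<rho>bar in auto)
      finally show ?thesis .
    qed
    then have "A * \<gamma> * (\<gamma> - 1) * ((1 + \<rho>bar) powr (\<gamma> - 2) * (1 + Z) powr (\<gamma> - 2)) / 2 * Z\<^sup>2 \<le> excess_fun A \<gamma> \<rho>bar Z"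
      by (intro excess_fun_quadratic[OF assms Z])
    then show "A * \<gamma> * (\<gamma> - 1) * (1 + \<rho>bar) powr (\<gamma> - 2) / 2 * Z\<^sup>2 * (1 + Z) powr (- (2 - \<gamma>)) \<le> excess_fun A \<gamma> \<rho>bar Z"
      by (simp add: mult_ac)
  qed
qed

section \<open>The flow and its finite speed of propagation\<close>

lemma GDERIV_norm_diff_sq: "GDERIV (\<lambda>x. (norm (x - y))\<^sup>2) x :> 2 *\<^sub>R (x - y)"
  unfolding gderiv_def power2_norm_eq_inner
  by (auto intro!: derivative_eq_intros simp: inner_commute inner_diff_left inner_diff_right)

text \<open>
  A C1 cutoff which is positive exactly inside the backward cone |x - y| < R - c t, as long as
  R - c t > 0.
\<close>
lemma C1_slab_cone:
  "C1_slab T (\<lambda>t x. (max 0 ((R - c * t)\<^sup>2 - (norm (x - y))\<^sup>2))\<^sup>2)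
     (\<lambda>t x. 2 * max 0 ((R - c * t)\<^sup>2 - (norm (x - y))\<^sup>2) * (- 2 * c * (R - c * t)))
     (\<lambda>t x. (2 * max 0 ((R - c * t)\<^sup>2 - (norm (x - y))\<^sup>2)) *\<^sub>R ((- 2) *\<^sub>R (x - y)))"
proof -
  have "C1_slab T (\<lambda>t x. (R - c * t)\<^sup>2 - (norm (x - y))\<^sup>2) (\<lambda>t x. - 2 * c * (R - c * t))
     (\<lambda>t x. (- 2) *\<^sub>R (x - y))"
    unfolding C1_slab_def
  proof (intro conjI ballI allI)
    fix t x
    show "((\<lambda>s. (R - c * s)\<^sup>2 - (norm (x - y))\<^sup>2) has_real_derivative - 2 * c * (R - c * t)) (at t within {0..T})"
      by (auto intro!: derivative_eq_intros)
    show "GDERIV (\<lambda>x. (R - c * t)\<^sup>2 - (norm (x - y))\<^sup>2) x :> (- 2) *\<^sub>R (x - y)"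
      using GDERIV_diff[OF GDERIV_const GDERIV_norm_diff_sq[where x = x and y = y]] by simp
  qed (intro continuous_intros)+
  from C1_slab_compose[OF this, of UNIV "\<lambda>z. (max 0 z) ^ Suc 1" "\<lambda>z. real (Suc 1) * (max 0 z) ^ 1"]
  show ?thesis
    using DERIV_pos_part_power[of 1] by (simp add: numeral_2_eq_2 continuous_intros)
qed

text \<open>
  A C1 solution of the damped Euler system on [0, T], equal to the constant state outside the ball of
  radius M at time 0. The derivatives of \<rho> and u are parameters; c is the sound speed of the
  background, n the density perturbation, and m i, with derivatives mt i and mx i, the components of
  the momentum.
\<close>
locale damped_euler_flow =
  fixes A \<gamma> \<mu> lam \<rho>bar M T :: real
    and \<rho> \<rho>t :: "real \<Rightarrow> real^3 \<Rightarrow> real" and \<rho>x :: "real \<Rightarrow> real^3 \<Rightarrow> real^3"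
    and u :: "real \<Rightarrow> real^3 \<Rightarrow> real^3"
    and ut :: "3 \<Rightarrow> real \<Rightarrow> real^3 \<Rightarrow> real" and ux :: "3 \<Rightarrow> real \<Rightarrow> real^3 \<Rightarrow> real^3"
    and m mt :: "3 \<Rightarrow> real \<Rightarrow> real^3 \<Rightarrow> real" and mx :: "3 \<Rightarrow> real \<Rightarrow> real^3 \<Rightarrow> real^3"
    and c :: real and n :: "real \<Rightarrow> real^3 \<Rightarrow> real" and drag :: "real \<Rightarrow> real"
  defines "c \<equiv> sqrt (A * \<gamma> * \<rho>bar powr (\<gamma> - 1))"
    and "n \<equiv> \<lambda>t x. \<rho> t x - \<rho>bar"
    and "drag \<equiv> \<lambda>t. \<mu> / (1 + t) powr lam"
    and "m \<equiv> \<lambda>i t x. \<rho> t x * u t x $ i"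
    and "mt \<equiv> \<lambda>i t x. \<rho>t t x * u t x $ i + \<rho> t x * ut i t x"
    and "mx \<equiv> \<lambda>i t x. \<rho> t x *\<^sub>R ux i t x + u t x $ i *\<^sub>R \<rho>x t x"
  assumes params: "A > 0" "\<gamma> > 1" "\<rho>bar > 0" "\<mu> > 0" "lam > 1" "M > 0"
    and T: "T > 0"
    and C1_\<rho>: "C1_slab T \<rho> \<rho>t \<rho>x"
    and C1_u: "\<And>i. C1_slab T (\<lambda>t x. u t x $ i) (ut i) (ux i)"
    and \<rho>_pos: "\<And>t x. t \<in> {0..T} \<Longrightarrow> 0 < \<rho> t x"
    and mass: "\<And>t x. t \<in> {0..T} \<Longrightarrow> \<rho>t t x + (\<Sum>i\<in>UNIV. mx i t x $ i) = 0"
    and momentum: "\<And>t x i. t \<in> {0..T} \<Longrightarrow>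
      mt i t x + (\<Sum>j\<in>UNIV. mx i t x $ j * u t x $ j + m i t x * ux j t x $ j)
        + A * \<gamma> * \<rho> t x powr (\<gamma> - 1) * \<rho>x t x $ i = - drag t * m i t x"
    and initially: "\<And>x. norm x > M \<Longrightarrow> \<rho> 0 x = \<rho>bar" "\<And>x. norm x > M \<Longrightarrow> u 0 x = 0"
begin

lemma c_pos: "c > 0" and c_sq: "c\<^sup>2 = A * \<gamma> * \<rho>bar powr (\<gamma> - 1)"
  using params by (auto simp: c_def)

lemma drag_nonneg: "0 \<le> t \<Longrightarrow> 0 \<le> drag t"
  using params by (simp add: drag_def)

lemma C1_m: "C1_slab T (m i) (mt i) (mx i)"
  unfolding m_def mt_def mx_def by (rule C1_slab_mult[OF C1_\<rho> C1_u])

lemma C1_n: "C1_slab T n \<rho>t \<rho>x"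
  using C1_slab_add[OF C1_\<rho> C1_slab_const[of T "- \<rho>bar"]] unfolding n_def by simp

text \<open>
  The energy of the acoustic system linearised at the background. Because the nonlinear terms
  contribute an error that is pointwise bounded by a multiple of the energy on compact sets, this quadratic
  energy already yields finite speed of propagation with the sharp constant c.
\<close>
definition energy :: "real \<Rightarrow> real^3 \<Rightarrow> real"
  where "energy t x = (c\<^sup>2 * (n t x)\<^sup>2 + (\<Sum>i\<in>UNIV. (m i t x)\<^sup>2)) / 2"

lemma C1_energy:
  "C1_slab T energy (\<lambda>t x. c\<^sup>2 * n t x * \<rho>t t x + (\<Sum>i\<in>UNIV. m i t x * mt i t x))
     (\<lambda>t x. (c\<^sup>2 * n t x) *\<^sub>R \<rho>x t x + (\<Sum>i\<in>UNIV. m i t x *\<^sub>R mx i t x))"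
proof -
  have *: "C1_slab T (\<lambda>t x. (c\<^sup>2 / 2) * (n t x * n t x) + (\<Sum>i\<in>UNIV. (1 / 2) * (m i t x * m i t x)))
    (\<lambda>t x. (c\<^sup>2 / 2) * (\<rho>t t x * n t x + n t x * \<rho>t t x)
       + (\<Sum>i\<in>UNIV. (1 / 2) * (mt i t x * m i t x + m i t x * mt i t x)))
    (\<lambda>t x. (c\<^sup>2 / 2) *\<^sub>R (n t x *\<^sub>R \<rho>x t x + n t x *\<^sub>R \<rho>x t x)
       + (\<Sum>i\<in>UNIV. (1 / 2) *\<^sub>R (m i t x *\<^sub>R mx i t x + m i t x *\<^sub>R mx i t x)))"
    by (intro C1_slab_add C1_slab_cmult C1_slab_mult C1_n C1_m C1_slab_sum finite)
  show ?thesis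
    by (rule C1_slab_cong[OF *])
       (auto simp: energy_def power2_eq_square sum_divide_distrib add_divide_distrib algebra_simps
         simp flip: scaleR_2 scaleR_add_left)
qed

lemma energy_nonneg: "0 \<le> energy t x"
  by (auto simp: energy_def intro!: divide_nonneg_pos add_nonneg_nonneg sum_nonneg)

lemma sq_le_energy: "(m i t x)\<^sup>2 \<le> 2 * energy t x" "c\<^sup>2 * (n t x)\<^sup>2 \<le> 2 * energy t x"
proof -
  define S where "S = (\<Sum>i\<in>UNIV. (m i t x)\<^sup>2)"
  define N where "N = c\<^sup>2 * (n t x)\<^sup>2"
  have "(m i t x)\<^sup>2 \<le> S" unfolding S_def by (rule member_le_sum) auto
  moreover have "0 \<le> S" "0 \<le> N" by (auto simp: S_def N_def intro!: sum_nonneg)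
  moreover have "2 * energy t x = N + S" by (simp add: energy_def S_def N_def)
  ultimately show "(m i t x)\<^sup>2 \<le> 2 * energy t x" "c\<^sup>2 * (n t x)\<^sup>2 \<le> 2 * energy t x"
    unfolding N_def by linarith+
qed

lemma mm_le_energy: "\<bar>m i t x\<bar> * \<bar>m j t x\<bar> \<le> 2 * energy t x"
proof -
  have "2 * (\<bar>m i t x\<bar> * \<bar>m j t x\<bar>) \<le> (m i t x)\<^sup>2 + (m j t x)\<^sup>2"
    using sum_squares_bound[of "\<bar>m i t x\<bar>" "\<bar>m j t x\<bar>"] by (simp add: mult.assoc)
  then show ?thesis using sq_le_energy(1)[of i t x] sq_le_energy(1)[of j t x] by linarith
qed

lemma mn_le_energy: "\<bar>m i t x\<bar> * \<bar>n t x\<bar> \<le> 2 * energy t x / c"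
proof -
  have "2 * (\<bar>m i t x\<bar> * \<bar>c * n t x\<bar>) \<le> (m i t x)\<^sup>2 + (c * n t x)\<^sup>2"
    using sum_squares_bound[of "\<bar>m i t x\<bar>" "\<bar>c * n t x\<bar>"] by (simp add: mult.assoc)
  then have "\<bar>m i t x\<bar> * \<bar>c * n t x\<bar> \<le> 2 * energy t x"
    using sq_le_energy(1)[of i t x] sq_le_energy(2)[of t x] unfolding power_mult_distrib by linarith
  then show ?thesis using c_pos by (simp add: abs_mult field_simps)
qed

text \<open>
  The energy flux c^2 n m is bounded by c times the energy, by the inequality of the means. This is
  where the speed of the cone is fixed.
\<close>
lemma flux_le_energy: "\<bar>\<Sum>i\<in>UNIV. v $ i * (c\<^sup>2 * n t x * m i t x)\<bar> \<le> c * norm v * energy t x"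
proof -
  define mv :: "real^3" where "mv = (\<chi> i. m i t x)"
  have e: "energy t x = ((c * \<bar>n t x\<bar>)\<^sup>2 + (norm mv)\<^sup>2) / 2"
    unfolding energy_def power_mult_distrib
    by (simp add: mv_def power2_norm_eq_inner inner_vec_def power2_eq_square[of "m _ _ _"])
  have "(\<Sum>i\<in>UNIV. v $ i * (c\<^sup>2 * n t x * m i t x)) = (c\<^sup>2 * n t x) * (v \<bullet> mv)"
    by (simp add: inner_vec_def mv_def sum_distrib_left mult_ac)
  also have "\<bar>\<dots>\<bar> \<le> (c\<^sup>2 * \<bar>n t x\<bar>) * (norm v * norm mv)"
    unfolding abs_mult by (intro mult_mono Cauchy_Schwarz_ineq2) (auto simp: abs_mult)
  also have "\<dots> = c * norm v * ((c * \<bar>n t x\<bar>) * norm mv)" by (simp add: power2_eq_square)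
  also have "\<dots> \<le> c * norm v * energy t x"
    using sum_squares_bound[of "c * \<bar>n t x\<bar>" "norm mv"] c_pos unfolding e
    by (intro mult_left_mono) auto
  finally show ?thesis .
qed

lemma sound_speed_lipschitz:
  assumes "r > 0"
  shows "\<bar>A * \<gamma> * r powr (\<gamma> - 1) - c\<^sup>2\<bar>
    \<le> A * \<gamma> * (\<gamma> - 1) * (r powr (\<gamma> - 2) + \<rho>bar powr (\<gamma> - 2)) * \<bar>r - \<rho>bar\<bar>"
proof (cases "r = \<rho>bar")
  case False
  define lo hi where "lo = min r \<rho>bar" and "hi = max r \<rho>bar"
  have lohi: "0 < lo" "lo < hi" using False assms params by (auto simp: lo_def hi_def)
  have "\<exists>z>lo. z < hi \<and> A * \<gamma> * hi powr (\<gamma> - 1) - A * \<gamma> * lo powr (\<gamma> - 1)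
      = (hi - lo) * (A * \<gamma> * ((\<gamma> - 1) * z powr (\<gamma> - 2)))"
  proof (rule MVT2[OF lohi(2)])
    fix z assume "lo \<le> z"
    then have "((\<lambda>z. z powr (\<gamma> - 1)) has_real_derivative (\<gamma> - 1) * z powr (\<gamma> - 1 - 1)) (at z)"
      using lohi by (intro has_real_derivative_powr) auto
    from DERIV_cmult[OF this, of "A * \<gamma>"]
    show "((\<lambda>z. A * \<gamma> * z powr (\<gamma> - 1)) has_real_derivative A * \<gamma> * ((\<gamma> - 1) * z powr (\<gamma> - 2))) (at z)"
      by simp
  qed
  then obtain z where z: "lo < z" "z < hi" and eq: "A * \<gamma> * hi powr (\<gamma> - 1) - A * \<gamma> * lo powr (\<gamma> - 1)
      = (hi - lo) * (A * \<gamma> * ((\<gamma> - 1) * z powr (\<gamma> - 2)))" by blast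
  have "z powr (\<gamma> - 2) \<le> lo powr (\<gamma> - 2) + hi powr (\<gamma> - 2)"
  proof (cases "\<gamma> \<ge> 2")
    case True
    then have "z powr (\<gamma> - 2) \<le> hi powr (\<gamma> - 2)" using z lohi by (intro powr_mono2) auto
    then show ?thesis using powr_ge_zero[of lo "\<gamma> - 2"] by linarith
  next
    case False
    then have "z powr (\<gamma> - 2) \<le> lo powr (\<gamma> - 2)" using z lohi by (intro powr_mono2') auto
    then show ?thesis using powr_ge_zero[of hi "\<gamma> - 2"] by linarith
  qed
  also have "\<dots> = r powr (\<gamma> - 2) + \<rho>bar powr (\<gamma> - 2)" by (auto simp: lo_def hi_def min_def max_def)
  finally have zb: "z powr (\<gamma> - 2) \<le> r powr (\<gamma> - 2) + \<rho>bar powr (\<gamma> - 2)" .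
  have "\<bar>A * \<gamma> * r powr (\<gamma> - 1) - c\<^sup>2\<bar> = \<bar>A * \<gamma> * hi powr (\<gamma> - 1) - A * \<gamma> * lo powr (\<gamma> - 1)\<bar>"
    unfolding c_sq by (auto simp: lo_def hi_def min_def max_def abs_minus_commute)
  also have "\<dots> = A * \<gamma> * (\<gamma> - 1) * z powr (\<gamma> - 2) * (hi - lo)"
    unfolding eq using lohi params by (simp add: abs_mult mult_ac)
  also have "\<dots> \<le> A * \<gamma> * (\<gamma> - 1) * (r powr (\<gamma> - 2) + \<rho>bar powr (\<gamma> - 2)) * (hi - lo)"
    using zb lohi params by (intro mult_right_mono mult_left_mono) auto
  also have "hi - lo = \<bar>r - \<rho>bar\<bar>" by (auto simp: lo_def hi_def)
  finally show ?thesis .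
qed (simp add: c_sq)

text \<open>
  After the balance laws are inserted, the energy production is a sum of three kinds of terms:
  (c^2 - p'(\<rho>)) m . grad \<rho>, which is of second order in the perturbation because p' is Lipschitz;
  the convective terms, of second order in m with coefficients bounded on compact sets; and the
  drag, which is dissipative.
\<close>
lemma energy_production_bound:
  assumes S: "compact S" "S \<subseteq> {0..T} \<times> UNIV"
  obtains K where "\<And>t x. (t, x) \<in> S \<Longrightarrow>
    c\<^sup>2 * n t x * \<rho>t t x + (\<Sum>i\<in>UNIV. m i t x * mt i t x)
      + (\<Sum>i\<in>UNIV. c\<^sup>2 * (\<rho>x t x $ i * m i t x + n t x * mx i t x $ i)) \<le> K * energy t x"
proof -
  define L where "L r = A * \<gamma> * (\<gamma> - 1) * (r powr (\<gamma> - 2) + \<rho>bar powr (\<gamma> - 2))" for r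
  define G where "G t x = norm (\<rho>x t x) + (\<Sum>i\<in>UNIV. norm (mx i t x)) + (\<Sum>i\<in>UNIV. norm (ux i t x))
      + 1 / \<rho> t x + L (\<rho> t x)" for t x
  have r: "0 < \<rho> (fst z) (snd z)" if "z \<in> {0..T} \<times> UNIV" for z
    using \<rho>_pos that by (metis fst_conv mem_Sigma_iff prod.collapse)
  have "continuous_on ({0..T} \<times> UNIV) (\<lambda>z. G (fst z) (snd z))"
    unfolding G_def L_def
    by (intro continuous_intros C1_slabD[OF C1_\<rho>] C1_slabD[OF C1_m] C1_slabD[OF C1_u])
       (use r in \<open>auto simp: less_imp_neq[OF r, symmetric]\<close>)
  then have "bounded ((\<lambda>z. G (fst z) (snd z)) ` S)"
    by (intro compact_imp_bounded compact_continuous_image[OF _ S(1)] continuous_on_subset[OF _ S(2)])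
  then obtain B where B0: "B > 0" and B: "\<And>z. z \<in> S \<Longrightarrow> \<bar>G (fst z) (snd z)\<bar> \<le> B"
    by (auto simp: bounded_pos)
  define K where "K = (\<Sum>i\<in>(UNIV::3 set). (2 * B * B / c) + (\<Sum>j\<in>(UNIV::3 set). 2 * B * B + 2 * B))"
  show ?thesis
  proof
    fix t x assume tx: "(t, x) \<in> S"
    then have t: "t \<in> {0..T}" using S by auto
    have pos: "\<rho> t x > 0" using \<rho>_pos[OF t] .
    have L0: "0 \<le> L (\<rho> t x)" using params by (simp add: L_def)
    have G: "G t x \<le> B" using B[OF tx] by simp
    have nn: "0 \<le> norm (\<rho>x t x)" "0 \<le> (\<Sum>i\<in>UNIV. norm (mx i t x))" "0 \<le> (\<Sum>i\<in>UNIV. norm (ux i t x))"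
      "0 \<le> 1 / \<rho> t x" using pos by (auto intro: sum_nonneg)
    have mem: "norm (mx i t x) \<le> (\<Sum>i\<in>UNIV. norm (mx i t x))" "norm (ux i t x) \<le> (\<Sum>i\<in>UNIV. norm (ux i t x))" for i
      by (rule member_le_sum; simp)+
    have b1: "\<bar>\<rho>x t x $ i\<bar> \<le> B" for i
      using component_le_norm_cart[of "\<rho>x t x" i] G nn L0 unfolding G_def by linarith
    have b2: "\<bar>mx i t x $ j\<bar> \<le> B" for i j
      using component_le_norm_cart[of "mx i t x" j] mem(1)[of i] G nn L0 unfolding G_def by linarith
    have b3: "\<bar>ux i t x $ j\<bar> \<le> B" for i j
      using component_le_norm_cart[of "ux i t x" j] mem(2)[of i] G nn L0 unfolding G_def by linarith
    have b4: "1 / \<rho> t x \<le> B" using G nn L0 unfolding G_def by linarith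
    have b5: "L (\<rho> t x) \<le> B" using G nn L0 unfolding G_def by linarith
    let ?e = "energy t x"
    note e0 = energy_nonneg[of t x]
    have term1: "m i t x * ((c\<^sup>2 - A * \<gamma> * \<rho> t x powr (\<gamma> - 1)) * \<rho>x t x $ i) \<le> (2 * B * B / c) * ?e" for i
    proof -
      have "\<bar>c\<^sup>2 - A * \<gamma> * \<rho> t x powr (\<gamma> - 1)\<bar> \<le> B * \<bar>n t x\<bar>"
        using sound_speed_lipschitz[OF pos] mult_right_mono[OF b5, of "\<bar>n t x\<bar>"]
        by (simp add: L_def n_def abs_minus_commute)
      then have "\<bar>(c\<^sup>2 - A * \<gamma> * \<rho> t x powr (\<gamma> - 1)) * \<rho>x t x $ i\<bar> \<le> (B * \<bar>n t x\<bar>) * B"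
        unfolding abs_mult using b1 B0 by (intro mult_mono) auto
      then have "\<bar>m i t x * ((c\<^sup>2 - A * \<gamma> * \<rho> t x powr (\<gamma> - 1)) * \<rho>x t x $ i)\<bar> \<le> \<bar>m i t x\<bar> * ((B * \<bar>n t x\<bar>) * B)"
        unfolding abs_mult[of "m i t x"] by (intro mult_left_mono) auto
      also have "\<dots> = (B * B) * (\<bar>m i t x\<bar> * \<bar>n t x\<bar>)" by simp
      also have "\<dots> \<le> (B * B) * (2 * ?e / c)" using mn_le_energy B0 by (intro mult_left_mono) auto
      finally show ?thesis by (simp add: mult_ac)
    qed
    have term2: "- (m i t x * (mx i t x $ j * u t x $ j + m i t x * ux j t x $ j)) \<le> (2 * B * B + 2 * B) * ?e" for i j
    proof -
      have uj: "u t x $ j = m j t x * (1 / \<rho> t x)" using pos by (simp add: m_def)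
      have "\<bar>mx i t x $ j * (1 / \<rho> t x)\<bar> \<le> B * B"
        unfolding abs_mult using b2 b4 B0 pos by (intro mult_mono) auto
      then have "\<bar>(mx i t x $ j * (1 / \<rho> t x)) * (m i t x * m j t x)\<bar> \<le> (B * B) * (2 * ?e)"
        unfolding abs_mult[of _ "m i t x * m j t x"] using mm_le_energy[of i t x j] B0
        by (intro mult_mono) (auto simp: abs_mult)
      moreover have "\<bar>ux j t x $ j * (m i t x * m i t x)\<bar> \<le> B * (2 * ?e)"
        unfolding abs_mult[of _ "m i t x * m i t x"] using mm_le_energy[of i t x i] b3 B0
        by (intro mult_mono) (auto simp: abs_mult)
      moreover have "m i t x * (mx i t x $ j * u t x $ j + m i t x * ux j t x $ j)
        = (mx i t x $ j * (1 / \<rho> t x)) * (m i t x * m j t x) + ux j t x $ j * (m i t x * m i t x)"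
        unfolding uj by (simp add: algebra_simps)
      moreover have "(2 * B * B + 2 * B) * ?e = (B * B) * (2 * ?e) + B * (2 * ?e)" by (simp add: algebra_simps)
      ultimately show ?thesis by linarith
    qed
    have term3: "- (m i t x * (drag t * m i t x)) \<le> 0" for i
      using drag_nonneg[of t] t by (simp add: mult.left_commute)
    have "c\<^sup>2 * n t x * \<rho>t t x + (\<Sum>i\<in>UNIV. m i t x * mt i t x)
        + (\<Sum>i\<in>UNIV. c\<^sup>2 * (\<rho>x t x $ i * m i t x + n t x * mx i t x $ i))
      = c\<^sup>2 * n t x * (\<rho>t t x + (\<Sum>i\<in>UNIV. mx i t x $ i))
        + (\<Sum>i\<in>UNIV. m i t x * (mt i t x + c\<^sup>2 * \<rho>x t x $ i))"
      by (simp add: sum.distrib sum_distrib_left algebra_simps)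
    also have "\<dots> = (\<Sum>i\<in>UNIV. m i t x * (mt i t x + c\<^sup>2 * \<rho>x t x $ i))" using mass[OF t] by simp
    also have "\<dots> \<le> (\<Sum>i\<in>(UNIV::3 set). ((2 * B * B / c) + (\<Sum>j\<in>(UNIV::3 set). 2 * B * B + 2 * B)) * ?e)"
    proof (rule sum_mono)
      fix i :: 3
      define R where "R = (\<Sum>j\<in>UNIV. mx i t x $ j * u t x $ j + m i t x * ux j t x $ j)"
      have mt: "mt i t x = - R - A * \<gamma> * \<rho> t x powr (\<gamma> - 1) * \<rho>x t x $ i - drag t * m i t x"
        using momentum[OF t, of i x] by (simp add: R_def)
      have "m i t x * (mt i t x + c\<^sup>2 * \<rho>x t x $ i)
        = m i t x * ((c\<^sup>2 - A * \<gamma> * \<rho> t x powr (\<gamma> - 1)) * \<rho>x t x $ i)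
          + - (m i t x * R) + - (m i t x * (drag t * m i t x))"
        unfolding mt by (simp add: algebra_simps)
      also have "- (m i t x * R) \<le> (\<Sum>j\<in>(UNIV::3 set). (2 * B * B + 2 * B) * ?e)"
        unfolding R_def sum_distrib_left sum_negf[symmetric] by (intro sum_mono term2)
      finally show "m i t x * (mt i t x + c\<^sup>2 * \<rho>x t x $ i)
          \<le> ((2 * B * B / c) + (\<Sum>j\<in>(UNIV::3 set). 2 * B * B + 2 * B)) * ?e"
        using term1[of i] term3[of i] by (simp add: distrib_right)
    qed
    also have "\<dots> = K * ?e" by (simp add: K_def)
    finally show "c\<^sup>2 * n t x * \<rho>t t x + (\<Sum>i\<in>UNIV. m i t x * mt i t x)
      + (\<Sum>i\<in>UNIV. c\<^sup>2 * (\<rho>x t x $ i * m i t x + n t x * mx i t x $ i)) \<le> K * energy t x" .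
  qed
qed

text \<open>
  For R = |y| - M the cone |x - y| < R - c t starts outside the initial perturbation. Its cutoff decreases
  in time at least as fast as the flux can supply energy, so the energy integrated against the
  cutoff satisfies a Gronwall inequality, and it vanishes initially. At time t1 the point y is still in
  the cone.
\<close>
lemma finite_speed:
  assumes t1: "t1 \<in> {0..T}" and y: "norm y > M + c * t1"
  shows "n t1 y = 0" "u t1 y = 0"
proof -
  define R where "R = norm y - M"
  have R: "c * t1 < R" "c * s \<le> c * t1" if "s \<le> t1" for s
    using y c_pos that by (auto simp: R_def)
  define q where "q s x = max 0 ((R - c * s)\<^sup>2 - (norm (x - y))\<^sup>2)" for s and x :: "real^3"
  have cone: "C1_slab T (\<lambda>s x. (q s x)\<^sup>2) (\<lambda>s x. 2 * q s x * (- 2 * c * (R - c * s)))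
     (\<lambda>s x. (2 * q s x) *\<^sub>R ((- 2) *\<^sub>R (x - y)))"
    unfolding q_def by (rule C1_slab_cone)
  obtain a b where box: "cball 0 ((norm y + R) + 1) \<subseteq> cbox a (b :: real^3)" by (rule cball_subset_cbox)
  have q0: "q s x = 0" if "s \<in> {0..t1}" "norm (x - y) \<ge> R - c * s" for s x
  proof -
    have "0 \<le> R - c * s" using R[of s] that by auto
    then show ?thesis using that by (auto simp: q_def intro!: max_absorb1 power_mono)
  qed
  have q0': "q s x = 0" if "s \<in> {0..t1}" "norm (x - y) > R" for s x
    using that c_pos by (intro q0) (auto intro: order_trans[of _ R])
  have compS: "compact ({0..t1} \<times> cball y R)" by (intro compact_Times) auto
  have subS: "{0..t1} \<times> cball y R \<subseteq> {0..T} \<times> UNIV" using t1 by auto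
  obtain K where K: "\<And>s x. (s, x) \<in> {0..t1} \<times> cball y R \<Longrightarrow>
    c\<^sup>2 * n s x * \<rho>t s x + (\<Sum>i\<in>UNIV. m i s x * mt i s x)
      + (\<Sum>i\<in>UNIV. c\<^sup>2 * (\<rho>x s x $ i * m i s x + n s x * mx i s x $ i)) \<le> K * energy s x"
    using energy_production_bound[OF compS subS] by blast
  define F where "F s = integral (cbox a b) (\<lambda>x. (q s x)\<^sup>2 * energy s x)" for s
  let ?ed = "\<lambda>s x. (2 * q s x * (- 2 * c * (R - c * s))) * energy s x
        + (q s x)\<^sup>2 * (c\<^sup>2 * n s x * \<rho>t s x + (\<Sum>i\<in>UNIV. m i s x * mt i s x))"
  have qe: "C1_slab T (\<lambda>s x. (q s x)\<^sup>2 * energy s x)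
     (\<lambda>s x. ?ed s x)
     (\<lambda>s x. (q s x)\<^sup>2 *\<^sub>R ((c\<^sup>2 * n s x) *\<^sub>R \<rho>x s x + (\<Sum>i\<in>UNIV. m i s x *\<^sub>R mx i s x))
        + energy s x *\<^sub>R ((2 * q s x) *\<^sub>R ((- 2) *\<^sub>R (x - y))))"
    by (rule C1_slab_mult[OF cone C1_energy])
  define fl where "fl i s x = (q s x)\<^sup>2 *\<^sub>R (c\<^sup>2 *\<^sub>R (n s x *\<^sub>R mx i s x + m i s x *\<^sub>R \<rho>x s x))
        + (c\<^sup>2 * (n s x * m i s x)) *\<^sub>R ((2 * q s x) *\<^sub>R ((- 2) *\<^sub>R (x - y)))" for i s x
  have flux: "C1_slab T (\<lambda>s x. (q s x)\<^sup>2 * (c\<^sup>2 * (n s x * m i s x)))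
     (\<lambda>s x. (2 * q s x * (- 2 * c * (R - c * s))) * (c\<^sup>2 * (n s x * m i s x))
        + (q s x)\<^sup>2 * (c\<^sup>2 * (\<rho>t s x * m i s x + n s x * mt i s x))) (fl i)" for i
    unfolding fl_def by (rule C1_slab_mult[OF cone C1_slab_cmult[OF C1_slab_mult[OF C1_n C1_m]]])
  define F' where "F' s = integral (cbox a b) (\<lambda>x. ?ed s x)" for s
  have dF: "(F has_real_derivative F' s) (at s within {0..T})" if "s \<in> {0..T}" for s
    unfolding F_def F'_def by (rule C1_slab_integral_deriv[OF qe that])
  have sT: "s \<in> {0..T}" if "s \<in> {0..t1}" for s using that t1 by auto
  have le: "F' s \<le> K * F s" if s: "s \<in> {0..t1}" for s
  proof -
    have "integral (cbox a b) (\<lambda>x. fl i s x \<bullet> axis i 1) = 0" for i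
    proof (rule integral_directional_derivative_eq_0[OF C1_slabD(5)[OF flux sT[OF s]] _ _ box])
      show "continuous_on UNIV (fl i s)" by (rule C1_slab_slice[OF C1_slabD(3)[OF flux] sT[OF s]])
      show "(q s x)\<^sup>2 * (c\<^sup>2 * (n s x * m i s x)) = 0" if "norm x > norm y + R" for x
      proof -
        have "norm x \<le> norm (x - y) + norm y" using norm_triangle_ineq[of "x - y" y] by simp
        then show ?thesis using q0'[OF s, of x] that by auto
      qed
    qed (simp add: norm_axis_1)
    then have fl0: "integral (cbox a b) (\<lambda>x. fl i s x $ i) = 0" for i
      by (simp add: inner_axis)
    have contfl: "continuous_on ({0..T} \<times> UNIV) (\<lambda>z. fl i (fst z) (snd z) $ i)" for i
      by (intro continuous_intros C1_slabD(3)[OF flux])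
    have intfl: "(\<lambda>x. fl i s x $ i) integrable_on cbox a b" for i
      by (rule C1_slab_integrable[OF contfl sT[OF s]])
    have int': "(\<lambda>x. ?ed s x) integrable_on cbox a b"
      by (rule C1_slab_integrable[OF C1_slabD(2)[OF qe] sT[OF s]])
    have int: "(\<lambda>x. K * ((q s x)\<^sup>2 * energy s x)) integrable_on cbox a b"
      by (intro integrable_on_mult_right C1_slab_integrable[OF C1_slabD(1)[OF qe] sT[OF s]])
    \<comment> \<open>Adding the integrated divergence of the weighted flux, which is zero, cancels the flux terms.\<close>
    have "F' s = F' s + (\<Sum>i\<in>UNIV. integral (cbox a b) (\<lambda>x. fl i s x $ i))" by (simp add: fl0)
    also have "\<dots> = integral (cbox a b) (\<lambda>x. ?ed s x
        + (\<Sum>i\<in>UNIV. fl i s x $ i))"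
      unfolding F'_def integral_sum[OF finite intfl, symmetric]
      by (rule integral_add[symmetric, OF int' integrable_sum[OF finite intfl]])
    also have "\<dots> \<le> integral (cbox a b) (\<lambda>x. K * ((q s x)\<^sup>2 * energy s x))"
    proof (rule integral_le[OF integrable_add[OF int' integrable_sum[OF finite intfl]] int])
      fix x
      define Q where "Q = (\<Sum>i\<in>UNIV. (x - y) $ i * (c\<^sup>2 * n s x * m i s x))"
      define D where "D = c\<^sup>2 * n s x * \<rho>t s x + (\<Sum>i\<in>UNIV. m i s x * mt i s x)
        + (\<Sum>i\<in>UNIV. c\<^sup>2 * (\<rho>x s x $ i * m i s x + n s x * mx i s x $ i))"
      have "?ed s x
        + (\<Sum>i\<in>UNIV. fl i s x $ i)
        = (q s x)\<^sup>2 * D - 4 * q s x * (c * (R - c * s) * energy s x + Q)"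
        by (simp add: fl_def D_def Q_def sum.distrib sum_distrib_left algebra_simps sum_subtractf)
      also have "\<dots> \<le> K * ((q s x)\<^sup>2 * energy s x)"
      proof (cases "q s x = 0")
        case False
        then have lt: "norm (x - y) < R - c * s" using q0[OF s, of x] by linarith
        moreover have "c * s \<ge> 0" using c_pos s by simp
        ultimately have "(s, x) \<in> {0..t1} \<times> cball y R" using s by (auto simp: dist_norm norm_minus_commute)
        then have "D \<le> K * energy s x" unfolding D_def by (rule K)
        then have 1: "(q s x)\<^sup>2 * D \<le> (q s x)\<^sup>2 * (K * energy s x)" by (intro mult_left_mono) auto
        have "c * norm (x - y) * energy s x \<le> c * (R - c * s) * energy s x"
          using lt c_pos energy_nonneg by (intro mult_right_mono mult_left_mono) auto
        then have "0 \<le> c * (R - c * s) * energy s x + Q"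
          using flux_le_energy[of "x - y" s x] unfolding Q_def[symmetric] by linarith
        moreover have "0 \<le> q s x" by (simp add: q_def)
        ultimately have "0 \<le> 4 * q s x * (c * (R - c * s) * energy s x + Q)" by simp
        then show ?thesis using 1 by (simp add: mult_ac)
      qed simp
      finally show "?ed s x
        + (\<Sum>i\<in>UNIV. fl i s x $ i) \<le> K * ((q s x)\<^sup>2 * energy s x)" .
    qed
    also have "\<dots> = K * F s" by (simp add: F_def)
    finally show ?thesis .
  qed
  have F0: "F 0 = 0"
  proof -
    have "(q 0 x)\<^sup>2 * energy 0 x = 0" for x
    proof (cases "norm (x - y) < R")
      case True
      then have "norm x > M" using norm_triangle_ineq2[of y x] by (simp add: R_def norm_minus_commute)
      then show ?thesis using initially[of x] by (simp add: energy_def n_def m_def)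
    qed (use q0[of 0 x] t1 in auto)
    then show ?thesis unfolding F_def by (simp only: integral_0)
  qed
  have "F t1 \<le> 0"
  proof (rule Gronwall_zero[where E = F and E' = F' and K = K])
    show "continuous_on {0..t1} F"
      by (rule continuous_on_subset[OF DERIV_continuous_on[OF dF]]) (use t1 in auto)
    show "(F has_real_derivative F' s) (at s)" if "0 < s" "s < t1" for s
      using dF[of s] that t1 by (simp add: at_within_Icc_at)
  qed (use t1 le F0 in auto)
  have cont: "continuous_on (cbox a b) (\<lambda>x. (q t1 x)\<^sup>2 * energy t1 x)"
    by (rule continuous_on_subset[OF C1_slab_slice[OF C1_slabD(1)[OF qe] t1] subset_UNIV])
  have nn: "0 \<le> (q t1 x)\<^sup>2 * energy t1 x" for x using energy_nonneg by simp
  have "0 \<le> F t1" unfolding F_def using nn by (intro integral_nonneg integrable_continuous cont) auto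
  then have i0: "((\<lambda>x. (q t1 x)\<^sup>2 * energy t1 x) has_integral 0) (cbox a b)"
    using integrable_integral[OF integrable_continuous[OF cont]] \<open>F t1 \<le> 0\<close> by (simp add: F_def)
  have Rpos: "0 < R - c * t1" using R(1)[of t1] by simp
  then have R0: "0 < R" using c_pos t1 by (auto intro: le_less_trans[of 0 "c * t1"])
  have "y \<in> ball 0 (norm y + R + 1)" using R0 by simp
  moreover have "ball 0 (norm y + R + 1) \<subseteq> box a b"
    using box interior_mono[OF box] by (simp add: interior_cbox)
  ultimately have "y \<in> box a b" by blast
  then have "(q t1 y)\<^sup>2 * energy t1 y = 0"
    using has_integral_0_cbox_imp_0[OF cont nn i0] box_subset_cbox[of a b] by blast
  moreover have "q t1 y > 0" using Rpos by (simp add: q_def)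
  ultimately have e0: "energy t1 y = 0" by simp
  have "c\<^sup>2 * (n t1 y)\<^sup>2 \<le> 0" using sq_le_energy(2)[of t1 y] e0 by simp
  then show "n t1 y = 0" using c_pos by (simp add: mult_le_0_iff)
  have "m i t1 y = 0" for i using sq_le_energy(1)[of i t1 y] e0 by simp
  then show "u t1 y = 0" using \<rho>_pos[OF t1, of y] by (simp add: m_def vec_eq_iff)
qed

section \<open>Balance laws tested against the radial weights\<close>

definition max_radius :: real where "max_radius = M + c * T"

text \<open>
  Integration over a box that contains the perturbation up to time T with a margin of 1, so that
  integrals over all of space can be differentiated under the integral sign.
\<close>
definition bulk :: "(real^3 \<Rightarrow> real) \<Rightarrow> real"
  where "bulk f = integral (cbox (vec (- (max_radius + 1))) (vec (max_radius + 1))) f"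

text \<open>
  The weighted surplus of mass outside the ball of radius l; integrating over all of space is harmless
  because the weight vanishes inside the ball.
\<close>
definition P :: "real \<Rightarrow> real \<Rightarrow> real"
  where "P s l = integral UNIV (\<lambda>x. shell_weight l x * n s x)"

definition gauge_pressure :: "real \<Rightarrow> real^3 \<Rightarrow> real"
  where "gauge_pressure s x = A * \<rho> s x powr \<gamma> - A * \<rho>bar powr \<gamma>"

lemma at_rest:
  assumes "s \<in> {0..T}" "norm x > M + c * s"
  shows "n s x = 0" "u s x = 0" "m i s x = 0" "gauge_pressure s x = 0"
proof -
  show n: "n s x = 0" and u: "u s x = 0" using finite_speed[OF assms] .
  show "m i s x = 0" unfolding m_def u by simp
  have "\<rho> s x = \<rho>bar" using n unfolding n_def by simp
  then show "gauge_pressure s x = 0" by (simp only: gauge_pressure_def diff_self)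
qed

lemma at_rest':
  assumes "s \<in> {0..T}" "norm x > max_radius"
  shows "n s x = 0" "u s x = 0" "m i s x = 0" "gauge_pressure s x = 0"
proof -
  have "c * s \<le> c * T" using assms c_pos by auto
  then have "norm x > M + c * s" using assms by (simp add: max_radius_def)
  then show "n s x = 0" "u s x = 0" "m i s x = 0" "gauge_pressure s x = 0" by (rule at_rest[OF assms(1)]; assumption)+
qed

lemma bulk_box: "cball 0 (max_radius + 1) \<subseteq> cbox (vec (- (max_radius + 1))) (vec (max_radius + 1) :: real^3)"
proof
  fix x :: "real^3" assume "x \<in> cball 0 (max_radius + 1)"
  then have "\<bar>x $ i\<bar> \<le> max_radius + 1" for i using component_le_norm_cart[of x i] by auto
  then show "x \<in> cbox (vec (- (max_radius + 1))) (vec (max_radius + 1))"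
    unfolding mem_box_cart abs_le_iff vec_component by (metis minus_le_iff)
qed

lemma bulk_eq_integral_UNIV:
  assumes "\<And>x. norm x > max_radius \<Longrightarrow> f x = 0"
  shows "bulk f = integral UNIV f"
  unfolding bulk_def
proof (rule integral_cbox_supported)
  fix x assume "x \<notin> cbox (vec (- (max_radius + 1))) (vec (max_radius + 1) :: real^3)"
  then have "x \<notin> cball 0 (max_radius + 1)" using bulk_box by blast
  then show "f x = 0" by (intro assms) auto
qed

lemma P_eq_bulk: "s \<in> {0..T} \<Longrightarrow> P s l = bulk (\<lambda>x. shell_weight l x * n s x)"
  unfolding P_def by (rule bulk_eq_integral_UNIV[symmetric]) (simp add: at_rest'(1))

lemma bulk_integrable:
  "continuous_on UNIV f \<Longrightarrow> f integrable_on cbox (vec (- (max_radius + 1))) (vec (max_radius + 1) :: real^3)"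
  for f :: "real^3 \<Rightarrow> real"
  using integrable_continuous[OF continuous_on_subset[OF _ subset_UNIV]] .

lemma bulk_add: "continuous_on UNIV f \<Longrightarrow> continuous_on UNIV g \<Longrightarrow> bulk (\<lambda>x. f x + g x) = bulk f + bulk g"
  unfolding bulk_def by (intro integral_add bulk_integrable)

lemma bulk_cmult: "bulk (\<lambda>x. k * f x) = k * bulk f"
  unfolding bulk_def by (rule integral_mult_right)

lemma bulk_linear4:
  assumes f: "continuous_on UNIV f1" "continuous_on UNIV f2" "continuous_on UNIV f3" "continuous_on UNIV f4"
  shows "bulk (\<lambda>x. k * f1 x + f2 x + k' * (f3 x + f4 x))
    = k * bulk f1 + bulk f2 + k' * (bulk f3 + bulk f4)"
proof -
  have "bulk (\<lambda>x. k * f1 x + f2 x + k' * (f3 x + f4 x))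
      = bulk (\<lambda>x. k * f1 x + f2 x) + bulk (\<lambda>x. k' * (f3 x + f4 x))"
    by (intro bulk_add continuous_intros f)
  also have "bulk (\<lambda>x. k * f1 x + f2 x) = bulk (\<lambda>x. k * f1 x) + bulk f2"
    by (intro bulk_add continuous_intros f)
  finally show ?thesis by (simp only: bulk_cmult bulk_add[OF f(3,4)])
qed

lemma bulk_sum:
  "finite I \<Longrightarrow> (\<And>i. i \<in> I \<Longrightarrow> continuous_on UNIV (f i)) \<Longrightarrow> bulk (\<lambda>x. \<Sum>i\<in>I. f i x) = (\<Sum>i\<in>I. bulk (f i))"
  unfolding bulk_def by (intro integral_sum bulk_integrable)

lemma bulk_mono:
  "continuous_on UNIV f \<Longrightarrow> continuous_on UNIV g \<Longrightarrow> (\<And>x. f x \<le> g x) \<Longrightarrow> bulk f \<le> bulk g"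
  unfolding bulk_def by (intro integral_le bulk_integrable)

lemma bulk_deriv:
  "C1_slab T f ft fx \<Longrightarrow> s \<in> {0..T} \<Longrightarrow>
    ((\<lambda>s. bulk (f s)) has_real_derivative bulk (ft s)) (at s within {0..T})"
  unfolding bulk_def by (rule C1_slab_integral_deriv)

lemma bulk_gradient:
  assumes f: "C1_slab T f ft fx" and s: "s \<in> {0..T}"
    and supp: "\<And>x. norm x > max_radius \<Longrightarrow> f s x = 0"
  shows "bulk (\<lambda>x. fx s x $ i) = 0"
proof -
  have "bulk (\<lambda>x. fx s x \<bullet> axis i 1) = 0"
    unfolding bulk_def
    by (rule integral_directional_derivative_eq_0[OF C1_slabD(5)[OF f s]
          C1_slab_slice[OF C1_slabD(3)[OF f] s] supp bulk_box]) simp_all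
  then show ?thesis by (simp add: inner_axis)
qed

lemma C1_gauge_pressure: "C1_slab T gauge_pressure (\<lambda>s x. A * \<gamma> * \<rho> s x powr (\<gamma> - 1) * \<rho>t s x)
    (\<lambda>s x. (A * \<gamma> * \<rho> s x powr (\<gamma> - 1)) *\<^sub>R \<rho>x s x)"
proof -
  have d: "((\<lambda>r. A * r powr \<gamma> - A * \<rho>bar powr \<gamma>) has_real_derivative A * \<gamma> * r powr (\<gamma> - 1)) (at r)"
    if "r \<in> {0<..}" for r
  proof -
    have d: "((\<lambda>r. A * r powr \<gamma> - A * \<rho>bar powr \<gamma>) has_real_derivative A * (\<gamma> * r powr (\<gamma> - 1)) - 0) (at r)"
      using that by (intro DERIV_diff DERIV_cmult DERIV_const has_real_derivative_powr) auto
    then show ?thesis by (simp add: mult_ac)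
  qed
  show ?thesis unfolding gauge_pressure_def[abs_def]
    by (rule C1_slab_compose[OF C1_\<rho> _ d, where S = "{0<..}"]) (auto simp: \<rho>_pos intro!: continuous_intros)
qed

lemma slices:
  assumes "s \<in> {0..T}"
  shows "continuous_on UNIV (\<rho> s)" "continuous_on UNIV (n s)" "continuous_on UNIV (\<rho>t s)"
    "continuous_on UNIV (\<rho>x s)" "continuous_on UNIV (m i s)" "continuous_on UNIV (mt i s)"
    "continuous_on UNIV (mx i s)" "continuous_on UNIV (\<lambda>x. u s x $ i)" "continuous_on UNIV (ux i s)"
    "continuous_on UNIV (gauge_pressure s)" "continuous_on UNIV (u s)"
proof -
  show u: "continuous_on UNIV (\<lambda>x. u s x $ i)" for i by (rule C1_slab_slice[OF C1_slabD(1)[OF C1_u] assms])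
  show "continuous_on UNIV (u s)"
  proof -
    have "continuous_on UNIV (\<lambda>x. \<chi> i. u s x $ i)" by (intro continuous_on_vec_lambda u)
    then show ?thesis by simp
  qed
qed (rule C1_slab_slice[OF _ assms] C1_slabD[OF C1_\<rho>] C1_slabD[OF C1_n] C1_slabD[OF C1_m]
   C1_slabD[OF C1_u] C1_slabD[OF C1_gauge_pressure])+

definition radial_momentum :: "real \<Rightarrow> real^3 \<Rightarrow> real"
  where "radial_momentum s x = (\<Sum>i\<in>UNIV. x $ i * m i s x)"

definition excess :: "real \<Rightarrow> real^3 \<Rightarrow> real"
  where "excess s x = gauge_pressure s x - c\<^sup>2 * n s x"

lemma C1_radial_momentum:
  "C1_slab T radial_momentum (\<lambda>s x. \<Sum>i\<in>UNIV. x $ i * mt i s x)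
     (\<lambda>s x. \<Sum>i\<in>UNIV. x $ i *\<^sub>R mx i s x + m i s x *\<^sub>R axis i 1)"
proof -
  have *: "C1_slab T (\<lambda>s x. \<Sum>i\<in>UNIV. (x \<bullet> axis i 1) * m i s x)
     (\<lambda>s x. \<Sum>i\<in>UNIV. 0 * m i s x + (x \<bullet> axis i 1) * mt i s x)
     (\<lambda>s x. \<Sum>i\<in>UNIV. (x \<bullet> axis i 1) *\<^sub>R mx i s x + m i s x *\<^sub>R axis i 1)"
    by (intro C1_slab_sum finite C1_slab_mult C1_slab_coord C1_m)
  show ?thesis by (rule C1_slab_cong[OF *]) (simp_all add: radial_momentum_def inner_axis)
qed

context
  fixes l0 \<sigma> s :: real
  assumes pos: "\<And>s. s \<in> {0..T} \<Longrightarrow> 0 < l0 + \<sigma> * s" and s: "s \<in> {0..T}"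
begin

lemma weight_slices:
  "continuous_on UNIV (\<lambda>x::real^3. reach (l0 + \<sigma> * s) x)" "continuous_on UNIV (\<lambda>x::real^3. shell_weight (l0 + \<sigma> * s) x)"
  "continuous_on UNIV (\<lambda>x::real^3. shell_flux (l0 + \<sigma> * s) x)" "continuous_on UNIV (\<lambda>x::real^3. push (l0 + \<sigma> * s) x)"
  "continuous_on UNIV (\<lambda>x::real^3. push_slope (l0 + \<sigma> * s) x)"
  using pos[OF s] by (intro continuous_on_weights continuous_intros; simp)+

lemmas cont = weight_slices slices[OF s]

lemma cont_rm: "continuous_on UNIV (radial_momentum s)"
  unfolding radial_momentum_def by (intro continuous_intros cont)

lemma cont_excess: "continuous_on UNIV (excess s)"
  unfolding excess_def by (intro continuous_intros cont)

text \<open>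
  The mass balance tested against the weight, after integration by parts.
\<close>
lemma mass_flux:
  "bulk (\<lambda>x. shell_weight (l0 + \<sigma> * s) x * \<rho>t s x) = bulk (\<lambda>x. shell_flux (l0 + \<sigma> * s) x * radial_momentum s x)"
proof -
  have "bulk (\<lambda>x. (shell_weight (l0 + \<sigma> * s) x *\<^sub>R mx i s x + m i s x *\<^sub>R (shell_flux (l0 + \<sigma> * s) x *\<^sub>R x)) $ i) = 0" for i
    by (rule bulk_gradient[OF C1_slab_mult[OF C1_slab_shell_weight[OF pos] C1_m] s]) (simp_all add: at_rest'(3)[OF s])
  then have "0 = (\<Sum>i\<in>UNIV. bulk (\<lambda>x. (shell_weight (l0 + \<sigma> * s) x *\<^sub>R mx i s x + m i s x *\<^sub>R (shell_flux (l0 + \<sigma> * s) x *\<^sub>R x)) $ i))"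
    by simp
  also have "\<dots> = bulk (\<lambda>x. \<Sum>i\<in>UNIV. (shell_weight (l0 + \<sigma> * s) x *\<^sub>R mx i s x + m i s x *\<^sub>R (shell_flux (l0 + \<sigma> * s) x *\<^sub>R x)) $ i)"
    by (rule bulk_sum[symmetric]) (auto intro!: continuous_intros cont)
  also have "\<dots> = bulk (\<lambda>x. shell_flux (l0 + \<sigma> * s) x * radial_momentum s x + (-1) * (shell_weight (l0 + \<sigma> * s) x * \<rho>t s x))"
  proof (rule arg_cong[where f = bulk], rule ext)
    fix x
    have "\<rho>t s x = - (\<Sum>i\<in>UNIV. mx i s x $ i)" using mass[OF s, of x] by linarith
    then show "(\<Sum>i\<in>UNIV. (shell_weight (l0 + \<sigma> * s) x *\<^sub>R mx i s x + m i s x *\<^sub>R (shell_flux (l0 + \<sigma> * s) x *\<^sub>R x)) $ i)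
      = shell_flux (l0 + \<sigma> * s) x * radial_momentum s x + (-1) * (shell_weight (l0 + \<sigma> * s) x * \<rho>t s x)"
      by (simp add: radial_momentum_def sum.distrib sum_distrib_left sum_negf mult_ac)
  qed
  also have "\<dots> = bulk (\<lambda>x. shell_flux (l0 + \<sigma> * s) x * radial_momentum s x) + (-1) * bulk (\<lambda>x. shell_weight (l0 + \<sigma> * s) x * \<rho>t s x)"
    unfolding bulk_cmult[symmetric] by (intro bulk_add continuous_intros cont cont_rm)
  finally show ?thesis by simp
qed

text \<open>
  The divergence of the field push l x * x.
\<close>
lemma push_trace: "3 * push (l0 + \<sigma> * s) x + push_slope (l0 + \<sigma> * s) x * (x \<bullet> x) = 6 * reach (l0 + \<sigma> * s) x" for x :: "real^3"
proof (cases "norm x \<le> (l0 + \<sigma> * s)")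
  case True
  then show ?thesis using reach_eq_0[OF pos[OF s] True] by (simp add: push_def push_slope_def)
next
  case False
  then have "push_slope (l0 + \<sigma> * s) x * (x \<bullet> x) = (6 * reach (l0 + \<sigma> * s) x - 3 * (reach (l0 + \<sigma> * s) x)\<^sup>2) * (1 - reach (l0 + \<sigma> * s) x)"
    using pos[OF s] by (auto simp: push_slope_def max_def power2_norm_eq_inner[symmetric])
  then show ?thesis by (simp add: push_def power2_eq_square power3_eq_cube algebra_simps)
qed

text \<open>
  The momentum balance tested against the field push l x * x: the convective tensor meets the Jacobian of
  the field, and the pressure its divergence.
\<close>
lemma momentum_flux:
  "bulk (\<lambda>x. push (l0 + \<sigma> * s) x * (\<Sum>i\<in>UNIV. x $ i * mt i s x))
    = - drag s * bulk (\<lambda>x. push (l0 + \<sigma> * s) x * radial_momentum s x)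
      + bulk (\<lambda>x. \<rho> s x * (push (l0 + \<sigma> * s) x * (norm (u s x))\<^sup>2 + push_slope (l0 + \<sigma> * s) x * (x \<bullet> u s x)\<^sup>2) + 6 * reach (l0 + \<sigma> * s) x * gauge_pressure s x)"
proof -
  define gp where "gp i x = push (l0 + \<sigma> * s) x *\<^sub>R axis i 1 + x $ i *\<^sub>R (push_slope (l0 + \<sigma> * s) x *\<^sub>R x)" for i :: 3 and x :: "real^3"
  define F1 where "F1 i j x = ((push (l0 + \<sigma> * s) x * x $ i) *\<^sub>R (m i s x *\<^sub>R ux j s x + u s x $ j *\<^sub>R mx i s x)
      + (m i s x * u s x $ j) *\<^sub>R gp i x) $ j" for i j x
  define F2 where "F2 j x = ((push (l0 + \<sigma> * s) x * x $ j) *\<^sub>R ((A * \<gamma> * \<rho> s x powr (\<gamma> - 1)) *\<^sub>R \<rho>x s x)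
      + gauge_pressure s x *\<^sub>R gp j x) $ j" for j x
  have px: "C1_slab T (\<lambda>s x. push (l0 + \<sigma> * s) x * x $ i)
     (\<lambda>s x. \<sigma> * (- 3 * shell_flux (l0 + \<sigma> * s) x) * x $ i + push (l0 + \<sigma> * s) x * 0)
     (\<lambda>s x. push (l0 + \<sigma> * s) x *\<^sub>R axis i 1 + x $ i *\<^sub>R (push_slope (l0 + \<sigma> * s) x *\<^sub>R x))" for i :: 3
    using C1_slab_mult[OF C1_slab_push[OF pos] C1_slab_coord[of T "axis i (1::real)"]] by (simp add: inner_axis inner_real_def)
  have F1: "bulk (F1 i j) = 0" for i j
    unfolding F1_def gp_def
    by (rule bulk_gradient[OF C1_slab_mult[OF px C1_slab_mult[OF C1_m C1_u]] s]) (simp add: at_rest'[OF s])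
  have F2: "bulk (F2 j) = 0" for j
    unfolding F2_def gp_def
    by (rule bulk_gradient[OF C1_slab_mult[OF px C1_gauge_pressure] s]) (simp add: at_rest'[OF s])
  have rp: "\<forall>x. \<rho> s x \<noteq> 0" using \<rho>_pos[OF s] by (metis less_irrefl)
  have cF1: "continuous_on UNIV (F1 i j)" and cF2: "continuous_on UNIV (F2 j)" for i j
    unfolding F1_def F2_def gp_def by (intro continuous_intros cont; use rp in simp)+
  have pw: "push (l0 + \<sigma> * s) x * (\<Sum>i\<in>UNIV. x $ i * mt i s x) =
      (- drag s) * (push (l0 + \<sigma> * s) x * radial_momentum s x)
      + (\<rho> s x * (push (l0 + \<sigma> * s) x * (norm (u s x))\<^sup>2 + push_slope (l0 + \<sigma> * s) x * (x \<bullet> u s x)\<^sup>2) + 6 * reach (l0 + \<sigma> * s) x * gauge_pressure s x)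
      + (-1) * ((\<Sum>i\<in>UNIV. \<Sum>j\<in>UNIV. F1 i j x) + (\<Sum>j\<in>UNIV. F2 j x))" for x
  proof -
    define N where "N i = (\<Sum>j\<in>UNIV. mx i s x $ j * u s x $ j + m i s x * ux j s x $ j)" for i
    have mt: "mt i s x = - drag s * m i s x - N i - A * \<gamma> * \<rho> s x powr (\<gamma> - 1) * \<rho>x s x $ i" for i
      using momentum[OF s, of i x] by (simp add: N_def)
    have "(\<Sum>j\<in>UNIV. F1 i j x) = push (l0 + \<sigma> * s) x * x $ i * N i + m i s x * (\<Sum>j\<in>UNIV. u s x $ j * gp i x $ j)" for i
      by (simp add: F1_def N_def sum.distrib sum_distrib_left algebra_simps)
    moreover have "(\<Sum>j\<in>UNIV. u s x $ j * gp i x $ j) = push (l0 + \<sigma> * s) x * u s x $ i + push_slope (l0 + \<sigma> * s) x * x $ i * (x \<bullet> u s x)" for i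
    proof -
      have "(\<Sum>j\<in>UNIV. u s x $ j * gp i x $ j) = u s x \<bullet> gp i x" by (simp add: inner_vec_def)
      also have "\<dots> = push (l0 + \<sigma> * s) x * u s x $ i + push_slope (l0 + \<sigma> * s) x * x $ i * (x \<bullet> u s x)"
        by (simp add: gp_def inner_add_right inner_axis inner_commute[of x])
      finally show ?thesis .
    qed
    ultimately have F1_sum: "(\<Sum>j\<in>UNIV. F1 i j x) = push (l0 + \<sigma> * s) x * (x $ i * N i)
        + push (l0 + \<sigma> * s) x * (m i s x * u s x $ i) + push_slope (l0 + \<sigma> * s) x * (x \<bullet> u s x) * (x $ i * m i s x)" for i
      by (simp only:) (simp add: algebra_simps)
    have "(\<Sum>i\<in>UNIV. m i s x * u s x $ i) = \<rho> s x * (norm (u s x))\<^sup>2"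
      "(\<Sum>i\<in>UNIV. x $ i * m i s x) = \<rho> s x * (x \<bullet> u s x)"
      by (simp_all add: m_def power2_norm_eq_inner inner_vec_def sum_distrib_left mult_ac)
    then have S1: "(\<Sum>i\<in>UNIV. \<Sum>j\<in>UNIV. F1 i j x) = push (l0 + \<sigma> * s) x * (\<Sum>i\<in>UNIV. x $ i * N i)
        + \<rho> s x * (push (l0 + \<sigma> * s) x * (norm (u s x))\<^sup>2 + push_slope (l0 + \<sigma> * s) x * (x \<bullet> u s x)\<^sup>2)"
      unfolding F1_sum sum.distrib sum_distrib_left[symmetric]
      by (simp add: power2_eq_square algebra_simps)
    have "(\<Sum>j\<in>UNIV. gp j x $ j) = 3 * push (l0 + \<sigma> * s) x + push_slope (l0 + \<sigma> * s) x * (x \<bullet> x)"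
      by (simp add: gp_def sum.distrib inner_vec_def sum_distrib_left mult_ac axis_def)
    then have gp_tr: "(\<Sum>j\<in>UNIV. gp j x $ j) = 6 * reach (l0 + \<sigma> * s) x" unfolding push_trace .
    have F2x: "F2 j x = push (l0 + \<sigma> * s) x * (x $ j * (A * \<gamma> * \<rho> s x powr (\<gamma> - 1) * \<rho>x s x $ j)) + gauge_pressure s x * gp j x $ j" for j
      by (simp add: F2_def)
    have S2: "(\<Sum>j\<in>UNIV. F2 j x) = push (l0 + \<sigma> * s) x * (\<Sum>i\<in>UNIV. x $ i * (A * \<gamma> * \<rho> s x powr (\<gamma> - 1) * \<rho>x s x $ i))
        + 6 * reach (l0 + \<sigma> * s) x * gauge_pressure s x"
      unfolding F2x sum.distrib sum_distrib_left[symmetric] gp_tr by simp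
    have "push (l0 + \<sigma> * s) x * (\<Sum>i\<in>UNIV. x $ i * mt i s x) = (- drag s) * (push (l0 + \<sigma> * s) x * radial_momentum s x)
        - push (l0 + \<sigma> * s) x * (\<Sum>i\<in>UNIV. x $ i * N i)
        - push (l0 + \<sigma> * s) x * (\<Sum>i\<in>UNIV. x $ i * (A * \<gamma> * \<rho> s x powr (\<gamma> - 1) * \<rho>x s x $ i))"
      unfolding mt radial_momentum_def
      by (simp add: right_diff_distrib sum_subtractf sum_distrib_left sum_negf mult_ac)
    then show ?thesis unfolding S1 S2 by (simp add: algebra_simps)
  qed
  have "bulk (\<lambda>x. push (l0 + \<sigma> * s) x * (\<Sum>i\<in>UNIV. x $ i * mt i s x)) =
      (- drag s) * bulk (\<lambda>x. push (l0 + \<sigma> * s) x * radial_momentum s x)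
      + bulk (\<lambda>x. \<rho> s x * (push (l0 + \<sigma> * s) x * (norm (u s x))\<^sup>2 + push_slope (l0 + \<sigma> * s) x * (x \<bullet> u s x)\<^sup>2) + 6 * reach (l0 + \<sigma> * s) x * gauge_pressure s x)
      + (-1) * (bulk (\<lambda>x. \<Sum>i\<in>UNIV. \<Sum>j\<in>UNIV. F1 i j x) + bulk (\<lambda>x. \<Sum>j\<in>UNIV. F2 j x))"
    unfolding pw by (intro bulk_linear4 continuous_intros cont cont_rm cF1 cF2)
  also have "bulk (\<lambda>x. \<Sum>i\<in>UNIV. \<Sum>j\<in>UNIV. F1 i j x) = 0"
    by (subst bulk_sum; (intro finite continuous_intros cF1)?)+ (simp add: F1)
  also have "bulk (\<lambda>x. \<Sum>j\<in>UNIV. F2 j x) = 0"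
    by (subst bulk_sum; (intro finite cF2)?) (simp add: F2)
  finally show ?thesis by simp
qed

end

lemma bulk_linear3:
  assumes f: "continuous_on UNIV f1" "continuous_on UNIV f2" "continuous_on UNIV f3"
  shows "bulk (\<lambda>x. k * f1 x + k' * (f2 x + f3 x)) = k * bulk f1 + k' * (bulk f2 + bulk f3)"
proof -
  have "bulk (\<lambda>x. k * f1 x + k' * (f2 x + f3 x)) = bulk (\<lambda>x. k * f1 x) + bulk (\<lambda>x. k' * (f2 x + f3 x))"
    by (intro bulk_add continuous_intros f)
  then show ?thesis by (simp only: bulk_cmult bulk_add[OF f(2,3)])
qed

text \<open>
  With l = l0 + \<sigma> s moving at speed \<sigma> = c or \<sigma> = - c, the momentum tested
  against the travelling field and the mass tested against its time derivative are combined as in the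
  conserved bilinear pairing of two solutions of the wave equation. Consequently the mass fluxes
  cancel in its derivative, and what remains is the drag and the source.
\<close>
definition wave_functional :: "real \<Rightarrow> real \<Rightarrow> real \<Rightarrow> real"
  where "wave_functional \<sigma> l0 s = 1 / (6 * c) * bulk (\<lambda>x. push (l0 + \<sigma> * s) x * radial_momentum s x)
    + \<sigma> / (2 * c) * P s (l0 + \<sigma> * s)"

definition wave_source :: "real \<Rightarrow> real \<Rightarrow> real^3 \<Rightarrow> real"
  where "wave_source l s x = 1 / (6 * c) * (\<rho> s x * (push l x * (norm (u s x))\<^sup>2
      + push_slope l x * (x \<bullet> u s x)\<^sup>2)) + 1 / c * (reach l x * excess s x)"

lemma excess_above_tangent:
  assumes "s \<in> {0..T}" "0 < r"
  shows "A * (r powr \<gamma> - \<rho>bar powr \<gamma> - \<gamma> * \<rho>bar powr (\<gamma> - 1) * (r - \<rho>bar))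
      + A * \<gamma> * (r powr (\<gamma> - 1) - \<rho>bar powr (\<gamma> - 1)) * (\<rho> s x - r) \<le> excess s x"
  unfolding excess_def gauge_pressure_def n_def c_sq
  by (rule tangent_arith, rule mult_left_mono, rule powr_above_tangent)
     (use params \<rho>_pos[OF assms(1)] assms(2) in auto)

lemma excess_nonneg:
  assumes "s \<in> {0..T}" shows "0 \<le> excess s x"
  using excess_above_tangent[OF assms params(3), of x] by simp

lemma DERIV_P:
  assumes pos: "\<And>s. s \<in> {0..T} \<Longrightarrow> 0 < l0 + \<sigma> * s" and s: "s \<in> {0..T}"
  shows "((\<lambda>s. P s (l0 + \<sigma> * s)) has_real_derivative
      bulk (\<lambda>x. \<sigma> * (- 2 * reach (l0 + \<sigma> * s) x) * n s x + shell_weight (l0 + \<sigma> * s) x * \<rho>t s x))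
    (at s within {0..T})"
proof (rule has_field_derivative_transform_within[OF _ zero_less_one s])
  show "((\<lambda>s. bulk (\<lambda>x. shell_weight (l0 + \<sigma> * s) x * n s x)) has_real_derivative
      bulk (\<lambda>x. \<sigma> * (- 2 * reach (l0 + \<sigma> * s) x) * n s x + shell_weight (l0 + \<sigma> * s) x * \<rho>t s x))
    (at s within {0..T})"
    by (rule bulk_deriv[OF C1_slab_mult[OF C1_slab_shell_weight[OF pos] C1_n] s])
qed (simp add: P_eq_bulk)

text \<open>
  The term - 3 \<sigma> from moving the field is cancelled by the mass flux, and the motion of the weight
  contributes - c times the integral of reach * n, which completes the pressure term to the
  excess p - pbar - c^2 n.
\<close>
lemma wave_functional_deriv:
  assumes pos: "\<And>s. s \<in> {0..T} \<Longrightarrow> 0 < l0 + \<sigma> * s" and \<sigma>: "\<sigma>\<^sup>2 = c\<^sup>2" and s: "s \<in> {0..T}"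
  shows "(wave_functional \<sigma> l0 has_real_derivative
      - drag s * (1 / (6 * c) * bulk (\<lambda>x. push (l0 + \<sigma> * s) x * radial_momentum s x))
      + bulk (wave_source (l0 + \<sigma> * s) s)) (at s within {0..T})"
proof -
  let ?l = "l0 + \<sigma> * s"
  note cont = cont[OF pos s] cont_rm[OF pos s] cont_excess[OF pos s]
  note mf = mass_flux[OF pos s]
  note pf = momentum_flux[OF pos s]
  define B where "B = bulk (\<lambda>x. push ?l x * radial_momentum s x)"
  define Bf where "Bf = bulk (\<lambda>x. shell_flux ?l x * radial_momentum s x)"
  define Bq where "Bq = bulk (\<lambda>x. \<rho> s x * (push ?l x * (norm (u s x))\<^sup>2 + push_slope ?l x * (x \<bullet> u s x)\<^sup>2))"
  define Bp where "Bp = bulk (\<lambda>x. reach ?l x * gauge_pressure s x)"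
  define Bn where "Bn = bulk (\<lambda>x. reach ?l x * n s x)"
  have "((\<lambda>s. bulk (\<lambda>x. push (l0 + \<sigma> * s) x * radial_momentum s x)) has_real_derivative
      bulk (\<lambda>x. \<sigma> * (- 3 * shell_flux ?l x) * radial_momentum s x + push ?l x * (\<Sum>i\<in>UNIV. x $ i * mt i s x)))
    (at s within {0..T})"
    by (rule bulk_deriv[OF C1_slab_mult[OF C1_slab_push[OF pos] C1_radial_momentum] s])
  also have "bulk (\<lambda>x. \<sigma> * (- 3 * shell_flux ?l x) * radial_momentum s x + push ?l x * (\<Sum>i\<in>UNIV. x $ i * mt i s x))
    = bulk (\<lambda>x. (\<sigma> * -3) * (shell_flux ?l x * radial_momentum s x)) + bulk (\<lambda>x. push ?l x * (\<Sum>i\<in>UNIV. x $ i * mt i s x))"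
    by (subst bulk_add[symmetric]) (auto intro!: continuous_intros cont simp: mult_ac)
  also have "\<dots> = (\<sigma> * -3) * Bf + (- drag s * B + (Bq + 6 * Bp))"
  proof -
    have "bulk (\<lambda>x. \<rho> s x * (push ?l x * (norm (u s x))\<^sup>2 + push_slope ?l x * (x \<bullet> u s x)\<^sup>2) + 6 * reach ?l x * gauge_pressure s x)
      = Bq + bulk (\<lambda>x. 6 * (reach ?l x * gauge_pressure s x))"
      unfolding Bq_def by (subst bulk_add[symmetric]) (auto intro!: continuous_intros cont simp: mult_ac)
    then show ?thesis by (simp only: pf bulk_cmult Bf_def B_def Bp_def)
  qed
  finally have d1: "((\<lambda>s. bulk (\<lambda>x. push (l0 + \<sigma> * s) x * radial_momentum s x)) has_real_derivative
      (\<sigma> * -3) * Bf + (- drag s * B + (Bq + 6 * Bp))) (at s within {0..T})" .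
  have "bulk (\<lambda>x. \<sigma> * (- 2 * reach ?l x) * n s x + shell_weight ?l x * \<rho>t s x)
    = bulk (\<lambda>x. (\<sigma> * -2) * (reach ?l x * n s x)) + bulk (\<lambda>x. shell_weight ?l x * \<rho>t s x)"
    by (subst bulk_add[symmetric]) (auto intro!: continuous_intros cont simp: mult_ac)
  also have "\<dots> = (\<sigma> * -2) * Bn + Bf" by (simp only: mf bulk_cmult Bf_def Bn_def)
  finally have d2: "((\<lambda>s. P s (l0 + \<sigma> * s)) has_real_derivative (\<sigma> * -2) * Bn + Bf) (at s within {0..T})"
    using DERIV_P[OF pos s] by simp
  have src: "bulk (wave_source ?l s) = 1 / (6 * c) * Bq + 1 / c * (Bp - c\<^sup>2 * Bn)"
  proof -
    let ?q = "\<lambda>x. \<rho> s x * (push ?l x * (norm (u s x))\<^sup>2 + push_slope ?l x * (x \<bullet> u s x)\<^sup>2)"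
    have *: "a + k * (r * (p - q * n)) = a + k * (r * p + (- q) * (r * n))" for a k r p q n :: real
      by (simp add: algebra_simps)
    have ws: "wave_source ?l s = (\<lambda>x. (1 / (6 * c)) * ?q x
        + (1 / c) * (reach ?l x * gauge_pressure s x + (- c\<^sup>2) * (reach ?l x * n s x)))"
      unfolding wave_source_def excess_def by (rule ext) (rule *)
    have "bulk (wave_source ?l s) = (1 / (6 * c)) * bulk ?q
        + (1 / c) * (bulk (\<lambda>x. reach ?l x * gauge_pressure s x) + bulk (\<lambda>x. (- c\<^sup>2) * (reach ?l x * n s x)))"
      unfolding ws by (rule bulk_linear3; intro continuous_intros cont)
    then show ?thesis unfolding bulk_cmult Bq_def Bp_def Bn_def by simp
  qed
  have "(wave_functional \<sigma> l0 has_real_derivative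
      1 / (6 * c) * ((\<sigma> * -3) * Bf + (- drag s * B + (Bq + 6 * Bp))) + \<sigma> / (2 * c) * ((\<sigma> * -2) * Bn + Bf)) (at s within {0..T})"
    unfolding wave_functional_def[abs_def] by (intro DERIV_add DERIV_cmult d1 d2)
  moreover have "1 / (6 * c) * ((\<sigma> * -3) * Bf + (- drag s * B + (Bq + 6 * Bp))) + \<sigma> / (2 * c) * ((\<sigma> * -2) * Bn + Bf)
      = - drag s * (1 / (6 * c) * B) + bulk (wave_source ?l s)"
  proof -
    have "\<sigma> / (2 * c) * (\<sigma> * -2 * Bn) = - (\<sigma>\<^sup>2 / c) * Bn" using c_pos by (simp add: power2_eq_square)
    then show ?thesis unfolding src \<sigma> using c_pos by (auto simp: field_simps)
  qed
  ultimately show ?thesis by (simp add: B_def)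
qed

section \<open>Duhamel formula for the damped wave equation\<close>

text \<open>
  The Duhamel formula is tied to the final time T; for an earlier final time it is applied to the
  restricted flow.
\<close>
lemma restrict_flow:
  assumes "0 < T'" "T' \<le> T"
  shows "damped_euler_flow A \<gamma> \<mu> lam \<rho>bar M T' \<rho> \<rho>t \<rho>x u ut ux"
proof unfold_locales
  show "C1_slab T' \<rho> \<rho>t \<rho>x" "\<And>i. C1_slab T' (\<lambda>t x. u t x $ i) (ut i) (ux i)"
    using C1_slab_subset[OF C1_\<rho> assms(2)] C1_slab_subset[OF C1_u assms(2)] .
  fix t x assume "t \<in> {0..T'}"
  then have t: "t \<in> {0..T}" using assms by auto
  show "0 < \<rho> t x" using \<rho>_pos[OF t] .
  show "\<rho>t t x + (\<Sum>i\<in>UNIV. (\<rho> t x *\<^sub>R ux i t x + u t x $ i *\<^sub>R \<rho>x t x) $ i) = 0"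
    using mass[OF t] unfolding mx_def .
  show "(\<rho>t t x * u t x $ i + \<rho> t x * ut i t x)
     + (\<Sum>j\<in>UNIV. (\<rho> t x *\<^sub>R ux i t x + u t x $ i *\<^sub>R \<rho>x t x) $ j * u t x $ j + \<rho> t x * u t x $ i * ux j t x $ j)
     + A * \<gamma> * \<rho> t x powr (\<gamma> - 1) * \<rho>x t x $ i = - (\<mu> / (1 + t) powr lam) * (\<rho> t x * u t x $ i)" for i
    using momentum[OF t] unfolding mx_def mt_def m_def drag_def .
qed (use params initially assms in auto)

text \<open>
  The exponential of the integral of the drag from 0 to t; it is bounded in t because lam > 1.
\<close>
definition damp :: "real \<Rightarrow> real"
  where "damp t = exp (\<mu> / (lam - 1) * (1 - (1 + t) powr (1 - lam)))"

lemma damp_bounds: "0 \<le> t \<Longrightarrow> 1 \<le> damp t" "0 \<le> t \<Longrightarrow> damp t \<le> exp (\<mu> / (lam - 1))"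
proof -
  assume t: "0 \<le> t"
  have "(1 + t) powr (1 - lam) \<le> (1 + t) powr 0" using t params by (intro powr_mono) auto
  then have "0 \<le> 1 - (1 + t) powr (1 - lam)" using t by simp
  then show "1 \<le> damp t" unfolding damp_def using params by simp
  have "\<mu> / (lam - 1) * (1 - (1 + t) powr (1 - lam)) \<le> \<mu> / (lam - 1) * 1"
    using params by (intro mult_left_mono) auto
  then show "damp t \<le> exp (\<mu> / (lam - 1))" unfolding damp_def by simp
qed

lemma damp_0: "damp 0 = 1" by (simp add: damp_def)

lemma DERIV_damp:
  assumes "0 \<le> t" shows "(damp has_real_derivative drag t * damp t) (at t within S)"
proof -
  have "((\<lambda>t. (1 + t) powr (1 - lam)) has_real_derivative (1 - lam) * (1 + t) powr (1 - lam - 1) * (0 + 1)) (at t within S)"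
    by (rule DERIV_chain2[OF has_real_derivative_powr DERIV_add[OF DERIV_const DERIV_ident]]) (use assms in auto)
  from DERIV_cmult[OF DERIV_diff[OF DERIV_const this], of "\<mu> / (lam - 1)" 1]
  have "((\<lambda>t. \<mu> / (lam - 1) * (1 - (1 + t) powr (1 - lam))) has_real_derivative
      \<mu> / (lam - 1) * (0 - (1 - lam) * (1 + t) powr (1 - lam - 1) * (0 + 1))) (at t within S)" .
  also have "\<mu> / (lam - 1) * (0 - (1 - lam) * (1 + t) powr (1 - lam - 1) * (0 + 1)) = drag t"
    using params by (simp add: drag_def powr_minus_divide divide_simps)
  finally show ?thesis
    unfolding damp_def[abs_def] using DERIV_chain2[OF DERIV_exp] by (fastforce simp: mult.commute)
qed

lemma half_c: "c / (2 * c) = 1 / 2" "(- c) / (2 * c) = - (1 / 2)"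
  using c_pos by simp_all

text \<open>
  The outgoing weight at level y + c s and the incoming one at level y + 2 c T - c s meet at time T at
  the level y + c T. There the tested momenta cancel, and the two halves of the mass terms add up
  to P(T, y + c T).
\<close>
definition duhamel :: "real \<Rightarrow> real \<Rightarrow> real"
  where "duhamel y s = wave_functional c y s - wave_functional (- c) (y + 2 * c * T) s"

definition duhamel_source :: "real \<Rightarrow> real \<Rightarrow> real"
  where "duhamel_source y s = bulk (\<lambda>x. 1 / c * ((reach (y + c * s) x - reach (y + 2 * c * T - c * s) x) * excess s x))"

context
  fixes y :: real
  assumes y: "0 < y"
begin

lemma pos_out: "s \<in> {0..T} \<Longrightarrow> 0 < y + c * s"
  using y c_pos by (auto intro: add_pos_nonneg)

lemma in_ge: "s \<in> {0..T} \<Longrightarrow> y + c * T \<le> y + 2 * c * T - c * s"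
  using c_pos by simp

lemma pos_in: "s \<in> {0..T} \<Longrightarrow> 0 < (y + 2 * c * T) + (- c) * s"
proof -
  assume s: "s \<in> {0..T}"
  have "c * s \<le> c * T" "0 \<le> c * T" using s T c_pos by auto
  then show ?thesis using y by linarith
qed

lemma duhamel_source_le:
  assumes s: "s \<in> {0..T}"
  shows "duhamel_source y s \<le> bulk (wave_source (y + c * s) s) - bulk (wave_source (y + 2 * c * T + (- c) * s) s)"
proof -
  note o = cont[OF pos_out s] cont_excess[OF pos_out s]
  note i = cont[OF pos_in s]
  let ?o = "y + c * s" and ?i = "y + 2 * c * T + (- c) * s"
  have oi: "0 < ?o" "?o \<le> ?i" using pos_out[OF s] in_ge[OF s] s c_pos by auto
  have co: "continuous_on UNIV (wave_source ?o s)" unfolding wave_source_def by (intro continuous_intros o)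
  have ci: "continuous_on UNIV (wave_source ?i s)" unfolding wave_source_def by (intro continuous_intros i o)
  have c1: "continuous_on UNIV (\<lambda>x. 1 / c * ((reach ?o x - reach ?i x) * excess s x))"
    by (intro continuous_intros o i)
  have "duhamel_source y s + bulk (wave_source ?i s)
     = bulk (\<lambda>x. 1 / c * ((reach (y + c * s) x - reach ?i x) * excess s x) + wave_source ?i s x)"
    unfolding duhamel_source_def
    using bulk_add[OF c1 ci] by simp
  also have "\<dots> \<le> bulk (wave_source ?o s)"
  proof (rule bulk_mono[OF _ co])
    show "continuous_on UNIV (\<lambda>x. 1 / c * ((reach (y + c * s) x - reach ?i x) * excess s x) + wave_source ?i s x)"
      by (intro continuous_on_add c1 ci)
    fix x
    let ?Q = "\<lambda>l. push l x * (norm (u s x))\<^sup>2 + push_slope l x * (x \<bullet> u s x)\<^sup>2"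
    have "1 / (6 * c) * (\<rho> s x * ?Q ?i) \<le> 1 / (6 * c) * (\<rho> s x * ?Q ?o)"
      using push_form_antimono[OF oi, of x "u s x"] \<rho>_pos[OF s, of x] c_pos
      by (intro mult_left_mono) auto
    then show "1 / c * ((reach (y + c * s) x - reach ?i x) * excess s x) + wave_source ?i s x \<le> wave_source ?o s x"
      unfolding wave_source_def by (simp add: left_diff_distrib diff_divide_distrib)
  qed
  finally show ?thesis by simp
qed

text \<open>
  The drag acts only on the tested momentum, which is the functional minus the average of P over the two
  characteristics. Moving that average to the right-hand side makes the drag term a multiple of
  the functional itself, to be absorbed by the integrating factor.
\<close>
lemma duhamel_deriv:
  assumes s: "s \<in> {0..T}"
  shows "(duhamel y has_real_derivative - drag s * duhamel y s
      + drag s / 2 * (P s (y + c * s) + P s (y + 2 * c * T - c * s))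
      + (bulk (wave_source (y + c * s) s) - bulk (wave_source (y + 2 * c * T + (- c) * s) s))) (at s within {0..T})"
proof -
  have "(duhamel y has_real_derivative
      (- drag s * (1 / (6 * c) * bulk (\<lambda>x. push (y + c * s) x * radial_momentum s x))
      + bulk (wave_source (y + c * s) s))
      - (- drag s * (1 / (6 * c) * bulk (\<lambda>x. push (y + 2 * c * T + (- c) * s) x * radial_momentum s x))
      + bulk (wave_source (y + 2 * c * T + (- c) * s) s))) (at s within {0..T})"
    unfolding duhamel_def[abs_def]
    by (intro DERIV_diff wave_functional_deriv[OF pos_out _ s] wave_functional_deriv[OF pos_in _ s]) simp_all
  moreover have "duhamel y s = 1 / (6 * c) * bulk (\<lambda>x. push (y + c * s) x * radial_momentum s x)
      - 1 / (6 * c) * bulk (\<lambda>x. push (y + 2 * c * T + (- c) * s) x * radial_momentum s x)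
      + (P s (y + c * s) + P s (y + 2 * c * T - c * s)) / 2"
    unfolding duhamel_def wave_functional_def half_c by simp
  then have "drag s * duhamel y s = drag s * (1 / (6 * c) * bulk (\<lambda>x. push (y + c * s) x * radial_momentum s x))
      - drag s * (1 / (6 * c) * bulk (\<lambda>x. push (y + 2 * c * T + (- c) * s) x * radial_momentum s x))
      + drag s / 2 * (P s (y + c * s) + P s (y + 2 * c * T - c * s))"
    by (simp only: distrib_left right_diff_distrib) (simp add: distrib_left)
  ultimately show ?thesis by (elim DERIV_cong) linarith
qed

lemma duhamel_end: "duhamel y T = P T (y + c * T)"
proof -
  have "y + 2 * c * T + (- c) * T = y + c * T" by simp
  then show ?thesis unfolding duhamel_def wave_functional_def using c_pos by (simp only:) (simp add: field_simps)
qed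

text \<open>
  The derivative of the tested initial momentum in l is - 3 times the quantity q1.
\<close>
lemma bulk_push_antimono:
  assumes q1: "\<And>l. y < l \<Longrightarrow> 0 \<le> integral UNIV (\<lambda>x. shell_flux l x * radial_momentum 0 x)" and yl: "y \<le> l'"
  shows "bulk (\<lambda>x. push l' x * radial_momentum 0 x) \<le> bulk (\<lambda>x. push y x * radial_momentum 0 x)"
proof -
  have crm: "continuous_on UNIV (radial_momentum 0)" using cont_rm[OF pos_out, of 0] T by simp
  have rm0: "radial_momentum 0 x = 0" if "norm x > max_radius" for x
    using at_rest'(3)[of 0 x] that T by (simp add: radial_momentum_def)
  have d: "((\<lambda>l. bulk (\<lambda>x. push l x * radial_momentum 0 x)) has_field_derivative
      bulk (\<lambda>x. - 3 * shell_flux l x * radial_momentum 0 x)) (at l within {y..l'})" if l: "l \<in> {y..l'}" for l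
    unfolding bulk_def
  proof (rule leibniz_rule_field_derivative)
    fix l and x :: "real^3" assume "l \<in> {y..l'}"
    then have "0 < l" using y by auto
    then show "((\<lambda>l. push l x * radial_momentum 0 x) has_field_derivative - 3 * shell_flux l x * radial_momentum 0 x) (at l within {y..l'})"
      using DERIV_cmult_right[OF has_field_derivative_at_within[OF DERIV_push]] by blast
  next
    fix l assume "l \<in> {y..l'}"
    then have "0 < l" using y by auto
    then have "continuous_on UNIV (\<lambda>x::real^3. push l x)" by (intro continuous_on_weights continuous_intros)
    then show "(\<lambda>x. push l x * radial_momentum 0 x) integrable_on cbox (vec (- (max_radius + 1))) (vec (max_radius + 1))"
      by (intro bulk_integrable continuous_on_mult crm)
  next
    have "continuous_on ({y..l'} \<times> UNIV) (\<lambda>z. shell_flux (fst z) (snd z :: real^3))"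
      by (rule continuous_on_weights(3)) (use y in \<open>auto intro!: continuous_intros\<close>)
    then have "continuous_on ({y..l'} \<times> UNIV) (\<lambda>z. - 3 * shell_flux (fst z) (snd z) * radial_momentum 0 (snd z))"
      by (intro continuous_on_mult continuous_on_const continuous_on_compose2[OF crm] continuous_on_snd continuous_on_id) auto
    then show "continuous_on ({y..l'} \<times> cbox (vec (- (max_radius + 1))) (vec (max_radius + 1)))
        (\<lambda>(l, x). - 3 * shell_flux l x * radial_momentum 0 x)"
      unfolding case_prod_beta by (rule continuous_on_subset) auto
  qed (use l in auto)
  show ?thesis
  proof (rule DERIV_nonpos_imp_decreasing_open[OF yl])
    show "continuous_on {y..l'} (\<lambda>l. bulk (\<lambda>x. push l x * radial_momentum 0 x))"
      by (rule DERIV_continuous_on[OF d])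
    fix l assume l: "y < l" "l < l'"
    have "bulk (\<lambda>x. - 3 * shell_flux l x * radial_momentum 0 x) = - 3 * bulk (\<lambda>x. shell_flux l x * radial_momentum 0 x)"
      unfolding bulk_cmult[symmetric] by (simp add: mult.assoc)
    also have "bulk (\<lambda>x. shell_flux l x * radial_momentum 0 x) = integral UNIV (\<lambda>x. shell_flux l x * radial_momentum 0 x)"
      by (rule bulk_eq_integral_UNIV) (simp add: rm0)
    finally have "bulk (\<lambda>x. - 3 * shell_flux l x * radial_momentum 0 x) \<le> 0" using q1[OF l(1)] by simp
    then show "\<exists>d. ((\<lambda>l. bulk (\<lambda>x. push l x * radial_momentum 0 x)) has_real_derivative d) (at l) \<and> d \<le> 0"
      using d[of l] l by (auto simp: at_within_Icc_at)
  qed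
qed

text \<open>
  An arbitrary integrable minorant g of the integrand is admitted, so that neither the source nor the drag
  term has to be integrated exactly.
\<close>
lemma duhamel_inequality:
  assumes q0: "\<And>l. y \<le> l \<Longrightarrow> 0 \<le> P 0 l"
    and q1: "\<And>l. y < l \<Longrightarrow> 0 \<le> integral UNIV (\<lambda>x. shell_flux l x * radial_momentum 0 x)"
    and g: "g integrable_on {0..T}"
    and le: "\<And>s. s \<in> {0..T} \<Longrightarrow> g s \<le> damp s * (drag s / 2 * (P s (y + c * s) + P s (y + 2 * c * T - c * s)) + duhamel_source y s)"
  shows "P 0 y / 2 + integral {0..T} g \<le> damp T * P T (y + c * T)"
proof -
  define G where "G s = damp s * (drag s / 2 * (P s (y + c * s) + P s (y + 2 * c * T - c * s))
      + (bulk (wave_source (y + c * s) s) - bulk (wave_source (y + 2 * c * T + (- c) * s) s)))" for s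
  have "((\<lambda>s. damp s * duhamel y s) has_real_derivative G s) (at s within {0..T})" if s: "s \<in> {0..T}" for s
    by (rule DERIV_cong[OF DERIV_mult'[OF DERIV_damp duhamel_deriv[OF s]]])
       (use s in \<open>auto simp: G_def algebra_simps\<close>)
  then have "(G has_integral damp T * duhamel y T - damp 0 * duhamel y 0) {0..T}"
    using T by (intro fundamental_theorem_of_calculus) (auto simp: has_real_derivative_iff_has_vector_derivative)
  then have "integral {0..T} g \<le> damp T * duhamel y T - damp 0 * duhamel y 0"
  proof (rule has_integral_le[OF integrable_integral[OF g]])
    fix s assume s: "s \<in> {0..T}"
    have "g s \<le> damp s * (drag s / 2 * (P s (y + c * s) + P s (y + 2 * c * T - c * s)) + duhamel_source y s)"
      using le[OF s] .
    also have "\<dots> \<le> G s"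
      unfolding G_def using duhamel_source_le[OF s] damp_bounds(1)[of s] s by (intro mult_left_mono add_left_mono) auto
    finally show "g s \<le> G s" .
  qed
  moreover have "P 0 y / 2 \<le> duhamel y 0"
  proof -
    have yT: "y \<le> y + 2 * c * T" using c_pos T by simp
    have "duhamel y 0 = 1 / (6 * c) * bulk (\<lambda>x. push y x * radial_momentum 0 x)
      - 1 / (6 * c) * bulk (\<lambda>x. push (y + 2 * c * T) x * radial_momentum 0 x)
      + P 0 y / 2 + P 0 (y + 2 * c * T) / 2"
      unfolding duhamel_def wave_functional_def half_c by simp
    moreover have "1 / (6 * c) * bulk (\<lambda>x. push (y + 2 * c * T) x * radial_momentum 0 x)
      \<le> 1 / (6 * c) * bulk (\<lambda>x. push y x * radial_momentum 0 x)"
      using bulk_push_antimono[OF q1 yT] c_pos by (intro mult_left_mono) auto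
    ultimately show ?thesis using q0[OF yT] by linarith
  qed
  ultimately show ?thesis unfolding duhamel_end damp_0 by simp
qed

end

lemma P_zero: "s \<in> {0..T} \<Longrightarrow> 0 < l \<Longrightarrow> M + c * s \<le> l \<Longrightarrow> P s l = 0"
proof -
  assume s: "s \<in> {0..T}" and l: "0 < l" "M + c * s \<le> l"
  have "shell_weight l x * n s x = 0" for x :: "real^3"
  proof (cases "norm x \<le> l")
    case True
    then show ?thesis using l by (simp add: shell_weight_def reach_eq_0)
  qed (use l at_rest(1)[OF s] in simp)
  then show "P s l = 0" unfolding P_def by (simp only: integral_0)
qed

lemma continuous_on_P:
  assumes "0 < a"
  shows "continuous_on ({0..T} \<times> {a..b}) (\<lambda>z. P (fst z) (snd z))"
proof -
  have w: "continuous_on (({0..T} \<times> {a..b}) \<times> UNIV) (\<lambda>z. shell_weight (snd (fst z)) (snd z :: real^3))"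
    by (rule continuous_on_weights(2)) (use assms in \<open>auto intro!: continuous_intros\<close>)
  have n: "continuous_on (({0..T} \<times> {a..b}) \<times> UNIV) (\<lambda>z. n (fst (fst z)) (snd z))"
    by (rule continuous_on_compose2[OF C1_slabD(1)[OF C1_n], of _ "\<lambda>z. (fst (fst z), snd z)", simplified])
       (auto intro!: continuous_intros)
  have "continuous_on ({0..T} \<times> {a..b}) (\<lambda>z. bulk (\<lambda>x. shell_weight (snd z) x * n (fst z) x))"
    unfolding bulk_def
    by (rule integral_continuous_on_param)
       (auto simp: case_prod_beta intro!: continuous_on_subset[OF continuous_on_mult[OF w n]])
  then show ?thesis by (rule continuous_on_eq) (auto simp: P_eq_bulk)
qed

lemma bulk_nonneg: "continuous_on UNIV f \<Longrightarrow> (\<And>x. 0 \<le> f x) \<Longrightarrow> 0 \<le> bulk f"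
  unfolding bulk_def by (intro integral_nonneg bulk_integrable)

lemma duhamel_source_nonneg:
  assumes y: "0 < y" and s: "s \<in> {0..T}"
  shows "0 \<le> duhamel_source y s"
  unfolding duhamel_source_def
proof (rule bulk_nonneg)
  have i: "y + 2 * c * T - c * s = y + 2 * c * T + (- c) * s" by simp
  show "continuous_on UNIV (\<lambda>x. 1 / c * ((reach (y + c * s) x - reach (y + 2 * c * T - c * s) x) * excess s x))"
    unfolding i
    by (intro continuous_intros cont[OF pos_out[OF y] s] cont[OF pos_in[OF y] s] cont_excess[OF pos_out[OF y] s])
  fix x :: "real^3"
  have "reach (y + 2 * c * T - c * s) x \<le> reach (y + c * s) x"
    using pos_out[OF y s] in_ge[OF y s] c_pos s by (intro reach_antimono) auto
  then show "0 \<le> 1 / c * ((reach (y + c * s) x - reach (y + 2 * c * T - c * s) x) * excess s x)"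
    using c_pos excess_nonneg[OF s] by auto
qed

text \<open>
  If P \<ge> \<nu> on the whole domain of dependence, the drag term alone integrates to
  \<nu> (damp T - 1).
\<close>
lemma duhamel_lower_bound:
  assumes y: "0 < y" and q0: "\<And>l. y \<le> l \<Longrightarrow> 0 \<le> P 0 l"
    and q1: "\<And>l. y < l \<Longrightarrow> 0 \<le> integral UNIV (\<lambda>x. shell_flux l x * radial_momentum 0 x)"
    and \<nu>: "\<And>s l. s \<in> {0..T} \<Longrightarrow> y + c * s \<le> l \<Longrightarrow> \<nu> \<le> P s l"
  shows "\<nu> * (damp T - 1) \<le> damp T * P T (y + c * T)"
proof -
  have I: "((\<lambda>s. \<nu> * (drag s * damp s)) has_integral \<nu> * (damp T - damp 0)) {0..T}"
    using T DERIV_damp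
    by (intro has_integral_mult_right fundamental_theorem_of_calculus)
       (auto simp flip: has_real_derivative_iff_has_vector_derivative)
  have g: "(\<lambda>s. \<nu> * (drag s * damp s)) integrable_on {0..T}"
    and ig: "integral {0..T} (\<lambda>s. \<nu> * (drag s * damp s)) = \<nu> * (damp T - 1)"
    using has_integral_integrable[OF I] integral_unique[OF I] unfolding damp_0 .
  have "P 0 y / 2 + integral {0..T} (\<lambda>s. \<nu> * (drag s * damp s)) \<le> damp T * P T (y + c * T)"
  proof (rule duhamel_inequality[OF y q0 q1 g])
    fix s assume s: "s \<in> {0..T}"
    have "y + c * s \<le> y + 2 * c * T - c * s" using in_ge[OF y s] s c_pos by (auto intro: order_trans)
    then have "\<nu> + \<nu> \<le> P s (y + c * s) + P s (y + 2 * c * T - c * s)"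
      using \<nu>[OF s] by (intro add_mono) auto
    then have "drag s / 2 * (\<nu> + \<nu>) \<le> drag s / 2 * (P s (y + c * s) + P s (y + 2 * c * T - c * s))"
      using drag_nonneg[of s] s by (intro mult_left_mono) auto
    also have "\<dots> \<le> drag s / 2 * (P s (y + c * s) + P s (y + 2 * c * T - c * s)) + duhamel_source y s"
      using duhamel_source_nonneg[OF y s] by simp
    finally have "damp s * (drag s / 2 * (\<nu> + \<nu>))
        \<le> damp s * (drag s / 2 * (P s (y + c * s) + P s (y + 2 * c * T - c * s)) + duhamel_source y s)"
      using damp_bounds(1)[of s] s by (intro mult_left_mono) auto
    then show "\<nu> * (drag s * damp s)
        \<le> damp s * (drag s / 2 * (P s (y + c * s) + P s (y + 2 * c * T - c * s)) + duhamel_source y s)"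
      by (simp add: mult_ac)
  qed
  then show ?thesis using q0[OF order_refl] unfolding ig by linarith
qed

text \<open>
  P attains its minimum over the compact part l \<le> U of the region y0 + c s \<le> l, and it vanishes for
  l > U. If the minimum \<nu> were negative and attained at time s', the lower bound for the flow up to s' would give
  \<nu> (damp s' - 1) \<le> damp s' \<nu>, that is, \<nu> \<ge> 0. The region is closed under both backward
  characteristics, so no smaller l ever enters.
\<close>
lemma P_nonneg:
  assumes y0: "0 < y0" and q0: "\<And>l. y0 \<le> l \<Longrightarrow> 0 \<le> P 0 l"
    and q1: "\<And>l. y0 < l \<Longrightarrow> 0 \<le> integral UNIV (\<lambda>x. shell_flux l x * radial_momentum 0 x)"
    and t: "t \<in> {0..T}" and l: "y0 + c * t \<le> l"
  shows "0 \<le> P t l"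
proof -
  define U where "U = max (M + c * T) (y0 + c * T)"
  define S where "S = {z \<in> {0..T} \<times> {y0..U}. y0 + c * fst z \<le> snd z}"
  have far: "P s l = 0" if "s \<in> {0..T}" "U < l" for s l
  proof (rule P_zero[OF that(1)])
    have "c * s \<le> c * T" using that c_pos by auto
    then show "M + c * s \<le> l" using that by (simp add: U_def)
    have "0 < y0 + c * T" using y0 c_pos T by (simp add: add_pos_nonneg)
    then show "0 < l" using that by (simp add: U_def)
  qed
  have y0le: "y0 \<le> y0 + c * s" if "s \<in> {0..T}" for s using that c_pos by simp
  have memS: "(s, l) \<in> S" if "s \<in> {0..T}" "y0 + c * s \<le> l" "l \<le> U" for s l
    using that y0le[of s] by (auto simp: S_def)
  have C: "compact S"
  proof -
    have "S = ({0..T} \<times> {y0..U}) \<inter> {z. y0 + c * fst z \<le> snd z}" by (auto simp: S_def)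
    moreover have "closed {z :: real \<times> real. y0 + c * fst z \<le> snd z}"
      by (intro closed_Collect_le continuous_intros)
    ultimately show ?thesis by (simp add: compact_Int_closed compact_Times)
  qed
  have K: "continuous_on S (\<lambda>z. P (fst z) (snd z))"
    by (rule continuous_on_subset[OF continuous_on_P[OF y0]]) (auto simp: S_def)
  have N: "S \<noteq> {}" 
  proof -
    have "y0 \<le> U" using y0le[of T] T by (simp add: U_def le_max_iff_disj)
    then have "(0, y0) \<in> S" using T by (intro memS) auto
    then show ?thesis by blast
  qed
  from continuous_attains_inf[OF C N K] obtain z where z: "z \<in> S" and zmin: "\<And>z'. z' \<in> S \<Longrightarrow> P (fst z) (snd z) \<le> P (fst z') (snd z')"
    by blast
  define s' where "s' = fst z"
  define l' where "l' = snd z"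
  have s': "s' \<in> {0..T}" and l': "y0 + c * s' \<le> l'" using z by (auto simp: S_def s'_def l'_def)
  have nn: "0 \<le> P s' l'"
  proof (cases "s' = 0")
    case True
    then show ?thesis using q0 l' by simp
  next
    case False
    then have sp: "0 < s'" "s' \<le> T" using s' by auto
    show ?thesis
    proof (rule ccontr)
      assume neg: "\<not> 0 \<le> P s' l'"
      interpret S: damped_euler_flow A \<gamma> \<mu> lam \<rho>bar M s' \<rho> \<rho>t \<rho>x u ut ux
        by (rule restrict_flow[OF sp], rule c_def, rule n_def, rule drag_def, rule m_def, rule mt_def, rule mx_def)
      \<comment> \<open>Beyond U the function P is zero, hence above the negative minimum.\<close>
      have low: "P s' l' \<le> P s l" if "s \<in> {0..s'}" "(l' - c * s') + c * s \<le> l" for s l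
      proof (cases "l \<le> U")
        case True
        have "(s, l) \<in> S" using that l' s' True by (intro memS) auto
        from zmin[OF this] show ?thesis by (simp add: s'_def l'_def)
      next
        case False
        then show ?thesis using far[of s l] that s' neg by auto
      qed
      have "P s' l' * (damp s' - 1) \<le> damp s' * P s' ((l' - c * s') + c * s')"
      proof (rule S.duhamel_lower_bound)
        show "0 < l' - c * s'" using l' y0 by simp
      qed (use l' q0 q1 low in auto)
      then have "0 \<le> P s' l'" by (simp add: algebra_simps)
      then show False using neg by simp
    qed
  qed
  show ?thesis
  proof (cases "l \<le> U")
    case True
    then show ?thesis using zmin[OF memS[OF t l True]] nn by (simp add: s'_def l'_def)
  qed (use far[OF t] in simp)
qed

section \<open>Superlinear growth along outgoing characteristics\<close>

lemma bulk_has_integral: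
  assumes "continuous_on UNIV f" "\<And>x. norm x > max_radius \<Longrightarrow> f x = 0"
  shows "(f has_integral bulk f) UNIV"
proof (rule has_integral_on_superset)
  show "(f has_integral bulk f) (cbox (vec (- (max_radius + 1))) (vec (max_radius + 1)))"
    unfolding bulk_def by (rule integrable_integral[OF bulk_integrable[OF assms(1)]])
  show "f x = 0" if "x \<notin> cbox (vec (- (max_radius + 1))) (vec (max_radius + 1))" for x
    using that bulk_box by (intro assms(2)) (force simp: not_less)
qed simp

text \<open>
  The tangent line of the excess at the perturbation z. Integrating it against the weight with a
  suitable z is Jensen's inequality, without normalising the weight to a probability measure.
\<close>
lemma excess_tangent:
  assumes s: "s \<in> {0..T}" and z: "0 < z"
  defines "\<beta> \<equiv> A * \<gamma> * ((\<rho>bar + z) powr (\<gamma> - 1) - \<rho>bar powr (\<gamma> - 1))"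
  shows "\<beta> * n s x - (\<beta> * z - excess_fun A \<gamma> \<rho>bar z) \<le> excess s x"
    and "0 \<le> \<beta>" and "0 \<le> \<beta> * z - excess_fun A \<gamma> \<rho>bar z"
proof -
  show "\<beta> * n s x - (\<beta> * z - excess_fun A \<gamma> \<rho>bar z) \<le> excess s x"
    using excess_above_tangent[OF s, of "\<rho>bar + z" x] z params
    by (simp add: excess_fun_def \<beta>_def n_def algebra_simps)
  have "\<rho>bar powr (\<gamma> - 1) \<le> (\<rho>bar + z) powr (\<gamma> - 1)" using z params by (intro powr_mono2) auto
  then show "0 \<le> \<beta>" unfolding \<beta>_def using params by auto
  have "A * ((\<rho>bar + z) powr \<gamma> + \<gamma> * (\<rho>bar + z) powr (\<gamma> - 1) * (\<rho>bar - (\<rho>bar + z))) \<le> A * \<rho>bar powr \<gamma>"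
    using z params by (intro mult_left_mono powr_above_tangent) auto
  then show "0 \<le> \<beta> * z - excess_fun A \<gamma> \<rho>bar z"
    by (simp add: excess_fun_def \<beta>_def algebra_simps)
qed

text \<open>
  A constant for which the integral of the weight over the shell between the radii y + c s and M + c s is at
  most shell_const y * (1 + s).
\<close>
definition shell_const :: "real \<Rightarrow> real"
  where "shell_const y = 4 * pi * (M - y) ^ 3 * (M / y) * (M + c)"

lemma shell_const_pos: "0 < y \<Longrightarrow> y < M \<Longrightarrow> 0 < shell_const y"
  using params c_pos by (simp add: shell_const_def)

lemma shell_volume_bound:
  assumes y: "0 < y" "y < M" and s: "0 \<le> s"
  shows "(M - y)\<^sup>2 / (y + c * s) * (4 / 3 * pi * ((M + c * s) ^ 3 - (y + c * s) ^ 3)) \<le> shell_const y * (1 + s)"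
proof -
  define a b where "a = y + c * s" and "b = M + c * s"
  have cs: "0 \<le> c * s" using c_pos s by simp
  have ab: "0 < a" "a \<le> b" "b - a = M - y" using y cs by (auto simp: a_def b_def)
  have "b ^ 3 - a ^ 3 = (M - y) * (b\<^sup>2 + b * a + a\<^sup>2)"
    unfolding ab(3)[symmetric] by (simp add: power2_eq_square power3_eq_cube algebra_simps)
  also have "\<dots> \<le> (M - y) * (3 * b\<^sup>2)"
  proof (rule mult_left_mono)
    have "b * a \<le> b * b" "a * a \<le> b * b" using ab by (auto intro: mult_mono)
    then show "b\<^sup>2 + b * a + a\<^sup>2 \<le> 3 * b\<^sup>2" by (simp add: power2_eq_square)
  qed (use y in simp)
  finally have "4 / 3 * pi * (b ^ 3 - a ^ 3) \<le> 4 / 3 * pi * ((M - y) * (3 * b\<^sup>2))"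
    by (intro mult_left_mono) auto
  then have "(M - y)\<^sup>2 / a * (4 / 3 * pi * (b ^ 3 - a ^ 3)) \<le> (M - y)\<^sup>2 / a * (4 / 3 * pi * ((M - y) * (3 * b\<^sup>2)))"
    using ab by (intro mult_left_mono) auto
  also have "\<dots> = 4 * pi * (M - y) ^ 3 * (b / a) * b"
    by (simp add: power2_eq_square power3_eq_cube)
  also have "\<dots> \<le> 4 * pi * (M - y) ^ 3 * (M / y) * ((M + c) * (1 + s))"
  proof (intro mult_mono)
    have "b * y \<le> M * a" using mult_left_mono[OF less_imp_le[OF y(2)] cs] by (simp add: a_def b_def algebra_simps)
    then show "b / a \<le> M / y" using y ab by (simp add: divide_simps mult_ac)
    have "0 \<le> M * s" using params s by simp
    then show "b \<le> (M + c) * (1 + s)" using c_pos by (simp add: b_def algebra_simps)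
  qed (use y ab in auto)
  finally show ?thesis by (simp add: a_def b_def shell_const_def mult_ac)
qed

text \<open>
  W bounds the total mass of the weight on the shell, so z = P / W is a lower bound for the mean
  of n. Since the tangent line at z has slope \<beta> \<ge> 0 and intercept at most 0, replacing the exact
  mass by W preserves the inequality.
\<close>
lemma jensen_excess:
  assumes y: "0 < y" "y < M" and s: "s \<in> {0..T}" and p: "0 < P s (y + c * s)"
  defines "W \<equiv> shell_const y * (1 + s)"
  shows "W * excess_fun A \<gamma> \<rho>bar (P s (y + c * s) / W) \<le> bulk (\<lambda>x. shell_weight (y + c * s) x * excess s x)"
proof -
  let ?l = "y + c * s" and ?p = "P s (y + c * s)"
  have W: "0 < W" using shell_const_pos[OF y] s by (simp add: W_def)
  define z where "z = ?p / W"
  have z: "0 < z" using p W by (simp add: z_def)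
  define \<beta> where "\<beta> = A * \<gamma> * ((\<rho>bar + z) powr (\<gamma> - 1) - \<rho>bar powr (\<gamma> - 1))"
  note tan = excess_tangent[OF s z, folded \<beta>_def]
  let ?\<delta> = "\<beta> * z - excess_fun A \<gamma> \<rho>bar z"
  have lpos: "0 < ?l" using pos_out[OF y(1) s] .
  define D where "D = cball (0 :: real^3) (M + c * s) - ball 0 ?l"
  define \<kappa> where "\<kappa> = (M - y)\<^sup>2 / ?l"
  have \<kappa>: "0 \<le> \<kappa>" using lpos by (simp add: \<kappa>_def)
  note c1 = cont[OF pos_out[OF y(1)] s] cont_excess[OF pos_out[OF y(1)] s]
  have i1: "((\<lambda>x. shell_weight ?l x * n s x) has_integral ?p) UNIV"
    unfolding P_eq_bulk[OF s] by (rule bulk_has_integral) (auto intro!: continuous_intros c1 simp: at_rest'(1)[OF s])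
  have i2: "((\<lambda>x. shell_weight ?l x * excess s x) has_integral bulk (\<lambda>x. shell_weight ?l x * excess s x)) UNIV"
    by (rule bulk_has_integral) (auto intro!: continuous_intros c1 simp: excess_def at_rest'(1,4)[OF s])
  have i3: "(indicat_real D has_integral 4 / 3 * pi * ((M + c * s) ^ 3 - ?l ^ 3)) UNIV"
    unfolding D_def using y lpos by (intro shell_volume) auto
  \<comment> \<open>Off the shell both sides vanish: inside, the weight does; outside, the flow is at rest.\<close>
  have "\<beta> * ?p - ?\<delta> * (\<kappa> * (4 / 3 * pi * ((M + c * s) ^ 3 - ?l ^ 3))) \<le> bulk (\<lambda>x. shell_weight ?l x * excess s x)"
  proof (rule has_integral_le[OF has_integral_diff[OF has_integral_mult_right[OF i1]
          has_integral_mult_right[OF has_integral_mult_right[OF i3]]] i2])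
    fix x :: "real^3"
    consider "norm x < ?l" | "norm x > M + c * s" | "?l \<le> norm x" "norm x \<le> M + c * s" by linarith
    then show "\<beta> * (shell_weight ?l x * n s x) - ?\<delta> * (\<kappa> * indicat_real D x) \<le> shell_weight ?l x * excess s x"
    proof cases
      case 1
      then show ?thesis using lpos by (simp add: D_def shell_weight_def reach_eq_0)
    next
      case 2
      then show ?thesis using at_rest(1,4)[OF s] by (simp add: D_def excess_def)
    next
      case 3
      have r: "0 < norm x" using 3 lpos by linarith
      have "reach ?l x = (norm x - ?l) / norm x"
        using 3 r by (simp add: reach_def max_def diff_divide_distrib)
      then have "shell_weight ?l x = (norm x - ?l)\<^sup>2 / norm x"
        using r by (simp add: shell_weight_def power_divide power2_eq_square)
      also have "\<dots> \<le> \<kappa>" unfolding \<kappa>_def using 3 lpos y by (intro frac_le power_mono) auto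
      finally have "?\<delta> * shell_weight ?l x \<le> ?\<delta> * \<kappa>" using tan(3) by (intro mult_left_mono)
      moreover have "shell_weight ?l x * (\<beta> * n s x - ?\<delta>) \<le> shell_weight ?l x * excess s x"
        by (intro mult_left_mono tan(1)) (simp add: shell_weight_def)
      moreover have "indicat_real D x = 1" using 3 by (simp add: D_def)
      ultimately show ?thesis by (simp add: algebra_simps)
    qed
  qed
  moreover have "?\<delta> * (\<kappa> * (4 / 3 * pi * ((M + c * s) ^ 3 - ?l ^ 3))) \<le> ?\<delta> * W"
    unfolding \<kappa>_def W_def using shell_volume_bound[OF y] s tan(3) by (intro mult_left_mono) auto
  moreover have "\<beta> * ?p - ?\<delta> * W = W * excess_fun A \<gamma> \<rho>bar z"
    using W by (simp add: z_def algebra_simps)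
  ultimately show ?thesis unfolding z_def by linarith
qed

lemma duhamel_source_lower:
  assumes y: "0 < y" "y < M" and s: "s \<in> {0..T}"
  shows "1 / c * (min 1 (2 * c / (M - y) * (T - s)) / (M - y) * bulk (\<lambda>x. shell_weight (y + c * s) x * excess s x))
    \<le> duhamel_source y s"
proof -
  have i: "y + 2 * c * T - c * s = y + 2 * c * T + (- c) * s" by simp
  note c1 = cont[OF pos_out[OF y(1)] s] cont_excess[OF pos_out[OF y(1)] s] cont[OF pos_in[OF y(1)] s]
  let ?k = "min 1 (2 * c / (M - y) * (T - s)) / (M - y)"
  have "bulk (\<lambda>x. 1 / c * (?k * (shell_weight (y + c * s) x * excess s x))) \<le> duhamel_source y s"
    unfolding duhamel_source_def
  proof (rule bulk_mono)
    show "continuous_on UNIV (\<lambda>x. 1 / c * (?k * (shell_weight (y + c * s) x * excess s x)))"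
      by (intro continuous_intros c1) (use y in auto)
    show "continuous_on UNIV (\<lambda>x. 1 / c * ((reach (y + c * s) x - reach (y + 2 * c * T - c * s) x) * excess s x))"
      unfolding i by (intro continuous_intros c1)
    fix x :: "real^3"
    show "1 / c * (?k * (shell_weight (y + c * s) x * excess s x))
      \<le> 1 / c * ((reach (y + c * s) x - reach (y + 2 * c * T - c * s) x) * excess s x)"
    proof (cases "norm x \<le> M + c * s")
      case True
      have "min 1 (2 * c * (T - s) / (M - y)) / (M - y) * shell_weight (y + c * s) x
        \<le> reach (y + c * s) x - reach (y + c * s + 2 * c * (T - s)) x"
        using True y s c_pos pos_out[OF y(1) s] by (intro reach_gap) auto
      moreover have "y + c * s + 2 * c * (T - s) = y + 2 * c * T - c * s" by (simp add: algebra_simps)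
      ultimately have "?k * shell_weight (y + c * s) x \<le> reach (y + c * s) x - reach (y + 2 * c * T - c * s) x"
        by simp
      from mult_right_mono[OF this excess_nonneg[OF s, of x]]
      show ?thesis using c_pos by (intro mult_left_mono) (auto simp: mult.assoc)
    next
      case False
      then show ?thesis using at_rest(1,4)[OF s, of x] by (simp add: excess_def)
    qed
  qed
  then show ?thesis by (simp only: bulk_cmult)
qed

definition damp_max :: real where "damp_max = exp (\<mu> / (lam - 1))"

lemma damp_max_ge_1: "1 \<le> damp_max" using params by (simp add: damp_max_def)

definition growth_const :: "real \<Rightarrow> real \<Rightarrow> real \<Rightarrow> real \<Rightarrow> real"
  where "growth_const y p0 C e = C / shell_const y * (1 / p0 + 1 / shell_const y) powr (- e) / (c * (M - y))"

context
  fixes y :: real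
  assumes y: "0 < y" "y < M"
    and q0: "\<And>l. y \<le> l \<Longrightarrow> 0 \<le> P 0 l"
    and q1: "\<And>l. y < l \<Longrightarrow> 0 \<le> integral UNIV (\<lambda>x. shell_flux l x * radial_momentum 0 x)"
begin

lemma P_sum_nonneg:
  assumes s: "s \<in> {0..T}"
  shows "0 \<le> drag s / 2 * (P s (y + c * s) + P s (y + 2 * c * T - c * s))"
proof -
  have "y + c * s \<le> y + 2 * c * T - c * s" using in_ge[OF y(1) s] s c_pos by (auto intro: order_trans)
  then show ?thesis using P_nonneg[OF y(1) q0 q1 s] drag_nonneg[of s] s by auto
qed

lemma P_lower_end: "P 0 y / 2 \<le> damp_max * P T (y + c * T)"
proof -
  have "P 0 y / 2 + integral {0..T} (\<lambda>_. 0) \<le> damp T * P T (y + c * T)"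
  proof (rule duhamel_inequality[OF y(1) q0 q1])
    fix s assume s: "s \<in> {0..T}"
    show "0 \<le> damp s * (drag s / 2 * (P s (y + c * s) + P s (y + 2 * c * T - c * s)) + duhamel_source y s)"
      using P_sum_nonneg[OF s] duhamel_source_nonneg[OF y(1) s] damp_bounds(1)[of s] s by auto
  qed auto
  also have "\<dots> \<le> damp_max * P T (y + c * T)"
    unfolding damp_max_def using damp_bounds(2)[of T] T P_nonneg[OF y(1) q0 q1, of T "y + c * T"]
    by (intro mult_right_mono) auto
  finally show ?thesis by simp
qed

end

lemma P_lower:
  assumes y: "0 < y" "y < M"
    and q0: "\<And>l. y \<le> l \<Longrightarrow> 0 \<le> P 0 l"
    and q1: "\<And>l. y < l \<Longrightarrow> 0 \<le> integral UNIV (\<lambda>x. shell_flux l x * radial_momentum 0 x)"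
    and s: "s \<in> {0..T}"
  shows "P 0 y / (2 * damp_max) \<le> P s (y + c * s)"
proof (cases "s = 0")
  case True
  have "P 0 y / (2 * damp_max) \<le> P 0 y / 1"
    using q0[OF order_refl] damp_max_ge_1 by (intro divide_left_mono) auto
  then show ?thesis using True by simp
next
  case False
  then have sp: "0 < s" "s \<le> T" using s by auto
  interpret S: damped_euler_flow A \<gamma> \<mu> lam \<rho>bar M s \<rho> \<rho>t \<rho>x u ut ux
    by (rule restrict_flow[OF sp], rule c_def, rule n_def, rule drag_def, rule m_def, rule mt_def, rule mx_def)
  have "P 0 y / 2 \<le> damp_max * P s (y + c * s)" by (rule S.P_lower_end[OF y q0 q1])
  then show ?thesis using damp_max_ge_1 by (simp add: field_simps)
qed

text \<open>
  By the growth of the excess, W * excess (p / W) is at least a constant times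
  p^2 / W * (1 + p / W)^(- e); the lower bound p \<ge> p0 and W \<ge> shell_const y turn this into
  p^(2 - e) / (1 + s).
\<close>
lemma growth_inequality_end:
  assumes y: "0 < y" "y < M"
    and q0: "\<And>l. y \<le> l \<Longrightarrow> 0 \<le> P 0 l" and P0: "0 < P 0 y"
    and q1: "\<And>l. y < l \<Longrightarrow> 0 \<le> integral UNIV (\<lambda>x. shell_flux l x * radial_momentum 0 x)"
    and e: "0 \<le> e" "e < 1" and C: "0 < C"
    and growth: "\<And>Z. Z > 0 \<Longrightarrow> C * Z\<^sup>2 * (1 + Z) powr (- e) \<le> excess_fun A \<gamma> \<rho>bar Z"
  defines "p0 \<equiv> P 0 y / (2 * damp_max)"
  shows "p0 + integral {0..T} (\<lambda>s. growth_const y p0 C e / damp_max * min 1 (2 * c / (M - y) * (T - s))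
      * P s (y + c * s) powr (2 - e) / (1 + s)) \<le> P T (y + c * T)"
proof -
  let ?p = "\<lambda>s. P s (y + c * s)"
  let ?k = "\<lambda>s. min 1 (2 * c / (M - y) * (T - s))"
  define G where "G = growth_const y p0 C e"
  define g where "g s = G * ?k s * ?p s powr (2 - e) / (1 + s)" for s
  have p0: "0 < p0" using P0 damp_max_ge_1 by (simp add: p0_def)
  have pl: "p0 \<le> ?p s" if "s \<in> {0..T}" for s unfolding p0_def by (rule P_lower[OF y q0 q1 that])
  have contp: "continuous_on {0..T} ?p"
    by (rule DERIV_continuous_on[OF DERIV_P]) (use pos_out[OF y(1)] in auto)
  have contg: "continuous_on {0..T} g"
    unfolding g_def using pl p0 y by (intro continuous_intros contp) force+
  have K: "0 < shell_const y" by (rule shell_const_pos[OF y])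
  have le: "g s \<le> damp s * (drag s / 2 * (P s (y + c * s) + P s (y + 2 * c * T - c * s)) + duhamel_source y s)"
    if s: "s \<in> {0..T}" for s
  proof -
    define W where "W = shell_const y * (1 + s)"
    have W: "0 < W" "shell_const y \<le> W"
      using K s mult_left_mono[of 1 "1 + s" "shell_const y"] by (auto simp: W_def)
    have pp: "0 < ?p s" using pl[OF s] p0 by linarith
    let ?Z = "?p s / W"
    have k0: "0 \<le> ?k s" using y c_pos s by auto
    have "1 + ?Z \<le> (1 / p0 + 1 / shell_const y) * ?p s"
    proof -
      have "1 \<le> (1 / p0) * ?p s" using pl[OF s] p0 by simp
      moreover have "?Z \<le> ?p s / shell_const y" using W K pp by (intro divide_left_mono) auto
      ultimately show ?thesis by (simp add: distrib_right)
    qed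
    then have "((1 / p0 + 1 / shell_const y) * ?p s) powr (- e) \<le> (1 + ?Z) powr (- e)"
      using e pp W by (intro powr_mono2') (auto intro: add_pos_nonneg)
    then have "C * ?Z\<^sup>2 * ((1 / p0 + 1 / shell_const y) * ?p s) powr (- e) \<le> C * ?Z\<^sup>2 * (1 + ?Z) powr (- e)"
      using C by (intro mult_left_mono) auto
    also have "\<dots> \<le> excess_fun A \<gamma> \<rho>bar ?Z" using pp W by (intro growth) auto
    finally have "W * (C * ?Z\<^sup>2 * ((1 / p0 + 1 / shell_const y) * ?p s) powr (- e)) \<le> W * excess_fun A \<gamma> \<rho>bar ?Z"
      using W by (intro mult_left_mono) auto
    also have "\<dots> \<le> bulk (\<lambda>x. shell_weight (y + c * s) x * excess s x)"
      unfolding W_def by (rule jensen_excess[OF y s pp])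
    finally have J: "W * (C * ?Z\<^sup>2 * ((1 / p0 + 1 / shell_const y) * ?p s) powr (- e))
      \<le> bulk (\<lambda>x. shell_weight (y + c * s) x * excess s x)" .
    have sq: "(?p s)\<^sup>2 * ?p s powr (- e) = ?p s powr (2 - e)"
      using pp powr_add[of "?p s" 2 "- e"] by (simp add: powr_numeral)
    have split: "((1 / p0 + 1 / shell_const y) * ?p s) powr (- e)
      = (1 / p0 + 1 / shell_const y) powr (- e) * ?p s powr (- e)"
      by (rule powr_mult)
    have "W * (C * (p / W)\<^sup>2 * (b * p')) = C / W * b * (p\<^sup>2 * p')" for p b p' :: real
      using W by (simp add: power2_eq_square)
    then have J2: "W * (C * ?Z\<^sup>2 * ((1 / p0 + 1 / shell_const y) * ?p s) powr (- e))
      = C / W * (1 / p0 + 1 / shell_const y) powr (- e) * ?p s powr (2 - e)"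
      unfolding split sq[symmetric] .
    have "g s = 1 / c * (?k s / (M - y) * (W * (C * ?Z\<^sup>2 * ((1 / p0 + 1 / shell_const y) * ?p s) powr (- e))))"
      unfolding J2 by (simp add: g_def G_def growth_const_def W_def mult_ac)
    also have "\<dots> \<le> 1 / c * (?k s / (M - y) * bulk (\<lambda>x. shell_weight (y + c * s) x * excess s x))"
      using J k0 y c_pos by (intro mult_left_mono) auto
    also have "\<dots> \<le> duhamel_source y s" by (rule duhamel_source_lower[OF y s])
    also have "\<dots> \<le> drag s / 2 * (P s (y + c * s) + P s (y + 2 * c * T - c * s)) + duhamel_source y s"
      using P_sum_nonneg[OF y q0 q1 s] by simp
    also have "\<dots> \<le> damp s * (drag s / 2 * (P s (y + c * s) + P s (y + 2 * c * T - c * s)) + duhamel_source y s)"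
      using P_sum_nonneg[OF y q0 q1 s] duhamel_source_nonneg[OF y(1) s] damp_bounds(1)[of s] s
      by (intro mult_right_le_one_le[of _ "1", simplified] mult_le_cancel_right1[THEN iffD2]) auto
    finally show ?thesis .
  qed
  have "P 0 y / 2 + integral {0..T} g \<le> damp T * ?p T"
    by (rule duhamel_inequality[OF y(1) q0 q1 integrable_continuous_real[OF contg] le])
  also have "\<dots> \<le> damp_max * ?p T"
    unfolding damp_max_def using damp_bounds(2)[of T] T pl[of T] p0 by (intro mult_right_mono) auto
  finally have "(P 0 y / 2 + integral {0..T} g) / damp_max \<le> ?p T"
    using damp_max_ge_1 by (simp add: divide_le_eq mult.commute)
  moreover have "integral {0..T} (\<lambda>s. G / damp_max * ?k s * ?p s powr (2 - e) / (1 + s)) = integral {0..T} g / damp_max"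
    unfolding g_def by (subst integral_divide[symmetric]) (simp add: field_simps)
  ultimately show ?thesis by (simp add: p0_def G_def add_divide_distrib)
qed

lemma growth_inequality:
  assumes y: "0 < y" "y < M"
    and q0: "\<And>l. y \<le> l \<Longrightarrow> 0 \<le> P 0 l" and P0: "0 < P 0 y"
    and q1: "\<And>l. y < l \<Longrightarrow> 0 \<le> integral UNIV (\<lambda>x. shell_flux l x * radial_momentum 0 x)"
    and e: "0 \<le> e" "e < 1" and C: "0 < C"
    and growth: "\<And>Z. Z > 0 \<Longrightarrow> C * Z\<^sup>2 * (1 + Z) powr (- e) \<le> excess_fun A \<gamma> \<rho>bar Z"
    and t: "t \<in> {0..T}"
  defines "p0 \<equiv> P 0 y / (2 * damp_max)"
  shows "p0 + integral {0..t} (\<lambda>s. growth_const y p0 C e / damp_max * min 1 (2 * c / (M - y) * (t - s))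
      * P s (y + c * s) powr (2 - e) / (1 + s)) \<le> P t (y + c * t)"
proof (cases "t = 0")
  case True
  then show ?thesis using P_lower[OF y q0 q1, of 0] T by (simp add: p0_def)
next
  case False
  then have tp: "0 < t" "t \<le> T" using t by auto
  interpret S: damped_euler_flow A \<gamma> \<mu> lam \<rho>bar M t \<rho> \<rho>t \<rho>x u ut ux
    by (rule restrict_flow[OF tp], rule c_def, rule n_def, rule drag_def, rule m_def, rule mt_def, rule mx_def)
  show ?thesis unfolding p0_def by (rule S.growth_inequality_end[OF y q0 P0 q1 e C growth])
qed

end

text \<open>
  The bound is uniform over all flows with given values of q0 at y: every constant of the growth
  inequality depends on the parameters and on q0(y) alone.
\<close>
lemma flow_lifespan_bound:
  fixes A \<gamma> \<mu> lam \<rho>bar M y Q :: real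
  assumes params: "A > 0" "\<gamma> > 1" "\<rho>bar > 0" "\<mu> > 0" "lam > 1" and y: "0 < y" "y < M" and Q: "0 < Q"
  obtains Tmax where "\<And>T \<rho> \<rho>t \<rho>x u ut ux. \<lbrakk>damped_euler_flow A \<gamma> \<mu> lam \<rho>bar M T \<rho> \<rho>t \<rho>x u ut ux;
      \<And>l. y \<le> l \<Longrightarrow> 0 \<le> integral UNIV (\<lambda>x. shell_weight l x * (\<rho> 0 x - \<rho>bar));
      integral UNIV (\<lambda>x. shell_weight y x * (\<rho> 0 x - \<rho>bar)) = Q;
      \<And>l. y < l \<Longrightarrow> 0 \<le> integral UNIV (\<lambda>x. shell_flux l x * (x \<bullet> (\<rho> 0 x *\<^sub>R u 0 x)))\<rbrakk> \<Longrightarrow> T \<le> Tmax"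
proof -
  obtain C e where C: "C > 0" and e: "0 \<le> e" "e < 1"
    and growth: "\<And>Z. Z > 0 \<Longrightarrow> C * Z\<^sup>2 * (1 + Z) powr (- e) \<le> excess_fun A \<gamma> \<rho>bar Z"
    using excess_fun_growth[OF params(1-3)] by blast
  define c where "c = sqrt (A * \<gamma> * \<rho>bar powr (\<gamma> - 1))"
  have c: "c > 0" using params by (simp add: c_def)
  define E where "E = exp (\<mu> / (lam - 1))"
  define K where "K = 4 * pi * (M - y) ^ 3 * (M / y) * (M + c)"
  define p0 where "p0 = Q / (2 * E)"
  define G where "G = C / K * (1 / p0 + 1 / K) powr (- e) / (c * (M - y))"
  have E: "0 < E" by (simp add: E_def)
  have K: "0 < K" using y c by (simp add: K_def)
  have p0: "0 < p0" using Q E by (simp add: p0_def)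
  have "0 < 1 / p0 + 1 / K" using p0 K by (simp add: add_pos_pos)
  then have G: "0 < G / E" using C K c y E by (simp add: G_def)
  have \<kappa>: "0 < 2 * c / (M - y)" using c y by simp
  have q: "1 < 2 - e" using e by simp
  obtain Tmax where
    Tmax: "\<And>T p. \<lbrakk>0 \<le> T; continuous_on {0..T} p; \<And>t. t \<in> {0..T} \<Longrightarrow>
        p0 + integral {0..t} (\<lambda>s. G / E * min 1 (2 * c / (M - y) * (t - s)) * p s powr (2 - e) / (1 + s)) \<le> p t\<rbrakk>
      \<Longrightarrow> T \<le> Tmax" by (rule superlinear_volterra_blowup[OF p0 G \<kappa> q]) (erule that)
  show ?thesis
  proof (rule that)
    fix T \<rho> \<rho>t \<rho>x u ut ux
    assume flow: "damped_euler_flow A \<gamma> \<mu> lam \<rho>bar M T \<rho> \<rho>t \<rho>x u ut ux"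
      and q0: "\<And>l. y \<le> l \<Longrightarrow> 0 \<le> integral UNIV (\<lambda>x. shell_weight l x * (\<rho> 0 x - \<rho>bar))"
      and Q0: "integral UNIV (\<lambda>x. shell_weight y x * (\<rho> 0 x - \<rho>bar)) = Q"
      and q1: "\<And>l. y < l \<Longrightarrow> 0 \<le> integral UNIV (\<lambda>x. shell_flux l x * (x \<bullet> (\<rho> 0 x *\<^sub>R u 0 x)))"
    define n where "n = (\<lambda>t x. \<rho> t x - \<rho>bar)"
    define drag where "drag = (\<lambda>t. \<mu> / (1 + t) powr lam)"
    define m where "m = (\<lambda>i t x. \<rho> t x * u t x $ i)"
    define mt where "mt = (\<lambda>i t x. \<rho>t t x * u t x $ i + \<rho> t x * ut i t x)"
    define mx where "mx = (\<lambda>i t x. \<rho> t x *\<^sub>R ux i t x + u t x $ i *\<^sub>R \<rho>x t x)"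
    interpret F: damped_euler_flow A \<gamma> \<mu> lam \<rho>bar M T \<rho> \<rho>t \<rho>x u ut ux m mt mx c n drag
      by (rule flow, (rule eq_reflection, rule c_def n_def drag_def m_def mt_def mx_def)+)
    have P: "F.P 0 l = integral UNIV (\<lambda>x. shell_weight l x * (\<rho> 0 x - \<rho>bar))" for l
      by (simp add: F.P_def n_def)
    have rm: "F.radial_momentum 0 x = x \<bullet> (\<rho> 0 x *\<^sub>R u 0 x)" for x
      by (simp add: F.radial_momentum_def m_def inner_vec_def)
    have dm: "F.damp_max = E" by (simp add: F.damp_max_def E_def)
    have sc: "F.shell_const y = K" by (simp add: F.shell_const_def K_def)
    have gc: "F.growth_const y p0 C e = G" by (simp add: F.growth_const_def sc G_def)
    have PQ: "F.P 0 y / (2 * F.damp_max) = p0" by (simp add: P Q0 dm p0_def)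
    show "T \<le> Tmax"
    proof (rule Tmax[of T "\<lambda>t. F.P t (y + c * t)"])
      show "0 \<le> T" using F.T by simp
      show "continuous_on {0..T} (\<lambda>t. F.P t (y + c * t))"
        by (rule DERIV_continuous_on[OF F.DERIV_P]) (use F.pos_out[OF y(1)] in auto)
      fix t assume t: "t \<in> {0..T}"
      show "p0 + integral {0..t} (\<lambda>s. G / E * min 1 (2 * c / (M - y) * (t - s)) * F.P s (y + c * s) powr (2 - e) / (1 + s))
        \<le> F.P t (y + c * t)"
        using F.growth_inequality[OF y _ _ _ e C growth t, unfolded PQ, unfolded gc dm] q0 q1 Q Q0
        unfolding P rm by simp
    qed
  qed
qed

section \<open>From smooth solutions to the lifespan\<close>

lemma linear_eq_inner_partials:
  fixes L :: "real^'n \<Rightarrow> real"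
  assumes "linear L"
  shows "L h = h \<bullet> (\<chi> i. L (axis i 1))"
proof -
  have "L h = L (\<Sum>i\<in>UNIV. h $ i *\<^sub>R axis i 1)"
    using basis_expansion[of h] by (simp add: scalar_mult_eq_scaleR)
  also have "\<dots> = (\<Sum>i\<in>UNIV. h $ i * L (axis i 1))"
    by (simp add: linear_sum[OF assms] linear_scale[OF assms])
  finally show ?thesis by (simp add: inner_vec_def)
qed

lemma C1_slab_of_derivative:
  fixes F :: "real \<times> (real^3) \<Rightarrow> real"
  assumes F: "\<And>z. z \<in> {0..T} \<times> UNIV \<Longrightarrow> (F has_derivative F' z) (at z within {0..T} \<times> UNIV)"
    and cont: "\<And>v. continuous_on ({0..T} \<times> UNIV) (\<lambda>z. F' z v)"
  shows "C1_slab T (\<lambda>t x. F (t, x)) (\<lambda>t x. F' (t, x) (1, 0)) (\<lambda>t x. \<chi> i. F' (t, x) (0, axis i 1))"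
  unfolding C1_slab_def prod.collapse
proof (intro conjI ballI allI)
  show "continuous_on ({0..T} \<times> UNIV) F"
    using F by (rule has_derivative_continuous_on)
  show "continuous_on ({0..T} \<times> UNIV) (\<lambda>z. F' z (1, 0))" by (rule cont)
  show "continuous_on ({0..T} \<times> UNIV) (\<lambda>z. \<chi> i. F' z (0, axis i 1))"
    by (intro continuous_on_vec_lambda cont)
  fix t and x :: "real^3" assume t: "t \<in> {0..T}"
  then have tx: "(t, x) \<in> {0..T} \<times> UNIV" by simp
  have lin: "linear (F' (t, x))" using F[OF tx] by (rule has_derivative_linear)
  have "((\<lambda>s. F (s, x)) has_derivative (\<lambda>h. F' (t, x) (h, 0))) (at t within {0..T})"
    by (rule has_derivative_in_compose2[where g = F and t = "{0..T} \<times> UNIV"])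
       (use F t in \<open>auto intro!: derivative_eq_intros\<close>)
  moreover have "(\<lambda>h. F' (t, x) (h, 0)) = (*) (F' (t, x) (1, 0))"
  proof
    show "F' (t, x) (h, 0) = F' (t, x) (1, 0) * h" for h
      using linear_scale[OF lin, of h "(1, 0)"] by (simp add: mult.commute)
  qed
  ultimately show "((\<lambda>s. F (s, x)) has_real_derivative F' (t, x) (1, 0)) (at t within {0..T})"
    by (simp only: has_field_derivative_def)
  have "((\<lambda>y. F (t, y)) has_derivative (\<lambda>h. F' (t, x) (0, h))) (at x within UNIV)"
    by (rule has_derivative_in_compose2[where g = F and t = "{0..T} \<times> UNIV"])
       (use F t in \<open>auto intro!: derivative_eq_intros\<close>)
  moreover have "F' (t, x) (0, h) = h \<bullet> (\<chi> i. F' (t, x) (0, axis i 1))" for h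
  proof (rule linear_eq_inner_partials)
    have "linear (\<lambda>h. (0 :: real, h :: real^3))" by (intro linearI) auto
    then show "linear (\<lambda>h. F' (t, x) (0, h))" using linear_compose[OF _ lin] by (simp add: o_def)
  qed
  then have "(\<lambda>h. F' (t, x) (0, h)) = (\<lambda>h. h \<bullet> (\<chi> i. F' (t, x) (0, axis i 1)))" by (rule ext)
  ultimately show "GDERIV (\<lambda>x. F (t, x)) x :> (\<chi> i. F' (t, x) (0, axis i 1))"
    by (simp only: gderiv_def)
qed

lemma partial_eq_gradient:
  assumes "GDERIV f x :> D"
  shows "partial i f x = D $ i"
proof -
  have "((\<lambda>h. f (x + h *\<^sub>R axis i 1)) has_derivative (\<lambda>h. (h *\<^sub>R axis i 1) \<bullet> D)) (at 0)"
    by (rule has_derivative_compose[where g = f and f = "\<lambda>h. x + h *\<^sub>R axis i 1"])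
       (use assms in \<open>auto intro!: derivative_eq_intros simp: gderiv_def\<close>)
  then have "((\<lambda>h. f (x + h *\<^sub>R axis i 1)) has_real_derivative D $ i) (at 0)"
    by (simp add: has_field_derivative_def inner_axis' mult_commute_abs)
  then show ?thesis unfolding partial_def by (rule DERIV_imp_deriv)
qed

text \<open>
  The partial derivatives in the definition of a smooth solution are the components of the total
  derivative on the slab, and the conservative form is expanded by the product rule.
\<close>
lemma smooth_solution_flow:
  assumes sol: "smooth_euler_solution A \<gamma> \<mu> lam r0 v0 T \<rho> u" and T: "0 < T"
    and params: "A > 0" "\<gamma> > 1" "\<rho>bar > 0" "\<mu> > 0" "lam > 1" "M > 0"
    and init: "\<And>x. norm x > M \<Longrightarrow> r0 x = \<rho>bar" "\<And>x. norm x > M \<Longrightarrow> v0 x = 0"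
  obtains \<rho>t \<rho>x ut ux where "damped_euler_flow A \<gamma> \<mu> lam \<rho>bar M T \<rho> \<rho>t \<rho>x u ut ux"
proof -
  have "Ck_on (Suc 0) ({0..T} \<times> UNIV) (\<lambda>(t, x). \<rho> t x)" "Ck_on (Suc 0) ({0..T} \<times> UNIV) (\<lambda>(t, x). u t x)"
    using sol unfolding smooth_euler_solution_def smooth_on_def by blast+
  then have CR: "\<exists>f'. (\<forall>z\<in>{0..T} \<times> UNIV. ((\<lambda>(t, x). \<rho> t x) has_derivative f' z) (at z within {0..T} \<times> UNIV))
      \<and> (\<forall>v. continuous_on ({0..T} \<times> UNIV) (\<lambda>z. f' z v))"
    and CU: "\<exists>f'. (\<forall>z\<in>{0..T} \<times> UNIV. ((\<lambda>(t, x). u t x) has_derivative f' z) (at z within {0..T} \<times> UNIV))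
      \<and> (\<forall>v. continuous_on ({0..T} \<times> UNIV) (\<lambda>z. f' z v))"
    by (simp_all only: Ck_on.simps)
  from CR obtain R' where
    R: "\<And>z. z \<in> {0..T} \<times> UNIV \<Longrightarrow> ((\<lambda>(t, x). \<rho> t x) has_derivative R' z) (at z within {0..T} \<times> UNIV)"
      "\<And>v. continuous_on ({0..T} \<times> UNIV) (\<lambda>z. R' z v)" by (elim exE conjE) (rule that, (erule bspec spec, assumption?)+)
  from CU obtain U' where
    U: "\<And>z. z \<in> {0..T} \<times> UNIV \<Longrightarrow> ((\<lambda>(t, x). u t x) has_derivative U' z) (at z within {0..T} \<times> UNIV)"
      "\<And>v. continuous_on ({0..T} \<times> UNIV) (\<lambda>z. U' z v)" by (elim exE conjE) (rule that, (erule bspec spec, assumption?)+)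
  define \<rho>t where "\<rho>t = (\<lambda>t x. R' (t, x) (1, 0))"
  define \<rho>x where "\<rho>x = (\<lambda>t x. (\<chi> i. R' (t, x) (0, axis i 1)) :: real^3)"
  define ut where "ut = (\<lambda>i t x. U' (t, x) (1, 0) $ i)"
  define ux where "ux = (\<lambda>i t x. (\<chi> j. U' (t, x) (0, axis j 1) $ i) :: real^3)"
  have C\<rho>: "C1_slab T \<rho> \<rho>t \<rho>x"
    using C1_slab_of_derivative[OF R] by (simp add: \<rho>t_def \<rho>x_def)
  have Cu: "C1_slab T (\<lambda>t x. u t x $ i) (ut i) (ux i)" for i
  proof -
    have "((\<lambda>z. (case z of (t, x) \<Rightarrow> u t x) $ i) has_derivative (\<lambda>v. U' z v $ i)) (at z within {0..T} \<times> UNIV)"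
      if "z \<in> {0..T} \<times> UNIV" for z
      by (rule bounded_linear.has_derivative[OF bounded_linear_vec_nth U(1)[OF that]])
    moreover have "continuous_on ({0..T} \<times> UNIV) (\<lambda>z. U' z v $ i)" for v
      by (intro continuous_intros U(2))
    ultimately show ?thesis
      using C1_slab_of_derivative[of T "\<lambda>z. (case z of (t, x) \<Rightarrow> u t x) $ i" "\<lambda>z v. U' z v $ i"]
      by (simp add: ut_def ux_def)
  qed
  have pos: "0 < \<rho> t x" if "t \<in> {0..T}" for t x
    using sol that unfolding smooth_euler_solution_def by blast
  define m where "m = (\<lambda>i t x. \<rho> t x * u t x $ i)"
  define mt where "mt = (\<lambda>i t x. \<rho>t t x * u t x $ i + \<rho> t x * ut i t x)"
  define mx where "mx = (\<lambda>i t x. \<rho> t x *\<^sub>R ux i t x + u t x $ i *\<^sub>R \<rho>x t x)"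
  have Cm: "C1_slab T (m i) (mt i) (mx i)" for i
    unfolding m_def mt_def mx_def by (rule C1_slab_mult[OF C\<rho> Cu])
  have vd: "vector_derivative f (at t within {0..T}) = f'"
    if "(f has_vector_derivative f') (at t within {0..T})" "t \<in> {0..T}" for f :: "real \<Rightarrow> 'z::real_normed_vector" and f' t
    using vector_derivative_within_cbox[OF T, of t f f'] that by (simp add: cbox_interval)
  have mass: "\<rho>t t x + (\<Sum>i\<in>UNIV. mx i t x $ i) = 0" if t: "t \<in> {0..T}" for t x
  proof -
    have "time_deriv T \<rho> t x = \<rho>t t x"
      unfolding time_deriv_def using C1_slabD(4)[OF C\<rho> t, of x] t
      by (intro vd) (auto simp: has_real_derivative_iff_has_vector_derivative)
    moreover have "divergence (\<lambda>y. \<rho> t y *\<^sub>R u t y) x = (\<Sum>i\<in>UNIV. mx i t x $ i)"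
      unfolding divergence_def
    proof (rule sum.cong[OF refl])
      fix i :: 3
      show "partial i (\<lambda>y. (\<rho> t y *\<^sub>R u t y) $ i) x = mx i t x $ i"
        using partial_eq_gradient[OF C1_slabD(5)[OF Cm t], of i] by (simp add: m_def)
    qed
    moreover have "time_deriv T \<rho> t x + divergence (\<lambda>y. \<rho> t y *\<^sub>R u t y) x = 0"
      using sol t unfolding smooth_euler_solution_def by blast
    ultimately show ?thesis by simp
  qed
  have momentum: "mt i t x + (\<Sum>j\<in>UNIV. mx i t x $ j * u t x $ j + m i t x * ux j t x $ j)
        + A * \<gamma> * \<rho> t x powr (\<gamma> - 1) * \<rho>x t x $ i = - (\<mu> / (1 + t) powr lam) * m i t x"
    if t: "t \<in> {0..T}" for t x i
  proof -
    have "((\<lambda>s. u s x) has_vector_derivative U' (t, x) (1, 0)) (at t within {0..T})"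
    proof -
      have "((\<lambda>s. (\<lambda>(t, x). u t x) (s, x)) has_derivative (\<lambda>h. U' (t, x) (h, 0))) (at t within {0..T})"
        by (rule has_derivative_in_compose2[where t = "{0..T} \<times> UNIV"])
           (use U(1) t in \<open>auto intro!: derivative_eq_intros\<close>)
      moreover have lin: "linear (U' (t, x))"
        by (rule has_derivative_linear[OF U(1)]) (use t in simp)
      have "(\<lambda>h. U' (t, x) (h, 0)) = (\<lambda>h. h *\<^sub>R U' (t, x) (1, 0))"
      proof
        show "U' (t, x) (h, 0) = h *\<^sub>R U' (t, x) (1, 0)" for h
          using linear_scale[OF lin, of h "(1, 0)"] by simp
      qed
      ultimately show ?thesis by (simp only: has_vector_derivative_def prod.case)
    qed
    from has_vector_derivative_scaleR[OF C1_slabD(4)[OF C\<rho> t] this]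
    have "time_deriv T (\<lambda>s y. \<rho> s y *\<^sub>R u s y) t x = \<rho> t x *\<^sub>R U' (t, x) (1, 0) + \<rho>t t x *\<^sub>R u t x"
      unfolding time_deriv_def by (intro vd t)
    then have td: "time_deriv T (\<lambda>s y. \<rho> s y *\<^sub>R u s y) t x $ i = mt i t x"
      by (simp add: mt_def ut_def)
    let ?p = "\<lambda>y. A * \<rho> t y powr \<gamma>"
    have dp: "GDERIV ?p x :> (A * \<gamma> * \<rho> t x powr (\<gamma> - 1)) *\<^sub>R \<rho>x t x"
    proof -
      have "((\<lambda>r. A * r powr \<gamma>) has_real_derivative A * (\<gamma> * \<rho> t x powr (\<gamma> - 1))) (at (\<rho> t x))"
        by (intro DERIV_cmult has_real_derivative_powr pos t)
      from GDERIV_DERIV_compose[OF C1_slabD(5)[OF C\<rho> t] this] show ?thesis by (simp add: mult.assoc)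
    qed
    have md: "matrix_divergence (\<lambda>y. \<rho> t y *\<^sub>R (u t y \<otimes>\<^sub>v u t y) + pressure A \<gamma> (\<rho> t y) *\<^sub>R mat 1) x $ i
      = (\<Sum>j\<in>UNIV. mx i t x $ j * u t x $ j + m i t x * ux j t x $ j) + A * \<gamma> * \<rho> t x powr (\<gamma> - 1) * \<rho>x t x $ i"
    proof -
      have "partial j (\<lambda>y. (\<rho> t y *\<^sub>R (u t y \<otimes>\<^sub>v u t y) + pressure A \<gamma> (\<rho> t y) *\<^sub>R mat 1) $ i $ j) x
        = (mx i t x $ j * u t x $ j + m i t x * ux j t x $ j)
          + (if i = j then A * \<gamma> * \<rho> t x powr (\<gamma> - 1) * \<rho>x t x $ j else 0)" for j
      proof -
        define \<delta> :: real where "\<delta> = (if i = j then 1 else 0)"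
        have "(\<lambda>y. (\<rho> t y *\<^sub>R (u t y \<otimes>\<^sub>v u t y) + pressure A \<gamma> (\<rho> t y) *\<^sub>R mat 1) $ i $ j)
          = (\<lambda>y. m i t y * u t y $ j + ?p y * \<delta>)"
          by (auto simp: tensor_def pressure_def mat_def m_def \<delta>_def)
        moreover have "GDERIV (\<lambda>y. m i t y * u t y $ j + ?p y * \<delta>) x :>
           (m i t x *\<^sub>R ux j t x + u t x $ j *\<^sub>R mx i t x)
             + (?p x *\<^sub>R 0 + \<delta> *\<^sub>R ((A * \<gamma> * \<rho> t x powr (\<gamma> - 1)) *\<^sub>R \<rho>x t x))"
          by (intro GDERIV_add GDERIV_mult GDERIV_const dp C1_slabD(5)[OF Cm t] C1_slabD(5)[OF Cu t])
        ultimately show ?thesis by (simp add: partial_eq_gradient \<delta>_def mult_ac)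
      qed
      then show ?thesis by (simp add: matrix_divergence_def divergence_def sum.distrib)
    qed
    have "time_deriv T (\<lambda>s y. \<rho> s y *\<^sub>R u s y) t x
        + matrix_divergence (\<lambda>y. \<rho> t y *\<^sub>R (u t y \<otimes>\<^sub>v u t y) + pressure A \<gamma> (\<rho> t y) *\<^sub>R mat 1) x
        = - (\<mu> / (1 + t) powr lam) *\<^sub>R (\<rho> t x *\<^sub>R u t x)"
      using sol t unfolding smooth_euler_solution_def by blast
    from arg_cong[OF this, of "\<lambda>v. v $ i"] show ?thesis
      unfolding vector_add_component td md by (simp add: m_def add.assoc)
  qed
  have "damped_euler_flow A \<gamma> \<mu> lam \<rho>bar M T \<rho> \<rho>t \<rho>x u ut ux"
  proof unfold_locales
    have "\<rho> 0 x = r0 x" "u 0 x = v0 x" for x using sol unfolding smooth_euler_solution_def by blast+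
    then show "\<rho> 0 x = \<rho>bar" "u 0 x = 0" if "norm x > M" for x
      using init[OF that] by (simp_all only:)
    show "C1_slab T \<rho> \<rho>t \<rho>x" "\<And>i. C1_slab T (\<lambda>t x. u t x $ i) (ut i) (ux i)" by (fact C\<rho> Cu)+
    fix t x assume t: "t \<in> {0..T}"
    show "0 < \<rho> t x" using pos[OF t] .
    show "\<rho>t t x + (\<Sum>i\<in>UNIV. (\<rho> t x *\<^sub>R ux i t x + u t x $ i *\<^sub>R \<rho>x t x) $ i) = 0"
      using mass[OF t] unfolding mx_def .
    show "(\<rho>t t x * u t x $ i + \<rho> t x * ut i t x)
     + (\<Sum>j\<in>UNIV. (\<rho> t x *\<^sub>R ux i t x + u t x $ i *\<^sub>R \<rho>x t x) $ j * u t x $ j + \<rho> t x * u t x $ i * ux j t x $ j)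
     + A * \<gamma> * \<rho> t x powr (\<gamma> - 1) * \<rho>x t x $ i = - (\<mu> / (1 + t) powr lam) * (\<rho> t x * u t x $ i)" for i
      using momentum[OF t] unfolding mx_def mt_def m_def .
  qed (fact params T)+
  then show ?thesis by (rule that)
qed

lemma set_integral_eq_integral_UNIV:
  fixes g :: "'a::euclidean_space \<Rightarrow> real"
  assumes g: "continuous_on UNIV g" and R: "\<And>x. norm x > R \<Longrightarrow> g x = 0"
    and S: "\<And>x. x \<in> S \<Longrightarrow> f x = g x" "\<And>x. x \<notin> S \<Longrightarrow> g x = 0"
  shows "(LINT x:S|lborel. f x) = integral UNIV g"
proof -
  have "integrable lborel (\<lambda>x. indicator (cball 0 R) x *\<^sub>R g x)"
    by (rule borel_integrable_compact) (auto intro: continuous_on_subset[OF g])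
  moreover have "(\<lambda>x. indicator (cball 0 R) x *\<^sub>R g x) = g"
  proof
    show "indicator (cball 0 R) x *\<^sub>R g x = g x" for x using R[of x] by (cases "norm x \<le> R") auto
  qed
  ultimately have "integrable lborel g" by (simp only:)
  moreover have "(\<lambda>x. indicator S x *\<^sub>R f x) = g"
  proof
    show "indicator S x *\<^sub>R f x = g x" for x using S[of x] by (cases "x \<in> S") auto
  qed
  ultimately show ?thesis unfolding set_lebesgue_integral_def by (simp only: integral_lborel)
qed

lemma q0_eq_shell_weight:
  assumes l: "0 < l" and cont: "continuous_on UNIV r0" and R: "\<And>x. norm x > R \<Longrightarrow> r0 x = \<rho>bar"
  shows "q0 \<rho>bar r0 l = integral UNIV (\<lambda>x. shell_weight l x * (r0 x - \<rho>bar))"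
  unfolding q0_def
proof (rule set_integral_eq_integral_UNIV[where R = R])
  show "continuous_on UNIV (\<lambda>x. shell_weight l x * (r0 x - \<rho>bar))"
    using l by (intro continuous_intros continuous_on_weights cont) auto
  fix x :: "real^3"
  show "(norm x - l)\<^sup>2 / norm x * (r0 x - \<rho>bar) = shell_weight l x * (r0 x - \<rho>bar)" if "x \<in> {x. l < norm x}"
  proof -
    have r: "0 < norm x" "l \<le> norm x" using that l by auto
    then have "reach l x = (norm x - l) / norm x" by (simp add: reach_def max_def diff_divide_distrib)
    then show ?thesis using r by (simp add: shell_weight_def power_divide power2_eq_square)
  qed
  show "shell_weight l x * (r0 x - \<rho>bar) = 0" if "x \<notin> {x. l < norm x}"
    using that l by (simp add: shell_weight_def reach_eq_0)
qed (simp add: R)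

lemma q1_eq_shell_flux:
  assumes l: "0 < l" and cont: "continuous_on UNIV r0" "continuous_on UNIV v0" and R: "\<And>x. norm x > R \<Longrightarrow> v0 x = 0"
  shows "q1 r0 v0 l = integral UNIV (\<lambda>x. shell_flux l x * (x \<bullet> (r0 x *\<^sub>R v0 x)))"
  unfolding q1_def
proof (rule set_integral_eq_integral_UNIV[where R = R])
  show "continuous_on UNIV (\<lambda>x. shell_flux l x * (x \<bullet> (r0 x *\<^sub>R v0 x)))"
    using l by (intro continuous_intros continuous_on_weights cont) auto
  fix x :: "real^3"
  show "((norm x)\<^sup>2 - l\<^sup>2) / (norm x) ^ 3 * (x \<bullet> (r0 x *\<^sub>R v0 x)) = shell_flux l x * (x \<bullet> (r0 x *\<^sub>R v0 x))"
    if "x \<in> {x. l < norm x}"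
  proof -
    have r: "0 < norm x" "l \<le> norm x" using that l by auto
    then have "shell_flux l x = (2 * (1 - l / norm x) - (1 - l / norm x)\<^sup>2) / norm x"
      by (simp add: shell_flux_def reach_def max_def)
    also have "\<dots> = ((norm x)\<^sup>2 - l\<^sup>2) / (norm x) ^ 3"
      using r by (simp add: field_simps power2_eq_square power3_eq_cube)
    finally show ?thesis by simp
  qed
  show "shell_flux l x * (x \<bullet> (r0 x *\<^sub>R v0 x)) = 0" if "x \<notin> {x. l < norm x}"
    using that l by (simp add: shell_flux_def reach_eq_0)
qed (simp add: R)

lemma supp_outside:
  assumes "supp f \<subseteq> {x. norm x \<le> M}" "norm x > M"
  shows "f x = 0"
proof (rule ccontr)
  assume "f x \<noteq> 0"
  then have "x \<in> supp f" unfolding supp_def by (intro subsetD[OF closure_subset]) simp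
  then have "norm x \<le> M" using assms(1) by blast
  then show False using assms(2) by simp
qed

theorem theorem1p2:
  fixes A \<gamma> \<mu> lam \<rho>bar M M0 :: real
    and \<rho>0 :: "real^3 \<Rightarrow> real" and u0 :: "real^3 \<Rightarrow> real^3"
  assumes "A > 0" and "\<gamma> > 1" and "\<rho>bar > 0" and "\<mu> > 0" and "lam > 1"
    and "smooth_compact_support \<rho>0" and "smooth_compact_support u0"
    and "\<not> ((\<forall>x. \<rho>0 x = 0) \<and> (\<forall>x. u0 x = 0))"
    and "supp \<rho>0 \<subseteq> {x. norm x \<le> M}" and "supp u0 \<subseteq> {x. norm x \<le> M}"
    and "0 \<le> M0" and "M0 < M"
    and "\<forall>\<^sub>F \<epsilon> in at_right 0. \<forall>x. init_density \<rho>bar \<rho>0 \<epsilon> x > 0"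
    and "\<forall>\<^sub>F \<epsilon> in at_right 0. \<forall>l\<in>{M0<..<M}.
           q0 \<rho>bar (init_density \<rho>bar \<rho>0 \<epsilon>) l > 0 \<and>
           q1 (init_density \<rho>bar \<rho>0 \<epsilon>) (init_velocity u0 \<epsilon>) l \<ge> 0"
  shows "\<exists>\<epsilon>0>0. \<forall>\<epsilon>. 0 < \<epsilon> \<and> \<epsilon> \<le> \<epsilon>0 \<longrightarrow>
           lifespan A \<gamma> \<mu> lam (init_density \<rho>bar \<rho>0 \<epsilon>) (init_velocity u0 \<epsilon>) < \<infinity>"
proof -
  obtain b where b: "b > 0" and q: "\<And>\<epsilon> l. \<lbrakk>0 < \<epsilon>; \<epsilon> < b; l \<in> {M0<..<M}\<rbrakk> \<Longrightarrow>
      q0 \<rho>bar (init_density \<rho>bar \<rho>0 \<epsilon>) l > 0 \<and>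
      q1 (init_density \<rho>bar \<rho>0 \<epsilon>) (init_velocity u0 \<epsilon>) l \<ge> 0"
  proof -
    from assms(14) obtain b where "b > 0" and "\<forall>\<epsilon>>0. \<epsilon> < b \<longrightarrow> (\<forall>l\<in>{M0<..<M}.
           q0 \<rho>bar (init_density \<rho>bar \<rho>0 \<epsilon>) l > 0 \<and>
           q1 (init_density \<rho>bar \<rho>0 \<epsilon>) (init_velocity u0 \<epsilon>) l \<ge> 0)"
      unfolding eventually_at_right_field by blast
    then show thesis by (intro that) blast+
  qed
  have M: "M > 0" using assms by simp
  have "Ck_on 0 UNIV \<rho>0" "Ck_on 0 UNIV u0"
    using assms(6,7) unfolding smooth_compact_support_def smooth_on_def by blast+
  then have c0: "continuous_on UNIV \<rho>0" "continuous_on UNIV u0" by (simp_all only: Ck_on.simps)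
  have fin: "lifespan A \<gamma> \<mu> lam (init_density \<rho>bar \<rho>0 \<epsilon>) (init_velocity u0 \<epsilon>) < \<infinity>"
    if \<epsilon>: "0 < \<epsilon>" "\<epsilon> < b" for \<epsilon>
  proof -
    define r0 where "r0 = init_density \<rho>bar \<rho>0 \<epsilon>"
    define v0 where "v0 = init_velocity u0 \<epsilon>"
    have cr: "continuous_on UNIV r0" and cv: "continuous_on UNIV v0"
      unfolding r0_def v0_def init_density_def init_velocity_def by (intro continuous_intros c0)+
    have r0: "r0 x = \<rho>bar" and v0: "v0 x = 0" if "norm x > M" for x
      using supp_outside[OF assms(9) that] supp_outside[OF assms(10) that]
      by (simp_all add: r0_def v0_def init_density_def init_velocity_def)
    \<comment> \<open>Any level strictly between M0 and M would do.\<close>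
    define y where "y = (M0 + M) / 2"
    have y: "0 < y" "y < M" "M0 < y" using assms by (auto simp: y_def)
    define W where "W l = integral UNIV (\<lambda>x. shell_weight l x * (r0 x - \<rho>bar))" for l
    define F where "F l = integral UNIV (\<lambda>x. shell_flux l x * (x \<bullet> (r0 x *\<^sub>R v0 x)))" for l
    have in0: "0 < W l" "0 \<le> F l" if "M0 < l" "l < M" for l
    proof -
      have l: "0 < l" using that assms by simp
      have "W l = q0 \<rho>bar r0 l" unfolding W_def by (rule q0_eq_shell_weight[OF l cr r0, symmetric])
      moreover have "F l = q1 r0 v0 l" unfolding F_def by (rule q1_eq_shell_flux[OF l cr cv v0, symmetric])
      ultimately show "0 < W l" "0 \<le> F l"
        using q[OF \<epsilon>, of l] that unfolding r0_def v0_def by simp_all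
    qed
    \<comment> \<open>The sign conditions on (M0, M) extend to all larger l, because both quantities vanish beyond M.\<close>
    have out0: "W l = 0" "F l = 0" if "M \<le> l" for l
    proof -
      have "shell_weight l x * (r0 x - \<rho>bar) = 0" "shell_flux l x * (x \<bullet> (r0 x *\<^sub>R v0 x)) = 0" for x
        using that M r0[of x] v0[of x]
        by (cases "norm x \<le> l"; simp add: shell_weight_def shell_flux_def reach_eq_0)+
      then show "W l = 0" "F l = 0" unfolding W_def F_def by (simp_all only: integral_0)
    qed
    have W0: "0 \<le> W l" and F0: "0 \<le> F l" if "y \<le> l" for l
      using in0[of l] out0[of l] that y(3) by (cases "l < M"; simp)+
    obtain Tmax where Tmax: "\<And>T \<rho> \<rho>t \<rho>x u ut ux. \<lbrakk>damped_euler_flow A \<gamma> \<mu> lam \<rho>bar M T \<rho> \<rho>t \<rho>x u ut ux;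
      \<And>l. y \<le> l \<Longrightarrow> 0 \<le> integral UNIV (\<lambda>x. shell_weight l x * (\<rho> 0 x - \<rho>bar));
      integral UNIV (\<lambda>x. shell_weight y x * (\<rho> 0 x - \<rho>bar)) = W y;
      \<And>l. y < l \<Longrightarrow> 0 \<le> integral UNIV (\<lambda>x. shell_flux l x * (x \<bullet> (\<rho> 0 x *\<^sub>R u 0 x)))\<rbrakk> \<Longrightarrow> T \<le> Tmax"
      by (rule flow_lifespan_bound[OF assms(1-5) y(1,2) in0(1)[OF y(3,2)]]) (erule that)
    have "T \<le> Tmax" if T: "0 < T" and sol: "smooth_euler_solution A \<gamma> \<mu> lam r0 v0 T \<rho> u" for T \<rho> u
    proof -
      obtain \<rho>t \<rho>x ut ux where flow: "damped_euler_flow A \<gamma> \<mu> lam \<rho>bar M T \<rho> \<rho>t \<rho>x u ut ux"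
        by (rule smooth_solution_flow[OF sol T assms(1-5) M]) (erule r0 v0 that)+
      have "\<rho> 0 = r0" "u 0 = v0" using sol unfolding smooth_euler_solution_def by blast+
      then show ?thesis
        by (intro Tmax[OF flow])
           (simp_all only: W_def[symmetric] F_def[symmetric] W0 F0 less_imp_le)
    qed
    then have "lifespan A \<gamma> \<mu> lam r0 v0 \<le> ennreal Tmax"
      unfolding lifespan_def by (intro Sup_least) (auto intro: ennreal_leI)
    also have "\<dots> < \<infinity>" by simp
    finally show ?thesis unfolding r0_def v0_def .
  qed
  show ?thesis
    by (rule exI[of _ "b / 2"]) (use b fin in auto)
qed

end
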